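(* The following two problems are NP-hard (under polynomial-time many-one, i.e. Karp, reductions). (1) Membership in the cut polytope: given $n$ and a symmetric $n\times n$ rational matrix $\Gamma$, decide whether $\Gamma\in\mathsf{CUT}(n)$. (2) Rank for the cut polytope: given a positive integer $\rho$ and a symmetric $n\times n$ rational matrix $\Gamma$ promised to belong to $\mathsf{CUT}(n)$, decide whether $\Gamma$ is a convex combination of at most $\rho$ matrices of the form $yy^{\top}$ with $y\in\{-1,1\}^n$.
   Context: The cut polytope $\mathsf{CUT}(n)$ is the convex hull of $\{yy^{\top} : y\in\{-1,1\}^n\}$. A promise means that every instance satisfies the stated condition (the weights of a decomposition are not part of the input); a promise problem is NP-hard if every language in NP has a polynomial-time many-one reduction to it whose outputs always satisfy the promise. *)

theory Defs
  imports "Jordan_Normal_Form.Matrix" "HOL-Computational_Algebra.Polynomial"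
begin

section \<open>Polynomial time and NP\<close>

text \<open>
  The machine model is the deterministic multi-tape Turing machine with two-way infinite tapes.
  States and tape symbols are initial segments of the natural numbers; symbol 0 is the blank,
  symbols 1 and 2 are the input bits, and any further symbols are work symbols.
\<close>

datatype move = Move_Left | Stay | Move_Right

record tm =
  tm_tapes :: nat
  tm_symbols :: nat
  tm_states :: nat
  tm_start :: nat
  tm_accept :: nat
  tm_reject :: nat
  tm_delta :: "nat \<Rightarrow> nat list \<Rightarrow> nat \<times> (nat \<times> move) list"

definition wf_tm :: "tm \<Rightarrow> bool" where
  "wf_tm M \<longleftrightarrow>
     1 \<le> tm_tapes M \<and> 3 \<le> tm_symbols M \<and>
     tm_start M < tm_states M \<and> tm_accept M < tm_states M \<and> tm_reject M < tm_states M \<and>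
     tm_accept M \<noteq> tm_reject M \<and>
     (\<forall>q ss. q < tm_states M \<and> length ss = tm_tapes M \<and> set ss \<subseteq> {..<tm_symbols M} \<longrightarrow>
        (case tm_delta M q ss of (q', as) \<Rightarrow>
           q' < tm_states M \<and> length as = tm_tapes M \<and> fst ` set as \<subseteq> {..<tm_symbols M}))"

text \<open>A tape is its head position together with its contents.\<close>

type_synonym tape = "int \<times> (int \<Rightarrow> nat)"
type_synonym config = "nat \<times> tape list"

fun read_tape :: "tape \<Rightarrow> nat" where
  "read_tape (h, t) = t h"

fun move_head :: "move \<Rightarrow> int \<Rightarrow> int" where
  "move_head Move_Left h = h - 1"
| "move_head Stay h = h"
| "move_head Move_Right h = h + 1"

fun act_tape :: "nat \<times> move \<Rightarrow> tape \<Rightarrow> tape" where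
  "act_tape (s, m) (h, t) = (move_head m h, t(h := s))"

definition halted :: "tm \<Rightarrow> config \<Rightarrow> bool" where
  "halted M c \<longleftrightarrow> fst c = tm_accept M \<or> fst c = tm_reject M"

text \<open>Halting configurations are fixed by a step, so halting within \<open>t\<close> steps means
  being in a halting configuration after exactly \<open>t\<close> steps.\<close>

definition tm_step :: "tm \<Rightarrow> config \<Rightarrow> config" where
  "tm_step M c =
     (if halted M c then c
      else case tm_delta M (fst c) (map read_tape (snd c)) of
             (q', as) \<Rightarrow> (q', map2 act_tape as (snd c)))"

fun bit_symbol :: "bool \<Rightarrow> nat" where
  "bit_symbol False = 1"
| "bit_symbol True = 2"

definition word_contents :: "bool list \<Rightarrow> int \<Rightarrow> nat" where
  "word_contents w i = (if 0 \<le> i \<and> i < int (length w) then bit_symbol (w ! nat i) else 0)"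

definition tm_init :: "tm \<Rightarrow> bool list list \<Rightarrow> config" where
  "tm_init M ws =
     (tm_start M,
      map (\<lambda>i. (0, word_contents (if i < length ws then ws ! i else []))) [0..<tm_tapes M])"

definition tm_run :: "tm \<Rightarrow> bool list list \<Rightarrow> nat \<Rightarrow> config" where
  "tm_run M ws t = (tm_step M ^^ t) (tm_init M ws)"

text \<open>The output is the word that starts at the final head position of the first tape; the
  rest of that tape must be blank.\<close>

fun tape_holds :: "tape \<Rightarrow> bool list \<Rightarrow> bool" where
  "tape_holds (h, t) w \<longleftrightarrow> (\<forall>i. t (h + i) = word_contents w i)"

definition polytime_computable :: "(bool list \<Rightarrow> bool list) \<Rightarrow> bool" where
  "polytime_computable f \<longleftrightarrow>
     (\<exists>M. \<exists>p :: nat poly. wf_tm M \<and>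
        (\<forall>x. halted M (tm_run M [x] (poly p (length x))) \<and>
             tape_holds (snd (tm_run M [x] (poly p (length x))) ! 0) (f x)))"

text \<open>Languages in NP are those with a polynomial-time verifier for certificates of polynomial
  length. The verifier gets the input on its first tape and the certificate on its second.\<close>

definition NP_languages :: "bool list set set" where
  "NP_languages =
     {L. \<exists>M. \<exists>p q :: nat poly. wf_tm M \<and> 2 \<le> tm_tapes M \<and>
           (\<forall>x w. halted M (tm_run M [x, w] (poly p (length x + length w)))) \<and>
           (\<forall>x. x \<in> L \<longleftrightarrow>
              (\<exists>w. length w \<le> poly q (length x) \<and>
                   fst (tm_run M [x, w] (poly p (length x + length w))) = tm_accept M))}"

text \<open>A promise problem is the pair of its yes-instances and its no-instances; a word in neither
  set violates the promise (or is not the encoding of an instance at all).\<close>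

type_synonym promise_problem = "bool list set \<times> bool list set"

definition promise_problem_of ::
    "('a \<Rightarrow> bool list) \<Rightarrow> ('a \<Rightarrow> bool) \<Rightarrow> ('a \<Rightarrow> bool) \<Rightarrow> promise_problem" where
  "promise_problem_of enc promise question =
     ({enc a | a. promise a \<and> question a}, {enc a | a. promise a \<and> \<not> question a})"

definition karp_reducible :: "bool list set \<Rightarrow> promise_problem \<Rightarrow> bool" where
  "karp_reducible L P \<longleftrightarrow>
     (\<exists>f. polytime_computable f \<and>
        (\<forall>x. (x \<in> L \<longrightarrow> f x \<in> fst P) \<and> (x \<notin> L \<longrightarrow> f x \<in> snd P)))"

definition NP_hard :: "promise_problem \<Rightarrow> bool" where
  "NP_hard P \<longleftrightarrow> (\<forall>L \<in> NP_languages. karp_reducible L P)"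


section \<open>The cut polytope\<close>

definition sign_vecs :: "nat \<Rightarrow> real vec set" where
  "sign_vecs n = {y \<in> carrier_vec n. \<forall>i<n. y $ i \<in> {-1, 1}}"

text \<open>The matrix $y y^{\top}$.\<close>

definition outer_self :: "real vec \<Rightarrow> real mat" where
  "outer_self y = mat (dim_vec y) (dim_vec y) (\<lambda>(i, j). y $ i * y $ j)"

definition cut_matrices :: "nat \<Rightarrow> real mat set" where
  "cut_matrices n = outer_self ` sign_vecs n"

text \<open>The type of matrices of all dimensions is not a real vector space, so convex combinations of
  \<open>n \<times> n\<close> matrices are spelled out.\<close>

definition convex_combination :: "nat \<Rightarrow> real mat set \<Rightarrow> real mat \<Rightarrow> bool" where
  "convex_combination n S X \<longleftrightarrow>
     finite S \<and>
     (\<exists>w. (\<forall>Y\<in>S. 0 \<le> w Y) \<and> sum w S = 1 \<and>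
          X = mat n n (\<lambda>(i, j). \<Sum>Y\<in>S. w Y * Y $$ (i, j)))"

definition mat_convex_hull :: "nat \<Rightarrow> real mat set \<Rightarrow> real mat set" where
  "mat_convex_hull n P = {X. \<exists>S\<subseteq>P. convex_combination n S X}"

definition CUT :: "nat \<Rightarrow> real mat set" where
  "CUT n = mat_convex_hull n (cut_matrices n)"

definition cut_rank_le :: "nat \<Rightarrow> nat \<Rightarrow> real mat \<Rightarrow> bool" where
  "cut_rank_le n \<rho> X \<longleftrightarrow>
     (\<exists>S\<subseteq>cut_matrices n. card S \<le> \<rho> \<and> convex_combination n S X)"


section \<open>Encoding of instances as words\<close>

text \<open>Binary digits, least significant first, without leading zeros.\<close>

fun nat_bits :: "nat \<Rightarrow> bool list" where
  "nat_bits n = (if n = 0 then [] else odd n # nat_bits (n div 2))"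

declare nat_bits.simps [simp del]

text \<open>Self-delimiting form of a word: each bit is preceded by \<open>True\<close>, and \<open>False\<close> marks the end.\<close>

fun delimit :: "bool list \<Rightarrow> bool list" where
  "delimit [] = [False]"
| "delimit (b # w) = True # b # delimit w"

definition encode_nat :: "nat \<Rightarrow> bool list" where
  "encode_nat n = delimit (nat_bits n)"

text \<open>Sign, numerator and denominator of the reduced fraction.\<close>

definition encode_rat :: "rat \<Rightarrow> bool list" where
  "encode_rat r =
     (case quotient_of r of (a, b) \<Rightarrow> (a < 0) # encode_nat (nat \<bar>a\<bar>) @ encode_nat (nat b))"

text \<open>Row by row.\<close>

definition encode_entries :: "nat \<Rightarrow> rat mat \<Rightarrow> bool list" where
  "encode_entries n \<Gamma> =
     concat (map (\<lambda>i. concat (map (\<lambda>j. encode_rat (\<Gamma> $$ (i, j))) [0..<n])) [0..<n])"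

definition encode_membership :: "nat \<times> rat mat \<Rightarrow> bool list" where
  "encode_membership = (\<lambda>(n, \<Gamma>). encode_nat n @ encode_entries n \<Gamma>)"

definition encode_rank :: "nat \<times> nat \<times> rat mat \<Rightarrow> bool list" where
  "encode_rank = (\<lambda>(\<rho>, n, \<Gamma>). encode_nat \<rho> @ encode_nat n @ encode_entries n \<Gamma>)"

definition symmetric_rat_mat :: "nat \<Rightarrow> rat mat \<Rightarrow> bool" where
  "symmetric_rat_mat n \<Gamma> \<longleftrightarrow> 1 \<le> n \<and> \<Gamma> \<in> carrier_mat n n \<and> transpose_mat \<Gamma> = \<Gamma>"


section \<open>The two problems\<close>

definition CUT_membership :: promise_problem where
  "CUT_membership =
     promise_problem_of encode_membership
       (\<lambda>(n, \<Gamma>). symmetric_rat_mat n \<Gamma>)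
       (\<lambda>(n, \<Gamma>). map_mat of_rat \<Gamma> \<in> CUT n)"

definition CUT_rank :: promise_problem where
  "CUT_rank =
     promise_problem_of encode_rank
       (\<lambda>(\<rho>, n, \<Gamma>). 1 \<le> \<rho> \<and> symmetric_rat_mat n \<Gamma> \<and> map_mat of_rat \<Gamma> \<in> CUT n)
       (\<lambda>(\<rho>, n, \<Gamma>). cut_rank_le n \<rho> (map_mat of_rat \<Gamma>))"


section \<open>The encodings are unambiguous\<close>

lemma delimit_append_eq_iff:
  "delimit u @ r = delimit v @ s \<longleftrightarrow> u = v \<and> r = s"
proof (induction u arbitrary: v)
  case Nil
  then show ?case by (cases v) auto
next
  case (Cons b u)
  then show ?case by (cases v) auto
qed

lemma nat_bits_eq_iff: "nat_bits m = nat_bits n \<longleftrightarrow> m = n"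
proof (induction m arbitrary: n rule: less_induct)
  case (less m)
  show ?case
  proof (cases "m = 0 \<or> n = 0")
    case True
    then show ?thesis by (auto simp: nat_bits.simps[of m] nat_bits.simps[of n] nat_bits.simps[of 0])
  next
    case False
    have "nat_bits m = nat_bits n \<longleftrightarrow> (odd m = odd n \<and> m div 2 = n div 2)"
      using False less.IH[of "m div 2" "n div 2"]
      by (subst nat_bits.simps[of m], subst nat_bits.simps[of n]) auto
    also have "\<dots> \<longleftrightarrow> m = n"
      by (metis even_iff_mod_2_eq_zero odd_iff_mod_2_eq_one div_mult_mod_eq)
    finally show ?thesis .
  qed
qed

lemma encode_nat_append_eq_iff:
  "encode_nat m @ r = encode_nat n @ s \<longleftrightarrow> m = n \<and> r = s"
  by (simp add: encode_nat_def delimit_append_eq_iff nat_bits_eq_iff)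

lemma encode_rat_append_eq_iff:
  "encode_rat x @ r = encode_rat y @ s \<longleftrightarrow> x = y \<and> r = s"
proof -
  obtain a b c d where q: "quotient_of x = (a, b)" "quotient_of y = (c, d)"
    by (metis surj_pair)
  have pos: "b > 0" "d > 0"
    using q quotient_of_denom_pos by blast+
  have "encode_rat x @ r = encode_rat y @ s \<longleftrightarrow>
        (a < 0) = (c < 0) \<and> nat \<bar>a\<bar> = nat \<bar>c\<bar> \<and> nat b = nat d \<and> r = s"
    by (simp add: encode_rat_def q encode_nat_append_eq_iff)
  also have "\<dots> \<longleftrightarrow> (a, b) = (c, d) \<and> r = s"
    using pos by auto
  also have "\<dots> \<longleftrightarrow> x = y \<and> r = s"
    using q by (metis quotient_of_inject)
  finally show ?thesis .
qed

lemma concat_map_append_eqD: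
  assumes "\<And>x r s. x \<in> set xs \<Longrightarrow> f x @ r = g x @ s \<Longrightarrow> P x \<and> r = s"
    and "concat (map f xs) @ r = concat (map g xs) @ s"
  shows "(\<forall>x\<in>set xs. P x) \<and> r = s"
  using assms
proof (induction xs)
  case Nil
  then show ?case by simp
next
  case (Cons x xs)
  have "P x \<and> concat (map f xs) @ r = concat (map g xs) @ s"
    using Cons.prems(1)[of x "concat (map f xs) @ r" "concat (map g xs) @ s"] Cons.prems(2)
    by simp
  then show ?case using Cons by auto
qed

lemma encode_entries_inject:
  assumes "encode_entries n A = encode_entries n B" "A \<in> carrier_mat n n" "B \<in> carrier_mat n n"
  shows "A = B"
proof -
  have row: "(\<forall>j\<in>set [0..<n]. A $$ (i, j) = B $$ (i, j)) \<and> r = s"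
    if "concat (map (\<lambda>j. encode_rat (A $$ (i, j))) [0..<n]) @ r
      = concat (map (\<lambda>j. encode_rat (B $$ (i, j))) [0..<n]) @ s" for i r s
    by (rule concat_map_append_eqD[OF _ that]) (simp add: encode_rat_append_eq_iff)
  have "(\<forall>i\<in>set [0..<n]. \<forall>j\<in>set [0..<n]. A $$ (i, j) = B $$ (i, j)) \<and> ([] :: bool list) = []"
    by (rule concat_map_append_eqD
        [where f = "\<lambda>i. concat (map (\<lambda>j. encode_rat (A $$ (i, j))) [0..<n])"
           and g = "\<lambda>i. concat (map (\<lambda>j. encode_rat (B $$ (i, j))) [0..<n])", OF row])
      (use assms(1) in \<open>simp_all add: encode_entries_def\<close>)
  then show ?thesis
    using assms(2,3) by (intro eq_matI) auto
qed

lemma CUT_membership_disjoint: "fst CUT_membership \<inter> snd CUT_membership = {}"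
  by (auto simp: CUT_membership_def promise_problem_of_def encode_membership_def
      symmetric_rat_mat_def encode_nat_append_eq_iff dest: encode_entries_inject)

lemma CUT_rank_disjoint: "fst CUT_rank \<inter> snd CUT_rank = {}"
  by (auto simp: CUT_rank_def promise_problem_of_def encode_rank_def
      symmetric_rat_mat_def encode_nat_append_eq_iff dest: encode_entries_inject)

end

(*
  For L in NP with verifier V, the accepting computations of V on input x are described by one cell
  per step, whose value records the situation of V, the positions of its heads and the times of the
  previous visits to these positions; all constraints relate two cells only. Encoding values by a
  Sidon set and shifting all of them cyclically turns these constraints into shift-invariant ones,
  so that a uniformly shifted solution gives the same probability to all values of a cell.

  A matrix in the cut polytope is the matrix of second moments of a random family of events. Take
  as events a flag and one literal for each value of each cell, prescribe the probability of the
  flag, make all values of a cell equally likely given the flag, and give joint probability 0 to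
  incompatible literals. Given the flag, exactly one literal of each cell holds, and these form a
  solution. Conversely, a solution and its shifts leave the joint probabilities of compatible
  literals undetermined, but sets of just two literals, without the flag, can make up for this.

  For the rank problem each cell gets a wild card, true with probability 1 - 1/N given the flag,
  where N is the number of cells. The matrix then always belongs to the cut polytope, as all cells
  but one may be wild. The first two moments force the sets without the flag to have exactly two
  literals, which makes their number known; if moreover the number of flagged sets is the smallest
  possible, all wild cards have to share one set, and the other flagged sets are solutions.

  The matrix is computed by Turing machines whose tapes are unary counters.
*)

theory Submission
  imports Defs
begin

section \<open>Structured programs for Turing machines\<close>

text \<open>Only first and second moments are visible in a matrix, and they must be prescribed
  without knowledge of a solution; this dictates the shape of the constraint system. A cell can have
  only polynomially many values, so it cannot store tape contents: a remembered visit time lets a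
  later cell compare the symbol it reads with the symbol written then. The number of digits of a
  value depends on the verifier alone, hence unary arithmetic and exhaustive search stay polynomial.
  A solution known only up to a shift shows differences of values, and a Sidon set allows a
  difference of distinct values to be decoded; cell 0 has a single value and reveals the shift
  itself. The joint probability of two compatible literals is topped up to the constant
  \<open>1 / D\<close>. The total mass \<open>D\<close> before normalisation can be computed in
  advance, since every flagged set contains exactly \<open>N * (N - 1) div 2\<close> compatible
  pairs. For the rank, wild cards need conditional probability above 1/2: then they cannot avoid the
  one set that contains the wild card of cell 0. This is why there are at least three cells.\<close>

datatype prog =
    Act nat "nat \<Rightarrow> nat \<times> move"
  | Seq prog prog
  | Cond nat "nat \<Rightarrow> bool" prog prog
  | While nat "nat \<Rightarrow> bool" prog

text \<open>The step counts mirror the compiled code: a test costs one step, the then-branch of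
  \<open>Cond\<close> and the body of \<open>While\<close> end with one jump, and the else-branch
  falls through to the exit.\<close>

inductive exec :: "prog \<Rightarrow> tape list \<Rightarrow> nat \<Rightarrow> tape list \<Rightarrow> bool" where
  exec_Act: "exec (Act i g) ts 1 (ts[i := act_tape (g (read_tape (ts ! i))) (ts ! i)])"
| exec_Seq: "exec p ts m us \<Longrightarrow> exec q us n vs \<Longrightarrow> exec (Seq p q) ts (m + n) vs"
| exec_CondT: "P (read_tape (ts ! i)) \<Longrightarrow> exec p ts m us \<Longrightarrow> exec (Cond i P p q) ts (m + 2) us"
| exec_CondF: "\<not> P (read_tape (ts ! i)) \<Longrightarrow> exec q ts m us \<Longrightarrow> exec (Cond i P p q) ts (m + 1) us"
| exec_WhileF: "\<not> P (read_tape (ts ! i)) \<Longrightarrow> exec (While i P p) ts 1 ts"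
| exec_WhileT: "P (read_tape (ts ! i)) \<Longrightarrow> exec p ts m us \<Longrightarrow> exec (While i P p) us n vs \<Longrightarrow>
    exec (While i P p) ts (m + n + 2) vs"

fun prog_ok :: "nat \<Rightarrow> prog \<Rightarrow> bool" where
  "prog_ok k (Act i g) \<longleftrightarrow> i < k \<and> (\<forall>s<3. fst (g s) < 3)"
| "prog_ok k (Seq p q) \<longleftrightarrow> prog_ok k p \<and> prog_ok k q"
| "prog_ok k (Cond i P p q) \<longleftrightarrow> i < k \<and> prog_ok k p \<and> prog_ok k q"
| "prog_ok k (While i P p) \<longleftrightarrow> i < k \<and> prog_ok k p"

lemma prog_ok_mono: "prog_ok k p \<Longrightarrow> k \<le> l \<Longrightarrow> prog_ok l p"
  by (induction p) auto

lemma exec_length: "exec p ts n us \<Longrightarrow> length us = length ts"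
  by (induction rule: exec.induct) auto

text \<open>The code of a program occupies the states from its start state up to its exit state, the
  latter excluded.\<close>

fun code_size :: "prog \<Rightarrow> nat" where
  "code_size (Act i g) = 1"
| "code_size (Seq p q) = code_size p + code_size q"
| "code_size (Cond i P p q) = code_size p + code_size q + 2"
| "code_size (While i P p) = code_size p + 2"

definition keep :: "nat list \<Rightarrow> (nat \<times> move) list" where
  "keep ss = map (\<lambda>s. (s, Stay)) ss"

text \<open>\<open>Cond\<close> is laid out as test, then-branch, one state jumping to the exit,
  else-branch; \<open>While\<close> as test, body, one state jumping back to the test. Tests and
  jumps write back what they read.\<close>

fun code :: "prog \<Rightarrow> nat \<Rightarrow> nat \<Rightarrow> nat list \<Rightarrow> nat \<times> (nat \<times> move) list" where
  "code (Act i g) b q ss = (b + 1, (keep ss)[i := g (ss ! i)])"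
| "code (Seq p1 p2) b q ss =
     (if q < b + code_size p1 then code p1 b q ss else code p2 (b + code_size p1) q ss)"
| "code (Cond i P p1 p2) b q ss =
     (if q = b then (if P (ss ! i) then b + 1 else b + code_size p1 + 2, keep ss)
      else if q < b + 1 + code_size p1 then code p1 (b + 1) q ss
      else if q = b + 1 + code_size p1 then (b + code_size p1 + code_size p2 + 2, keep ss)
      else code p2 (b + code_size p1 + 2) q ss)"
| "code (While i P p) b q ss =
     (if q = b then (if P (ss ! i) then b + 1 else b + code_size p + 2, keep ss)
      else if q = b + 1 + code_size p then (b, keep ss)
      else code p (b + 1) q ss)"

lemma code_size_pos: "0 < code_size p"
  by (induction p) auto

lemma length_keep [simp]: "length (keep ss) = length ss"
  by (simp add: keep_def)

text \<open>The bound on the next state is not strict: it may be the exit, which belongs to whatever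
  code follows or is a halting state.\<close>

lemma code_wf:
  assumes "prog_ok k p" "length ss = k" "set ss \<subseteq> {..<3}" "b \<le> q" "q < b + code_size p"
  shows "case code p b q ss of (q', as) \<Rightarrow>
    q' \<le> b + code_size p \<and> length as = k \<and> fst ` set as \<subseteq> {..<3}"
  using assms
proof (induction p arbitrary: b q)
  case (Act i g)
  have "fst ` set (keep ss) \<subseteq> {..<3}" using Act by (auto simp: keep_def)
  moreover have "fst (g (ss ! i)) < 3" using Act by (auto simp: subset_iff)
  ultimately show ?case using Act set_update_subset_insert[of "keep ss" i "g (ss ! i)"]
    by (auto 0 3)
next
  case (Seq p1 p2)
  show ?case
  proof (cases "q < b + code_size p1")
    case True
    then show ?thesis using Seq.IH(1)[of b q] Seq.prems by (simp split: prod.splits)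
  next
    case False
    then show ?thesis
      using Seq.IH(2)[of "b + code_size p1" q] Seq.prems by (simp split: prod.splits)
  qed
next
  case (Cond i P p1 p2)
  have k: "fst ` set (keep ss) \<subseteq> {..<3}" using Cond by (auto simp: keep_def)
  consider "q = b \<or> q = b + 1 + code_size p1" | "b + 1 \<le> q" "q < b + 1 + code_size p1"
    | "b + code_size p1 + 2 \<le> q" using Cond.prems by linarith
  then show ?case
  proof cases
    case 1
    then show ?thesis using Cond.prems k by auto
  next
    case 2
    then show ?thesis using Cond.IH(1)[of "b + 1" q] Cond.prems by (simp split: prod.splits)
  next
    case 3
    then show ?thesis
      using Cond.IH(2)[of "b + code_size p1 + 2" q] Cond.prems by (simp split: prod.splits)
  qed
next
  case (While i P p)
  have k: "fst ` set (keep ss) \<subseteq> {..<3}" using While by (auto simp: keep_def)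
  consider "q = b \<or> q = b + 1 + code_size p" | "b + 1 \<le> q" "q < b + 1 + code_size p"
    using While.prems by force
  then show ?case
  proof cases
    case 1
    then show ?thesis using While.prems k by auto
  next
    case 2
    then show ?thesis using While.IH[of "b + 1" q] While.prems by (simp split: prod.splits)
  qed
qed

lemma act_tape_read: "act_tape (read_tape t, Stay) t = t"
  by (cases t) auto

lemma map2_keep: "map2 act_tape (keep (map read_tape ts)) ts = ts"
  by (rule nth_equalityI) (auto simp: keep_def act_tape_read)

lemma map2_keep_update:
  "map2 act_tape ((keep (map read_tape ts))[i := a]) ts = ts[i := act_tape a (ts ! i)]"
proof (rule nth_equalityI)
  fix j assume "j < length (map2 act_tape ((keep (map read_tape ts))[i := a]) ts)"
  then have j: "j < length ts" by simp
  have "act_tape (keep (map read_tape ts) ! j) (ts ! j) = ts ! j"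
    using j by (simp add: keep_def act_tape_read)
  then show "map2 act_tape ((keep (map read_tape ts))[i := a]) ts ! j
      = ts[i := act_tape a (ts ! i)] ! j"
    using j by (cases "i = j") auto
qed simp

definition runs_code :: "tm \<Rightarrow> prog \<Rightarrow> nat \<Rightarrow> bool" where
  "runs_code M p b \<longleftrightarrow>
     (\<forall>q ss. b \<le> q \<and> q < b + code_size p \<longrightarrow>
        tm_delta M q ss = code p b q ss \<and> q \<noteq> tm_accept M \<and> q \<noteq> tm_reject M)"

lemma tm_step_code:
  assumes "runs_code M p b" "b \<le> q" "q < b + code_size p"
  shows "tm_step M (q, ts) =
    (case code p b q (map read_tape ts) of (q', as) \<Rightarrow> (q', map2 act_tape as ts))"
  using assms by (simp add: tm_step_def runs_code_def halted_def)

lemma runs_code_Seq: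
  assumes "runs_code M (Seq p1 p2) b"
  shows "runs_code M p1 b" "runs_code M p2 (b + code_size p1)"
  using assms unfolding runs_code_def by auto

lemma runs_code_Cond:
  assumes "runs_code M (Cond i P p1 p2) b"
  shows "runs_code M p1 (b + 1)" "runs_code M p2 (b + code_size p1 + 2)"
  using assms unfolding runs_code_def by auto

lemma runs_code_While:
  assumes "runs_code M (While i P p) b"
  shows "runs_code M p (b + 1)"
  using assms unfolding runs_code_def by auto

lemma funpow_trans:
  "(f ^^ m) a = b \<Longrightarrow> (f ^^ n) b = c \<Longrightarrow> (f ^^ (m + n)) a = c"
  by (simp add: add.commute[of m n] funpow_add)

text \<open>Induction on the execution. Every subprogram is entered at its first state and left at
  its exit, so the runs of the parts can be concatenated by \<open>funpow_trans\<close>.\<close>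

lemma exec_tm:
  assumes "exec p ts n us" "runs_code M p b" "prog_ok (length ts) p"
  shows "(tm_step M ^^ n) (b, ts) = (b + code_size p, us)"
  using assms
proof (induction arbitrary: b rule: exec.induct)
  case (exec_Act i g ts)
  then show ?case
    using tm_step_code[OF exec_Act(1), of b ts] by (simp add: map2_keep_update)
next
  case (exec_Seq p ts m us q n vs)
  show ?case
    using funpow_trans[OF exec_Seq.IH(1) exec_Seq.IH(2)] runs_code_Seq[OF exec_Seq.prems(1)]
      exec_Seq.prems(2) exec_length[OF exec_Seq.hyps(1)]
    by (simp add: add.assoc)
next
  case (exec_CondT P ts i p m us q)
  note rc = runs_code_Cond(1)[OF exec_CondT.prems(1)]
  have "(tm_step M ^^ 1) (b, ts) = (b + 1, ts)"
    using tm_step_code[OF exec_CondT.prems(1), of b ts] exec_CondT.hyps(1) exec_CondT.prems(2)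
    by (cases "i < length ts") (auto simp: map2_keep)
  note a = this
  have c: "(tm_step M ^^ 1) (b + 1 + code_size p, us) = (b + code_size p + code_size q + 2, us)"
    using tm_step_code[OF exec_CondT.prems(1), of "b + 1 + code_size p" us]
    by (simp add: map2_keep)
  from funpow_trans[OF funpow_trans[OF a exec_CondT.IH[OF rc]] c] exec_CondT.prems(2)
  show ?case by (simp add: algebra_simps del: funpow.simps)
next
  case (exec_CondF P ts i q m us p)
  note rc = runs_code_Cond(2)[OF exec_CondF.prems(1)]
  have "(tm_step M ^^ 1) (b, ts) = (b + code_size p + 2, ts)"
    using tm_step_code[OF exec_CondF.prems(1), of b ts] exec_CondF.hyps(1) exec_CondF.prems(2)
    by (simp add: map2_keep)
  from funpow_trans[OF this exec_CondF.IH[OF rc]] exec_CondF.prems(2)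
  show ?case by (simp add: algebra_simps del: funpow.simps)
next
  case (exec_WhileF P ts i p)
  then show ?case
    using tm_step_code[OF exec_WhileF.prems(1), of b ts] by (auto simp: map2_keep)
next
  case (exec_WhileT P ts i p m us n vs)
  note rc = runs_code_While[OF exec_WhileT.prems(1)]
  have a: "(tm_step M ^^ 1) (b, ts) = (b + 1, ts)"
    using tm_step_code[OF exec_WhileT.prems(1), of b ts] exec_WhileT.hyps(1) exec_WhileT.prems(2)
    by (simp add: map2_keep)
  have c: "(tm_step M ^^ 1) (b + 1 + code_size p, us) = (b, us)"
    using tm_step_code[OF exec_WhileT.prems(1), of "b + 1 + code_size p" us]
    by (simp add: map2_keep)
  from funpow_trans[OF funpow_trans[OF funpow_trans[OF a exec_WhileT.IH(1)[OF rc]] c]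
      exec_WhileT.IH(2)[OF exec_WhileT.prems(1)]]
    exec_WhileT.prems(2) exec_length[OF exec_WhileT.hyps(2)]
  show ?case by (simp add: algebra_simps del: funpow.simps)
qed

text \<open>The exit state of the program doubles as the accepting state, so leaving the code halts
  the machine.\<close>

definition tm_of :: "nat \<Rightarrow> prog \<Rightarrow> tm" where
  "tm_of k p =
     \<lparr>tm_tapes = k, tm_symbols = 3, tm_states = code_size p + 2, tm_start = 0,
      tm_accept = code_size p, tm_reject = code_size p + 1,
      tm_delta = (\<lambda>q ss. if q < code_size p then code p 0 q ss else (q, keep ss))\<rparr>"

lemma wf_tm_of:
  assumes "prog_ok k p" "1 \<le> k"
  shows "wf_tm (tm_of k p)"
proof -
  have "case tm_delta (tm_of k p) q ss of (q', as) \<Rightarrow>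
      q' < code_size p + 2 \<and> length as = k \<and> fst ` set as \<subseteq> {..<3}"
    if "q < code_size p + 2" "length ss = k" "set ss \<subseteq> {..<3}" for q ss
    using code_wf[OF assms(1) that(2,3), of 0 q] that
    by (cases "q < code_size p") (auto simp: tm_of_def keep_def split: prod.splits)
  then show ?thesis
    using assms code_size_pos[of p] by (auto simp: wf_tm_def tm_of_def)
qed

lemma halted_funpow: "halted M c \<Longrightarrow> (tm_step M ^^ n) c = c"
  by (induction n) (auto simp: tm_step_def)

text \<open>Bridges two notions of time: machines are inspected after a number of steps given by a
  polynomial, while they are only known to halt by then.\<close>

lemma halted_later:
  assumes "halted M ((tm_step M ^^ m) (c :: config))" "m \<le> n"
  shows "(tm_step M ^^ n) c = (tm_step M ^^ m) c"
proof -
  have "(tm_step M ^^ n) c = (tm_step M ^^ (n - m)) ((tm_step M ^^ m) c)"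
    using assms(2) by (metis comp_apply funpow_add le_add_diff_inverse2)
  then show ?thesis using halted_funpow[OF assms(1)] by simp
qed

lemma polytime_computable_exec:
  assumes ok: "prog_ok k p" "1 \<le> k"
    and run: "\<And>x. \<exists>n us. n \<le> poly q (length x) \<and> tape_holds (us ! 0) (f x) \<and>
      exec p (map (\<lambda>i. (0, word_contents (if i = 0 then x else []))) [0..<k]) n us"
  shows "polytime_computable f"
proof -
  let ?M = "tm_of k p"
  have "halted ?M (tm_run ?M [x] (poly q (length x))) \<and>
      tape_holds (snd (tm_run ?M [x] (poly q (length x))) ! 0) (f x)" for x
  proof -
    obtain n us where n: "n \<le> poly q (length x)" "tape_holds (us ! 0) (f x)"
      and e: "exec p (map (\<lambda>i. (0, word_contents (if i = 0 then x else []))) [0..<k]) n us"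
      using run by blast
    have init: "tm_init ?M [x] =
        (0, map (\<lambda>i. (0, word_contents (if i = 0 then x else []))) [0..<k])"
      by (auto simp: tm_init_def tm_of_def)
    have "runs_code ?M p 0" by (auto simp: runs_code_def tm_of_def)
    from exec_tm[OF e this] ok
    have fin: "(tm_step ?M ^^ n) (tm_init ?M [x]) = (code_size p, us)" by (simp add: init)
    have h: "halted ?M (code_size p, us)" by (simp add: halted_def tm_of_def)
    have "tm_run ?M [x] (poly q (length x)) = (code_size p, us)"
      using halted_later[of ?M n "tm_init ?M [x]"] fin h n(1) by (simp add: tm_run_def)
    then show ?thesis using h n(2) by simp
  qed
  then show ?thesis unfolding polytime_computable_def using wf_tm_of[OF ok] by blast
qed

section \<open>Programs over unary counters\<close>

definition runs :: "prog \<Rightarrow> tape list \<Rightarrow> nat \<Rightarrow> tape list \<Rightarrow> bool" where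
  "runs p ts b us \<longleftrightarrow> (\<exists>n\<le>b. exec p ts n us)"

lemma runs_mono: "runs p ts b us \<Longrightarrow> b \<le> c \<Longrightarrow> runs p ts c us"
  unfolding runs_def using le_trans by blast

lemma runsI: "exec p ts n us \<Longrightarrow> n \<le> b \<Longrightarrow> runs p ts b us"
  unfolding runs_def by blast

lemma runsE: "runs p ts b us \<Longrightarrow> (\<And>n. exec p ts n us \<Longrightarrow> n \<le> b \<Longrightarrow> thesis) \<Longrightarrow> thesis"
  unfolding runs_def by blast

lemma runs_Act:
  "us = ts[i := act_tape (g (read_tape (ts ! i))) (ts ! i)] \<Longrightarrow> runs (Act i g) ts 1 us"
  by (simp add: runsI[OF exec_Act])

lemma runs_Seq: "runs p ts m us \<Longrightarrow> runs q us n vs \<Longrightarrow> runs (Seq p q) ts (m + n) vs"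
  by (elim runsE, rule runsI, erule (1) exec_Seq) simp

lemma runs_CondT: "P (read_tape (ts ! i)) \<Longrightarrow> runs p ts m us \<Longrightarrow> runs (Cond i P p q) ts (m + 2) us"
  by (elim runsE, rule runsI, erule (1) exec_CondT) simp

text \<open>One step is given away so that both branches obey the same bound.\<close>

lemma runs_CondF: "\<not> P (read_tape (ts ! i)) \<Longrightarrow> runs q ts m us \<Longrightarrow> runs (Cond i P p q) ts (m + 2) us"
  by (elim runsE, rule runsI, erule (1) exec_CondF) simp

lemma runs_WhileF: "\<not> P (read_tape (ts ! i)) \<Longrightarrow> runs (While i P p) ts 1 ts"
  by (rule runsI, erule exec_WhileF) simp

lemma runs_WhileT:
  "P (read_tape (ts ! i)) \<Longrightarrow> runs p ts m us \<Longrightarrow> runs (While i P p) us n vs \<Longrightarrow>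
    runs (While i P p) ts (m + n + 2) vs"
  by (elim runsE, rule runsI, erule (2) exec_WhileT) simp

lemma runs_While_iterate:
  assumes "\<And>j. j < m \<Longrightarrow> P (read_tape (st j ! i))"
    and "\<And>j. j < m \<Longrightarrow> runs p (st j) t (st (Suc j))"
    and "\<not> P (read_tape (st m ! i))"
  shows "runs (While i P p) (st 0) (m * (t + 2) + 1) (st m)"
proof -
  have "runs (While i P p) (st j) ((m - j) * (t + 2) + 1) (st m)" if "j \<le> m" for j
    using that
  proof (induction rule: inc_induct)
    case base
    then show ?case using runs_WhileF[of P "st m" i p] assms(3) by simp
  next
    case (step j)
    have "t + ((m - Suc j) * (t + 2) + 1) + 2 = (m - j) * (t + 2) + 1"
      using step.hyps(2) by (metis Suc_diff_Suc add.assoc add.commute mult_Suc)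
    then show ?case
      using runs_WhileT[of P "st j" i, OF assms(1)[OF step.hyps(2)] assms(2)[OF step.hyps(2)]
          step.IH]
      by simp
  qed
  from this[of 0] show ?thesis by simp
qed

text \<open>The single mark at position 0 makes reading symbol 1 the test for zero, and moving the
  head is counting.\<close>

definition ctr :: "nat \<Rightarrow> tape" where
  "ctr r = (int r, \<lambda>z. if z = 0 then 1 else 0)"

text \<open>Tape 0 holds the output produced so far, starting where the erased input ended; tape 1 holds
  the input; every other tape is a counter, whose value is the position of its head.\<close>

definition cfg :: "bool list \<Rightarrow> nat \<Rightarrow> bool list \<Rightarrow> nat list \<Rightarrow> tape list" where
  "cfg x j w vs =
     (int (length x) + int (length w), \<lambda>z. word_contents w (z - int (length x)))
     # (int j, word_contents x) # map ctr vs"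

definition input_symbol :: "bool list \<Rightarrow> nat \<Rightarrow> nat" where
  "input_symbol x j = word_contents x (int j)"

definition inc :: "nat \<Rightarrow> prog" where
  "inc i = Act (i + 2) (\<lambda>s. (s, Move_Right))"
definition dec :: "nat \<Rightarrow> prog" where
  "dec i = Act (i + 2) (\<lambda>s. (s, Move_Left))"
definition skip :: prog where
  "skip = Act 0 (\<lambda>s. (s, Stay))"
definition input_move :: "move \<Rightarrow> prog" where
  "input_move m = Act 1 (\<lambda>s. (s, m))"
definition emit :: "bool \<Rightarrow> prog" where
  "emit b = Act 0 (\<lambda>s. (bit_symbol b, Move_Right))"
definition if_zero :: "nat \<Rightarrow> prog \<Rightarrow> prog \<Rightarrow> prog" where
  "if_zero i p q = Cond (i + 2) (\<lambda>s. s = 1) p q"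
text \<open>A loop consumes its counter; a value that is still needed must be copied while it is
  counted down.\<close>

definition loop :: "nat \<Rightarrow> prog \<Rightarrow> prog" where
  "loop i p = While (i + 2) (\<lambda>s. s \<noteq> 1) (Seq (dec i) p)"
definition move_ctr :: "nat \<Rightarrow> nat \<Rightarrow> prog" where
  "move_ctr i l = loop i (inc l)"
definition clear :: "nat \<Rightarrow> prog" where
  "clear i = loop i skip"

lemma bit_symbol_less_3: "bit_symbol b < 3"
  by (cases b) auto

lemma prog_ok_simps [simp]:
  "prog_ok k (inc i) \<longleftrightarrow> i + 2 < k"
  "prog_ok k (dec i) \<longleftrightarrow> i + 2 < k"
  "prog_ok k skip \<longleftrightarrow> 0 < k"
  "prog_ok k (input_move m) \<longleftrightarrow> 1 < k"
  "prog_ok k (emit b) \<longleftrightarrow> 0 < k"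
  "prog_ok k (if_zero i p q) \<longleftrightarrow> i + 2 < k \<and> prog_ok k p \<and> prog_ok k q"
  "prog_ok k (loop i p) \<longleftrightarrow> i + 2 < k \<and> prog_ok k p"
  "prog_ok k (move_ctr i l) \<longleftrightarrow> i + 2 < k \<and> l + 2 < k"
  "prog_ok k (clear i) \<longleftrightarrow> i + 2 < k"
  by (auto simp: inc_def dec_def skip_def input_move_def emit_def if_zero_def loop_def
      move_ctr_def clear_def bit_symbol_less_3)

lemma act_ctr:
  "act_tape (read_tape (ctr r), Move_Right) (ctr r) = ctr (Suc r)"
  "r > 0 \<Longrightarrow> act_tape (read_tape (ctr r), Move_Left) (ctr r) = ctr (r - 1)"
  by (auto simp: ctr_def)

lemma read_cfg:
  "i < length vs \<Longrightarrow> read_tape (cfg x j w vs ! (i + 2)) = (if vs ! i = 0 then 1 else 0)"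
  "read_tape (cfg x j w vs ! 1) = input_symbol x j"
  by (auto simp: cfg_def ctr_def input_symbol_def)

lemma runs_inc:
  "i < length vs \<Longrightarrow> runs (inc i) (cfg x j w vs) 1 (cfg x j w (vs[i := Suc (vs ! i)]))"
  unfolding inc_def by (rule runs_Act) (simp add: cfg_def act_ctr map_update)

lemma runs_dec:
  "i < length vs \<Longrightarrow> vs ! i > 0 \<Longrightarrow> runs (dec i) (cfg x j w vs) 1 (cfg x j w (vs[i := vs ! i - 1]))"
  unfolding dec_def by (rule runs_Act) (simp add: cfg_def act_ctr map_update)

lemma runs_skip: "runs skip ts 1 ts"
  unfolding skip_def by (rule runs_Act) (simp add: act_tape_read)

lemma runs_input_right: "runs (input_move Move_Right) (cfg x j w vs) 1 (cfg x (Suc j) w vs)"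
  unfolding input_move_def by (rule runs_Act) (simp add: cfg_def)

lemma runs_input_left:
  "j > 0 \<Longrightarrow> runs (input_move Move_Left) (cfg x j w vs) 1 (cfg x (j - 1) w vs)"
  unfolding input_move_def by (rule runs_Act) (simp add: cfg_def)

lemma word_contents_snoc:
  "(word_contents w)(int (length w) := bit_symbol b) = word_contents (w @ [b])"
  by (auto simp: word_contents_def fun_eq_iff nth_append)

lemma runs_emit: "runs (emit b) (cfg x j w vs) 1 (cfg x j (w @ [b]) vs)"
proof -
  have "(\<lambda>z. word_contents w (z - int (length x)))(int (length x) + int (length w) := bit_symbol b)
      = (\<lambda>z. word_contents (w @ [b]) (z - int (length x)))"
    by (auto simp: word_contents_snoc[symmetric] fun_eq_iff)
  then show ?thesis
    unfolding emit_def by (intro runs_Act) (simp add: cfg_def)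
qed

lemma runs_if_zero:
  assumes "i < length vs"
    and "vs ! i = 0 \<Longrightarrow> runs p (cfg x j w vs) t us"
    and "vs ! i \<noteq> 0 \<Longrightarrow> runs q (cfg x j w vs) t us"
  shows "runs (if_zero i p q) (cfg x j w vs) (t + 2) us"
proof (cases "vs ! i = 0")
  case True
  then show ?thesis
    unfolding if_zero_def using assms(1)
        by (intro runs_CondT assms(2)) (simp_all add: read_cfg(1) del: add_2_eq_Suc')
next
  case False
  then show ?thesis
    unfolding if_zero_def using assms(1)
        by (intro runs_CondF assms(3)) (simp_all add: read_cfg(1) del: add_2_eq_Suc')
qed

text \<open>\<open>J\<close>, \<open>W\<close> and \<open>V\<close> give the input head, the output
  and the counters before each round. The body sees counter \<open>i\<close> already decremented; a
  round costs \<open>t\<close> steps plus the decrement, the test and the jump back.\<close>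

lemma runs_loop:
  assumes "\<And>j. j \<le> m \<Longrightarrow> i < length (V j) \<and> V j ! i = m - j"
    and "\<And>j. j < m \<Longrightarrow> runs p (cfg x (J j) (W j) ((V j)[i := m - Suc j])) t
      (cfg x (J (Suc j)) (W (Suc j)) (V (Suc j)))"
  shows "runs (loop i p) (cfg x (J 0) (W 0) (V 0)) (m * (t + 3) + 1) (cfg x (J m) (W m) (V m))"
proof -
  have "runs (Seq (dec i) p) (cfg x (J j) (W j) (V j)) (1 + t)
      (cfg x (J (Suc j)) (W (Suc j)) (V (Suc j)))" if j: "j < m" for j
  proof -
    have "i < length (V j)" and v: "V j ! i = m - j" using assms(1)[of j] j by auto
    then have "runs (dec i) (cfg x (J j) (W j) (V j)) 1 (cfg x (J j) (W j) ((V j)[i := m - Suc j]))"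
      using runs_dec[of i "V j" x "J j" "W j"] j by (simp add: v)
    then show ?thesis by (rule runs_Seq[OF _ assms(2)[OF j]])
  qed
  moreover have "read_tape (cfg x (J j) (W j) (V j) ! (i + 2)) = (if j < m then 0 else 1)"
    if "j \<le> m" for j
    using assms(1)[OF that] that read_cfg(1)[of i "V j"] by (simp del: add_2_eq_Suc')
  ultimately have "runs (While (i + 2) (\<lambda>s. s \<noteq> 1) (Seq (dec i) p)) (cfg x (J 0) (W 0) (V 0))
      (m * ((1 + t) + 2) + 1) (cfg x (J m) (W m) (V m))"
    by (intro runs_While_iterate[where st = "\<lambda>j. cfg x (J j) (W j) (V j)"])
      (simp_all del: add_2_eq_Suc')
  moreover have "m * ((1 + t) + 2) + 1 = m * (t + 3) + 1"
    by (simp only: add.commute[of 1 t] add.assoc one_plus_numeral) simp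
  ultimately show ?thesis by (simp only: loop_def)
qed

lemma runs_move_ctr:
  assumes "i < length vs" "l < length vs" "i \<noteq> l"
  shows "runs (move_ctr i l) (cfg x j w vs) (4 * (vs ! i) + 1)
    (cfg x j w (vs[l := vs ! l + vs ! i, i := 0]))"
proof -
  let ?V = "\<lambda>k. vs[l := vs ! l + k, i := vs ! i - k]"
  have "runs (loop i (inc l)) (cfg x j w (?V 0)) (vs ! i * (1 + 3) + 1) (cfg x j w (?V (vs ! i)))"
  proof (rule runs_loop[where J = "\<lambda>_. j" and W = "\<lambda>_. w" and V = ?V])
    fix k assume k: "k < vs ! i"
    have "(?V k)[i := vs ! i - Suc k, l := Suc ((?V k)[i := vs ! i - Suc k] ! l)] = ?V (Suc k)"
      using assms by (auto simp: nth_list_update intro!: nth_equalityI)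
    then show "runs (inc l) (cfg x j w ((?V k)[i := vs ! i - Suc k])) 1 (cfg x j w (?V (Suc k)))"
      using runs_inc[of l "(?V k)[i := vs ! i - Suc k]" x j w] assms by simp
  qed (use assms in auto)
  then show ?thesis using assms by (simp add: move_ctr_def mult.commute)
qed

lemma runs_clear:
  assumes "i < length vs"
  shows "runs (clear i) (cfg x j w vs) (4 * (vs ! i) + 1) (cfg x j w (vs[i := 0]))"
proof -
  let ?V = "\<lambda>k. vs[i := vs ! i - k]"
  have "runs (loop i skip) (cfg x j w (?V 0)) (vs ! i * (1 + 3) + 1) (cfg x j w (?V (vs ! i)))"
  proof (rule runs_loop[where J = "\<lambda>_. j" and W = "\<lambda>_. w" and V = ?V])
    fix k
    show "runs skip (cfg x j w ((?V k)[i := vs ! i - Suc k])) 1 (cfg x j w (?V (Suc k)))"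
      using runs_skip by simp
  qed (use assms in auto)
  then show ?thesis by (simp add: clear_def mult.commute)
qed

subsection \<open>Polynomially bounded functions\<close>

text \<open>Coefficients are natural numbers, so these functions are monotone and size estimates may
  be enlarged inside time bounds.\<close>

definition polyfun :: "(nat \<Rightarrow> nat) \<Rightarrow> bool" where
  "polyfun g \<longleftrightarrow> (\<exists>q. g = poly q)"

lemma polyfun_id: "polyfun (\<lambda>s. s)"
  unfolding polyfun_def by (rule exI[of _ "[:0, 1:]"]) auto
lemma polyfun_const: "polyfun (\<lambda>s. c)"
  unfolding polyfun_def by (rule exI[of _ "[:c:]"]) auto
lemma polyfun_poly: "polyfun (poly q)"
  unfolding polyfun_def by blast
lemma polyfun_add: assumes "polyfun f" "polyfun g" shows "polyfun (\<lambda>s. f s + g s)"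
proof -
  obtain p q where "f = poly p" "g = poly q" using assms unfolding polyfun_def by blast
  then have "(\<lambda>s. f s + g s) = poly (p + q)" by auto
  then show ?thesis by (simp only: polyfun_poly)
qed
lemma polyfun_mult: assumes "polyfun f" "polyfun g" shows "polyfun (\<lambda>s. f s * g s)"
proof -
  obtain p q where "f = poly p" "g = poly q" using assms unfolding polyfun_def by blast
  then have "(\<lambda>s. f s * g s) = poly (p * q)" by auto
  then show ?thesis by (simp only: polyfun_poly)
qed
lemma polyfun_comp: assumes "polyfun f" "polyfun g" shows "polyfun (\<lambda>s. f (g s))"
proof -
  obtain p q where "f = poly p" "g = poly q" using assms unfolding polyfun_def by blast
  then have "(\<lambda>s. f (g s)) = poly (pcompose p q)" by (auto simp: poly_pcompose)
  then show ?thesis by (simp only: polyfun_poly)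
qed
lemma polyfun_Suc: "polyfun f \<Longrightarrow> polyfun (\<lambda>s. Suc (f s))"
  using polyfun_add[OF polyfun_const[of 1]] by simp

lemmas polyfun_intros = polyfun_id polyfun_const polyfun_add polyfun_mult polyfun_Suc

lemma poly_nat_mono: "a \<le> b \<Longrightarrow> poly (q :: nat poly) a \<le> poly q b"
  by (induction q) (auto intro!: add_mono mult_mono)

lemma polyfun_mono: "polyfun f \<Longrightarrow> a \<le> b \<Longrightarrow> f a \<le> f b"
  unfolding polyfun_def using poly_nat_mono by auto

section \<open>Functions computed by counter programs\<close>

definition zero_from :: "nat \<Rightarrow> nat list \<Rightarrow> bool" where
  "zero_from d vs \<longleftrightarrow> (\<forall>i. d \<le> i \<longrightarrow> i < length vs \<longrightarrow> vs ! i = 0)"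

text \<open>The variables of \<open>F\<close> are held by the counters \<open>\<rho>\<close>; the result goes to counter \<open>d\<close>, and
  the counters above \<open>d\<close> serve as scratch space, which is zero before and after.\<close>

definition computes ::
    "(bool list \<Rightarrow> nat list \<Rightarrow> nat) \<Rightarrow> nat list \<Rightarrow> nat \<Rightarrow> prog \<Rightarrow> nat \<Rightarrow> (nat \<Rightarrow> nat) \<Rightarrow> bool" where
  "computes F \<rho> d p k T \<longleftrightarrow> polyfun T \<and> prog_ok (k + 2) p \<and> d < k \<and>
     (\<forall>x w vs. k \<le> length vs \<longrightarrow> zero_from d vs \<longrightarrow>
        runs p (cfg x 0 w vs) (T (length x + sum_list vs))
          (cfg x 0 w (vs[d := F x (map ((!) vs) \<rho>)])))"

text \<open>Quantifying over all placements \<open>\<rho>\<close> and all destinations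
  \<open>d\<close> above them gives closure under composition, since a subprogram can be run with
  the next free counter as destination. The value bound is demanded because counters are unary: a
  value is also a running time.\<close>

definition cf :: "nat \<Rightarrow> (bool list \<Rightarrow> nat list \<Rightarrow> nat) \<Rightarrow> bool" where
  "cf n F \<longleftrightarrow>
     (\<exists>V. polyfun V \<and> (\<forall>x vs. length vs = n \<longrightarrow> F x vs \<le> V (length x + sum_list vs))) \<and>
     (\<forall>\<rho> d. length \<rho> = n \<longrightarrow> (\<forall>i\<in>set \<rho>. i < d) \<longrightarrow> (\<exists>p k T. computes F \<rho> d p k T))"

lemma runs_inc_eq:
  "i < length vs \<Longrightarrow> us = vs[i := Suc (vs ! i)] \<Longrightarrow> runs (inc i) (cfg x j w vs) 1 (cfg x j w us)"
  using runs_inc by simp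

lemma runs_dec_eq:
  "i < length vs \<Longrightarrow> vs ! i > 0 \<Longrightarrow> us = vs[i := vs ! i - 1] \<Longrightarrow>
    runs (dec i) (cfg x j w vs) 1 (cfg x j w us)"
  using runs_dec by simp

lemma runs_move_ctr_eq:
  "i < length vs \<Longrightarrow> l < length vs \<Longrightarrow> i \<noteq> l \<Longrightarrow> vs ! i \<le> t \<Longrightarrow>
    us = vs[l := vs ! l + vs ! i, i := 0] \<Longrightarrow>
    runs (move_ctr i l) (cfg x j w vs) (4 * t + 1) (cfg x j w us)"
  using runs_mono[OF runs_move_ctr[of i vs l x j w]] by simp

lemma runs_clear_eq:
  "i < length vs \<Longrightarrow> vs ! i \<le> t \<Longrightarrow> us = vs[i := 0] \<Longrightarrow>
    runs (clear i) (cfg x j w vs) (4 * t + 1) (cfg x j w us)"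
  using runs_mono[OF runs_clear[of i vs x j w]] by simp

lemma zero_from_update: "zero_from d vs \<Longrightarrow> d \<le> e \<Longrightarrow> i < e \<Longrightarrow> zero_from e (vs[i := a])"
  by (auto simp: zero_from_def)

lemma zero_from_mono: "zero_from d vs \<Longrightarrow> d \<le> e \<Longrightarrow> zero_from e vs"
  by (auto simp: zero_from_def)

lemma zero_fromD: "zero_from d vs \<Longrightarrow> d \<le> i \<Longrightarrow> i < length vs \<Longrightarrow> vs ! i = 0"
  by (auto simp: zero_from_def)

lemma sum_list_update_le: "sum_list (vs[i := a]) \<le> sum_list vs + (a :: nat)"
proof (cases "i < length vs")
  case True
  then show ?thesis using sum_list_update[OF True, of a] by simp
qed (simp add: list_update_beyond)

lemma sum_list_map_nth_le:
  assumes "\<forall>i\<in>set \<rho>. i < length vs"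
  shows "sum_list (map ((!) vs) \<rho>) \<le> length \<rho> * sum_list (vs :: nat list)"
  using assms by (induction \<rho>) (auto intro!: add_mono elem_le_sum_list)

lemma nth_le_sum_list: "i < length vs \<Longrightarrow> vs ! i \<le> sum_list (vs :: nat list)"
  by (rule elem_le_sum_list)

lemma map_nth_update_cong: "\<forall>i\<in>set \<rho>. i \<noteq> j \<Longrightarrow> map ((!) (vs[j := a])) \<rho> = map ((!) vs) \<rho>"
  by auto

lemma cf_boundE:
  assumes "cf n F"
  obtains V where "polyfun V" "\<And>x vs. length vs = n \<Longrightarrow> F x vs \<le> V (length x + sum_list vs)"
  using assms unfolding cf_def by blast

lemma cf_progE:
  assumes "cf n F" "length \<rho> = n" "\<And>i. i \<in> set \<rho> \<Longrightarrow> i < d"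
  obtains p k T where "polyfun T" "prog_ok (k + 2) p" "d < k"
    "\<And>x w vs. k \<le> length vs \<Longrightarrow> zero_from d vs \<Longrightarrow>
        runs p (cfg x 0 w vs) (T (length x + sum_list vs)) (cfg x 0 w (vs[d := F x (map ((!) vs)
            \<rho>)]))"
proof -
  obtain p k T where "computes F \<rho> d p k T" using assms unfolding cf_def by blast
  then show ?thesis using that[of T k p] unfolding computes_def by blast
qed

lemma cfI:
  assumes "polyfun V" "\<And>x vs. length vs = n \<Longrightarrow> F x vs \<le> V (length x + sum_list vs)"
    and "\<And>\<rho> d. length \<rho> = n \<Longrightarrow> (\<And>i. i \<in> set \<rho> \<Longrightarrow> i < d) \<Longrightarrow> \<exists>p k T. computes F \<rho> d p k T"
  shows "cf n F"
  unfolding cf_def using assms by blast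

lemma cf_cong:
  assumes "cf n F" "\<And>x vs. length vs = n \<Longrightarrow> F x vs = G x vs"
  shows "cf n G"
proof -
  have "computes F \<rho> d p k T \<longleftrightarrow> computes G \<rho> d p k T" if "length \<rho> = n" for \<rho> d p k T
    using assms(2)[of "map _ \<rho>"] that by (simp add: computes_def)
  moreover obtain V where "polyfun V"
    "\<And>x vs. length vs = n \<Longrightarrow> F x vs \<le> V (length x + sum_list vs)"
    using cf_boundE[OF assms(1)] by blast
  ultimately show ?thesis
    using assms by (intro cfI[of V]) (auto simp: cf_def)
qed

lemma cf_rename:
  assumes F: "cf n F" and \<sigma>: "length \<sigma> = n" "\<forall>i\<in>set \<sigma>. i < m"
  shows "cf m (\<lambda>x vs. F x (map ((!) vs) \<sigma>))"
proof -
  obtain V where V: "polyfun V" "\<And>x vs. length vs = n \<Longrightarrow> F x vs \<le> V (length x + sum_list vs)"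
    using cf_boundE[OF F] by blast
  show ?thesis
  proof (rule cfI)
    \<comment> \<open>A variable can occur up to \<open>n\<close> times in \<open>\<sigma>\<close>,
      which multiplies the sum of the arguments by at most \<open>n\<close>.\<close>
    show "polyfun (\<lambda>s. V (Suc n * s))"
      by (intro polyfun_comp[OF V(1)] polyfun_intros)
    fix x and vs :: "nat list" assume vs: "length vs = m"
    have "F x (map ((!) vs) \<sigma>) \<le> V (length x + sum_list (map ((!) vs) \<sigma>))"
      by (rule V(2)) (simp add: \<sigma>)
    also have "\<dots> \<le> V (Suc n * (length x + sum_list vs))"
      using sum_list_map_nth_le[of \<sigma> vs] \<sigma> vs
      by (intro polyfun_mono[OF V(1)]) (simp add: algebra_simps)
    finally show "F x (map ((!) vs) \<sigma>) \<le> V (Suc n * (length x + sum_list vs))" .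
  next
    fix \<rho> :: "nat list" and d assume \<rho>: "length \<rho> = m" "\<And>i. i \<in> set \<rho> \<Longrightarrow> i < d"
    let ?\<tau> = "map ((!) \<rho>) \<sigma>"
    have "map ((!) vs) ?\<tau> = map ((!) (map ((!) vs) \<rho>)) \<sigma>" for vs :: "nat list"
      using \<rho> \<sigma> by auto
    moreover obtain p k T where "computes F ?\<tau> d p k T"
      using F \<rho> \<sigma> unfolding cf_def
      by (metis (no_types, lifting) image_iff length_map list.set_map nth_mem)
    ultimately show "\<exists>p k T. computes (\<lambda>x vs. F x (map ((!) vs) \<sigma>)) \<rho> d p k T"
      unfolding computes_def by metis
  qed
qed

text \<open>Reading a unary counter empties it, so its value is moved to \<open>d\<close> and
  \<open>d + 1\<close> at once and then moved back from \<open>d + 1\<close>.\<close>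

lemma cf_var:
  assumes "i < n"
  shows "cf n (\<lambda>x vs. vs ! i)"
proof (rule cfI)
  show "polyfun (\<lambda>s. s)" by (rule polyfun_id)
  show "vs ! i \<le> length x + sum_list vs" if "length vs = n" for x :: "bool list"
      and vs :: "nat list"
    using nth_le_sum_list[of i vs] assms that by simp
next
  fix \<rho> :: "nat list" and d assume \<rho>: "length \<rho> = n" "\<And>i. i \<in> set \<rho> \<Longrightarrow> i < d"
  define r where "r = \<rho> ! i"
  have r: "r < d" using \<rho> assms by (simp add: r_def)
  let ?p = "Seq (loop r (Seq (inc d) (inc (d + 1)))) (move_ctr (d + 1) r)"
  let ?T = "\<lambda>s :: nat. 5 * s + 1 + (4 * s + 1)"
  have "runs ?p (cfg x 0 w vs) (?T (length x + sum_list vs))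
      (cfg x 0 w (vs[d := map ((!) vs) \<rho> ! i]))"
    if k: "d + 2 \<le> length vs" and z: "zero_from d vs" for x w vs
  proof -
    have zs: "vs ! d = 0" "vs ! (d + 1) = 0" using k zero_fromD[OF z] by auto
    let ?V = "\<lambda>j. vs[r := vs ! r - j, d := j, d + 1 := j]"
    have "runs (loop r (Seq (inc d) (inc (d + 1)))) (cfg x 0 w (?V 0)) (vs ! r * (2 + 3) + 1)
        (cfg x 0 w (?V (vs ! r)))"
    proof (rule runs_loop[where J = "\<lambda>_. 0" and W = "\<lambda>_. w" and V = ?V])
      fix j assume j: "j < vs ! r"
      have "runs (inc d) (cfg x 0 w ((?V j)[r := vs ! r - Suc j])) 1
          (cfg x 0 w ((?V j)[r := vs ! r - Suc j, d := Suc j]))"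
        using k r by (intro runs_inc_eq) (auto simp: nth_list_update)
      moreover have "runs (inc (d + 1)) (cfg x 0 w ((?V j)[r := vs ! r - Suc j, d := Suc j])) 1
          (cfg x 0 w (?V (Suc j)))"
        using k r by (intro runs_inc_eq) (auto simp: nth_list_update intro!: nth_equalityI)
      ultimately show "runs (Seq (inc d) (inc (d + 1))) (cfg x 0 w ((?V j)[r := vs ! r - Suc j])) 2
          (cfg x 0 w (?V (Suc j)))"
        using runs_Seq by (metis nat_1_add_1)
    qed (use k r in \<open>auto simp: nth_list_update\<close>)
    moreover have "?V 0 = vs"
      using zs k r by (auto simp: nth_list_update intro!: nth_equalityI)
    moreover have "runs (move_ctr (d + 1) r) (cfg x 0 w (?V (vs ! r))) (4 * (vs ! r) + 1)
        (cfg x 0 w (vs[d := vs ! r]))"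
      using zs k r by (intro runs_move_ctr_eq) (auto simp: nth_list_update intro!: nth_equalityI)
    ultimately have "runs ?p (cfg x 0 w vs) (vs ! r * (2 + 3) + 1 + (4 * (vs ! r) + 1))
        (cfg x 0 w (vs[d := vs ! r]))"
      using runs_Seq by metis
    then show ?thesis
      using nth_le_sum_list[of r vs] k r \<rho>(1) assms
      by (auto elim!: runs_mono simp: r_def)
  qed
  moreover have "polyfun ?T" by (intro polyfun_intros)
  ultimately have "computes (\<lambda>x vs. vs ! i) \<rho> d ?p (d + 2) ?T"
    using r by (auto simp: computes_def)
  then show "\<exists>p k T. computes (\<lambda>x vs. vs ! i) \<rho> d p k T" by blast
qed

lemma cf_zero: "cf n (\<lambda>x vs. 0)"
proof (rule cfI)
  show "polyfun (\<lambda>s. 0)" by (intro polyfun_intros)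
  fix \<rho> :: "nat list" and d :: nat
  have "runs skip (cfg x 0 w vs) 1 (cfg x 0 w (vs[d := 0]))" if "d < length vs" "zero_from d vs"
      for x w vs
  proof -
    have "vs[d := 0] = vs" using zero_fromD[OF that(2)] that by (metis le_refl list_update_id)
    then show ?thesis using runs_skip by simp
  qed
  then have "computes (\<lambda>x vs. 0) \<rho> d skip (d + 1) (\<lambda>s. 1)"
    by (auto simp: computes_def intro!: polyfun_intros)
  then show "\<exists>p k T. computes (\<lambda>x vs. 0) \<rho> d p k T" by blast
qed simp

lemma cf_Suc:
  assumes F: "cf n F"
  shows "cf n (\<lambda>x vs. Suc (F x vs))"
proof -
  obtain V where V: "polyfun V" "\<And>x vs. length vs = n \<Longrightarrow> F x vs \<le> V (length x + sum_list vs)"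
    using cf_boundE[OF F] by blast
  show ?thesis
  proof (rule cfI)
    show "polyfun (\<lambda>s. Suc (V s))" by (intro polyfun_intros V)
    show "Suc (F x vs) \<le> Suc (V (length x + sum_list vs))" if "length vs = n" for x vs
      using V(2)[OF that] by simp
    fix \<rho> :: "nat list" and d assume \<rho>: "length \<rho> = n" "\<And>i. i \<in> set \<rho> \<Longrightarrow> i < d"
    obtain p k T where p: "polyfun T" "prog_ok (k + 2) p" "d < k"
      "\<And>x w vs. k \<le> length vs \<Longrightarrow> zero_from d vs \<Longrightarrow>
        runs p (cfg x 0 w vs) (T (length x + sum_list vs)) (cfg x 0 w (vs[d := F x (map ((!) vs)
            \<rho>)]))"
      using cf_progE[OF F \<rho>] by metis
    have "runs (Seq p (inc d)) (cfg x 0 w vs) (Suc (T (length x + sum_list vs)))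
        (cfg x 0 w (vs[d := Suc (F x (map ((!) vs) \<rho>))]))"
      if "k \<le> length vs" "zero_from d vs" for x w vs
      using runs_Seq[OF p(4)[OF that, of x w] runs_inc[of d]] p(3) that by simp
    then have "computes (\<lambda>x vs. Suc (F x vs)) \<rho> d (Seq p (inc d)) k (\<lambda>s. Suc (T s))"
      using p by (auto simp: computes_def intro!: polyfun_intros)
    then show "\<exists>p k T. computes (\<lambda>x vs. Suc (F x vs)) \<rho> d p k T" by blast
  qed
qed

lemma cf_const: "cf n (\<lambda>x vs. c)"
  by (induction c) (auto intro: cf_zero cf_Suc)

lemma cf_prog_boundE:
  assumes "cf n F" "length \<rho> = n" "\<And>i. i \<in> set \<rho> \<Longrightarrow> i < d"
  obtains p k T V where "polyfun T" "polyfun V" "prog_ok (k + 2) p" "d < k"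
    "\<And>x w vs. k \<le> length vs \<Longrightarrow> zero_from d vs \<Longrightarrow>
        runs p (cfg x 0 w vs) (T (length x + sum_list vs)) (cfg x 0 w (vs[d := F x (map ((!) vs)
            \<rho>)]))"
    "\<And>x vs. d \<le> length vs \<Longrightarrow> F x (map ((!) vs) \<rho>) \<le> V (length x + sum_list vs)"
proof -
  obtain V where V: "polyfun V" "\<And>x vs. length vs = n \<Longrightarrow> F x vs \<le> V (length x + sum_list vs)"
    using cf_boundE[OF assms(1)] by blast
  obtain p k T where p: "polyfun T" "prog_ok (k + 2) p" "d < k"
      "\<And>x w vs. k \<le> length vs \<Longrightarrow> zero_from d vs \<Longrightarrow>
        runs p (cfg x 0 w vs) (T (length x + sum_list vs)) (cfg x 0 w (vs[d := F x (map ((!) vs)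
            \<rho>)]))"
    using cf_progE[OF assms] by metis
  have "F x (map ((!) vs) \<rho>) \<le> V (Suc n * (length x + sum_list vs))" if "d \<le> length vs" for x vs
  proof -
    have "F x (map ((!) vs) \<rho>) \<le> V (length x + sum_list (map ((!) vs) \<rho>))"
      by (rule V(2)) (simp add: assms)
    also have "\<dots> \<le> V (Suc n * (length x + sum_list vs))"
      using sum_list_map_nth_le[of \<rho> vs] assms(2,3) that
      by (intro polyfun_mono[OF V(1)]) (force simp: algebra_simps)
    finally show ?thesis .
  qed
  moreover have "polyfun (\<lambda>s. V (Suc n * s))"
    by (intro polyfun_comp[OF V(1)] polyfun_intros)
  ultimately show ?thesis using that p by blast
qed

lemma prog_ok_max: "prog_ok (k + 2) p \<Longrightarrow> prog_ok (max k l + 2) p" "prog_ok (l + 2) p \<Longrightarrow>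
    prog_ok (max k l + 2) p"
  by (auto elim: prog_ok_mono)

text \<open>The second operand is computed into \<open>d + 1\<close> while the first already
  occupies \<open>d\<close>, so its time bound is taken at the size enlarged by the first value. The
  allowance \<open>10 * b + 1\<close> is loose enough for both addition and truncated
  subtraction.\<close>

lemma cf_binop:
  assumes F: "cf n F" and G: "cf n G"
    and op_ok: "\<And>d. prog_ok (d + 4) (op d)" and op_le: "\<And>a b. h a b \<le> a + b"
    and op: "\<And>d x w vs a b. d + 1 < length vs \<Longrightarrow> vs ! d = 0 \<Longrightarrow> vs ! (d + 1) = 0 \<Longrightarrow>
      runs (op d) (cfg x 0 w (vs[d := a, d + 1 := b])) (10 * b + 1) (cfg x 0 w (vs[d := h a b]))"
  shows "cf n (\<lambda>x vs. h (F x vs) (G x vs))"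
proof -
  obtain V where V: "polyfun V" "\<And>x vs. length vs = n \<Longrightarrow> F x vs \<le> V (length x + sum_list vs)"
    using cf_boundE[OF F] by blast
  obtain W where W: "polyfun W" "\<And>x vs. length vs = n \<Longrightarrow> G x vs \<le> W (length x + sum_list vs)"
    using cf_boundE[OF G] by blast
  show ?thesis
  proof (rule cfI)
    show "polyfun (\<lambda>s. V s + W s)" by (intro polyfun_intros V W)
    show "h (F x vs) (G x vs) \<le> V (length x + sum_list vs) + W (length x + sum_list vs)"
      if "length vs = n" for x vs
      using op_le[of "F x vs" "G x vs"] V(2)[OF that, of x] W(2)[OF that, of x] by linarith
    fix \<rho> :: "nat list" and d assume \<rho>: "length \<rho> = n" "\<And>i. i \<in> set \<rho> \<Longrightarrow> i < d"
    then have \<rho>': "\<And>i. i \<in> set \<rho> \<Longrightarrow> i < d + 1" by (simp add: less_SucI)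
    obtain p k T V' where p: "polyfun T" "polyfun V'" "prog_ok (k + 2) p" "d < k"
      "\<And>x w vs. k \<le> length vs \<Longrightarrow> zero_from d vs \<Longrightarrow>
        runs p (cfg x 0 w vs) (T (length x + sum_list vs)) (cfg x 0 w (vs[d := F x (map ((!) vs)
            \<rho>)]))"
      "\<And>x vs. d \<le> length vs \<Longrightarrow> F x (map ((!) vs) \<rho>) \<le> V' (length x + sum_list vs)"
      using cf_prog_boundE[OF F \<rho>] by metis
    obtain q l U W' where q: "polyfun U" "polyfun W'" "prog_ok (l + 2) q" "d + 1 < l"
      "\<And>x w vs. l \<le> length vs \<Longrightarrow> zero_from (d + 1) vs \<Longrightarrow>
        runs q (cfg x 0 w vs) (U (length x + sum_list vs)) (cfg x 0 w (vs[d + 1 := G x (map ((!) vs)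
            \<rho>)]))"
      "\<And>x vs. d + 1 \<le> length vs \<Longrightarrow> G x (map ((!) vs) \<rho>) \<le> W' (length x + sum_list vs)"
      using cf_prog_boundE[OF G \<rho>(1) \<rho>'] by metis
    let ?T = "\<lambda>s. T s + (U (s + V' s) + (10 * W' s + 1))"
    let ?p = "Seq p (Seq q (op d))"
    have "runs ?p (cfg x 0 w vs) (?T (length x + sum_list vs))
        (cfg x 0 w (vs[d := h (F x (map ((!) vs) \<rho>)) (G x (map ((!) vs) \<rho>))]))"
      if len: "max k l \<le> length vs" and z: "zero_from d vs" for x w vs
    proof -
      let ?a = "F x (map ((!) vs) \<rho>)" and ?b = "G x (map ((!) vs) \<rho>)"
          and ?s = "length x + sum_list vs"
      have a: "?a \<le> V' ?s" and b: "?b \<le> W' ?s" using p(4,6) q(4,6) len by auto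
      have "runs p (cfg x 0 w vs) (T ?s) (cfg x 0 w (vs[d := ?a]))"
        using p(5) len z by simp
      moreover have "runs q (cfg x 0 w (vs[d := ?a])) (U (?s + V' ?s)) (cfg x 0 w (vs[d := ?a, d
          + 1 := ?b]))"
      proof -
        have "map ((!) (vs[d := ?a])) \<rho> = map ((!) vs) \<rho>"
          by (rule map_nth_update_cong) (use \<rho>(2) in blast)
        moreover have "runs q (cfg x 0 w (vs[d := ?a])) (U (length x + sum_list (vs[d := ?a])))
            (cfg x 0 w ((vs[d := ?a])[d + 1 := G x (map ((!) (vs[d := ?a])) \<rho>)]))"
          by (rule q(5)) (use len zero_from_update[OF z, of "d + 1" d] in auto)
        ultimately have "runs q (cfg x 0 w (vs[d := ?a])) (U (length x + sum_list (vs[d := ?a])))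
            (cfg x 0 w (vs[d := ?a, d + 1 := ?b]))" by (simp only:)
        then show ?thesis
          by (rule runs_mono) (use sum_list_update_le[of vs d ?a] a in \<open>auto intro!: polyfun_mono[OF
              q(1)]\<close>)
      qed
      moreover have "runs (op d) (cfg x 0 w (vs[d := ?a, d + 1 := ?b])) (10 * W' ?s + 1)
          (cfg x 0 w (vs[d := h ?a ?b]))"
        by (rule runs_mono[OF op]) (use len q(4) b zero_fromD[OF z] in auto)
      ultimately show ?thesis using runs_Seq by blast
    qed
    moreover have "polyfun ?T"
      by (intro polyfun_intros polyfun_comp[OF q(1)] p(1,2) q(2))
    moreover have "prog_ok (max k l + 2) (op d)"
      by (rule prog_ok_mono[OF op_ok[of d]]) (use q(4) in auto)
    ultimately have "computes (\<lambda>x vs. h (F x vs) (G x vs)) \<rho> d ?p (max k l) ?T"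
      using p(3,4) q(3) prog_ok_max by (auto simp: computes_def)
    then show "\<exists>p k T. computes (\<lambda>x vs. h (F x vs) (G x vs)) \<rho> d p k T" by blast
  qed
qed

lemma cf_add: "cf n F \<Longrightarrow> cf n G \<Longrightarrow> cf n (\<lambda>x vs. F x vs + G x vs)"
proof (rule cf_binop[where h = "(+)" and op = "\<lambda>d. move_ctr (d + 1) d"])
  fix d x w and vs :: "nat list" and a b
  assume "d + 1 < length vs" "vs ! d = 0" "vs ! (d + 1) = 0"
  then have "runs (move_ctr (d + 1) d) (cfg x 0 w (vs[d := a, d + 1 := b])) (4 * b + 1)
      (cfg x 0 w (vs[d := a + b]))"
    by (intro runs_move_ctr_eq) (auto simp: nth_list_update intro!: nth_equalityI)
  then show "runs (move_ctr (d + 1) d) (cfg x 0 w (vs[d := a, d + 1 := b])) (10 * b + 1)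
      (cfg x 0 w (vs[d := a + b]))" by (rule runs_mono) simp
qed auto

lemma cf_diff: "cf n F \<Longrightarrow> cf n G \<Longrightarrow> cf n (\<lambda>x vs. F x vs - G x vs)"
proof (rule cf_binop[where h = "(-)" and op = "\<lambda>d. loop (d + 1) (if_zero d skip (dec d))"])
  fix d x w and vs :: "nat list" and a b
  assume v: "d + 1 < length vs" "vs ! d = 0" "vs ! (d + 1) = 0"
  let ?V = "\<lambda>j. vs[d := a - j, d + 1 := b - j]"
  have "runs (loop (d + 1) (if_zero d skip (dec d))) (cfg x 0 w (?V 0)) (b * (3 + 3) + 1)
      (cfg x 0 w (?V b))"
  proof (rule runs_loop[where J = "\<lambda>_. 0" and W = "\<lambda>_. w" and V = ?V])
    fix j assume j: "j < b"
    have "runs (if_zero d skip (dec d)) (cfg x 0 w ((?V j)[d + 1 := b - Suc j])) (1 + 2)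
        (cfg x 0 w (?V (Suc j)))"
    proof (rule runs_if_zero)
      assume "(?V j)[d + 1 := b - Suc j] ! d = 0"
      then have "(?V j)[d + 1 := b - Suc j] = ?V (Suc j)"
        using v by (auto simp: nth_list_update intro!: nth_equalityI)
      then show "runs skip (cfg x 0 w ((?V j)[d + 1 := b - Suc j])) 1 (cfg x 0 w (?V (Suc j)))"
        using runs_skip by simp
    next
      assume "(?V j)[d + 1 := b - Suc j] ! d \<noteq> 0"
      then show "runs (dec d) (cfg x 0 w ((?V j)[d + 1 := b - Suc j])) 1 (cfg x 0 w (?V (Suc j)))"
        using v by (intro runs_dec_eq) (auto simp: nth_list_update intro!: nth_equalityI)
    qed (use v in auto)
    then show "runs (if_zero d skip (dec d)) (cfg x 0 w ((?V j)[d + 1 := b - Suc j])) 3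
        (cfg x 0 w (?V (Suc j)))" by (rule runs_mono) simp
  qed (use v in auto)
  moreover have "?V b = vs[d := a - b]" using v
      by (auto simp: nth_list_update intro!: nth_equalityI)
  ultimately show "runs (loop (d + 1) (if_zero d skip (dec d))) (cfg x 0 w (vs[d := a, d + 1 := b]))
      (10 * b + 1) (cfg x 0 w (vs[d := a - b]))"
    by (auto elim!: runs_mono)
qed auto

text \<open>Bounded sums are the source of all bounded search below. Counter \<open>d\<close>
  accumulates, \<open>d + 1\<close> counts the remaining terms, \<open>d + 2\<close> holds the
  index, and \<open>d + 3\<close> receives each term before it is emptied into
  \<open>d\<close>.\<close>

lemma cf_sum:
  assumes F: "cf n F" and G: "cf (Suc n) G"
  shows "cf n (\<lambda>x vs. \<Sum>k<F x vs. G x (k # vs))"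
proof -
  obtain V where V: "polyfun V" "\<And>x vs. length vs = n \<Longrightarrow> F x vs \<le> V (length x + sum_list vs)"
    using cf_boundE[OF F] by blast
  obtain W where W: "polyfun W" "\<And>x vs. length vs = Suc n \<Longrightarrow> G x vs \<le> W (length x + sum_list vs)"
    using cf_boundE[OF G] by blast
  show ?thesis
  proof (rule cfI)
    show "polyfun (\<lambda>s. V s * W (V s + s))" by (intro polyfun_intros polyfun_comp[OF W(1)] V)
    show "(\<Sum>k<F x vs. G x (k # vs)) \<le> V (length x + sum_list vs) * W (V (length x + sum_list vs)
        + (length x + sum_list vs))"
      if len: "length vs = n" for x vs
    proof -
      let ?s = "length x + sum_list vs"
      have "G x (k # vs) \<le> W (V ?s + ?s)" if "k < F x vs" for k
        by (rule order.trans[OF W(2)]) (use len that V(2)[OF len, of x] in \<open>auto intro!: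
            polyfun_mono[OF W(1)]\<close>)
      then have "(\<Sum>k<F x vs. G x (k # vs)) \<le> F x vs * W (V ?s + ?s)"
        using sum_bounded_above[of "{..<F x vs}" "\<lambda>k. G x (k # vs)" "W (V ?s + ?s)"] by simp
      also have "\<dots> \<le> V ?s * W (V ?s + ?s)" using V(2)[OF len] by (simp add: mult_right_mono)
      finally show ?thesis .
    qed
    fix \<rho> :: "nat list" and d assume \<rho>: "length \<rho> = n" "\<And>i. i \<in> set \<rho> \<Longrightarrow> i < d"
    have \<rho>1: "\<And>i. i \<in> set \<rho> \<Longrightarrow> i < d + 1" and \<rho>2: "\<And>i. i \<in> set ((d + 2) # \<rho>) \<Longrightarrow> i < d + 3"
      and len2: "length ((d + 2) # \<rho>) = Suc n"
      using \<rho> by (auto simp: less_SucI dest!: \<rho>(2))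
    obtain p k T V' where p: "polyfun T" "polyfun V'" "prog_ok (k + 2) p" "d + 1 < k"
      "\<And>x w vs. k \<le> length vs \<Longrightarrow> zero_from (d + 1) vs \<Longrightarrow>
        runs p (cfg x 0 w vs) (T (length x + sum_list vs)) (cfg x 0 w (vs[d + 1 := F x (map ((!) vs)
            \<rho>)]))"
      "\<And>x vs. d + 1 \<le> length vs \<Longrightarrow> F x (map ((!) vs) \<rho>) \<le> V' (length x + sum_list vs)"
      using cf_prog_boundE[OF F \<rho>(1) \<rho>1] by metis
    obtain q l U where q: "polyfun U" "prog_ok (l + 2) q" "d + 3 < l"
      "\<And>x w vs. l \<le> length vs \<Longrightarrow> zero_from (d + 3) vs \<Longrightarrow>
        runs q (cfg x 0 w vs) (U (length x + sum_list vs)) (cfg x 0 w (vs[d + 3 := G x (map ((!) vs)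
            ((d + 2) # \<rho>))]))"
      using cf_progE[OF G len2 \<rho>2] by metis
    let ?W = "\<lambda>s. W (V' s + Suc n * s)"
    \<comment> \<open>During a round the counters exceed their initial size by at most the partial
      sum, the index and the remaining count; this is the argument of \<open>U\<close>.\<close>
    let ?t = "\<lambda>s. U (s + V' s * ?W s + V' s + V' s) + ((4 * ?W s + 1) + 1)"
    let ?T = "\<lambda>s. T s + ((V' s * (?t s + 3) + 1) + (4 * V' s + 1))"
    let ?body = "Seq q (Seq (move_ctr (d + 3) d) (inc (d + 2)))"
    let ?p = "Seq p (Seq (loop (d + 1) ?body) (clear (d + 2)))"
    have "runs ?p (cfg x 0 w vs) (?T (length x + sum_list vs))
        (cfg x 0 w (vs[d := \<Sum>k<F x (map ((!) vs) \<rho>). G x (k # map ((!) vs) \<rho>)]))"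
      if len: "max k l \<le> length vs" and z: "zero_from d vs" for x w vs
    proof -
      define f where "f = F x (map ((!) vs) \<rho>)"
      define g where "g = (\<lambda>k. G x (k # map ((!) vs) \<rho>))"
      define s where "s = length x + sum_list vs"
      have f: "f \<le> V' s" using p(4,6) len unfolding f_def s_def by auto
      have d: "d + 3 < length vs" using q(3) len by auto
      have zs: "vs ! d = 0" "vs ! (d + 1) = 0" "vs ! (d + 2) = 0" "vs ! (d + 3) = 0"
        using d zero_fromD[OF z] by auto
      have g: "g j \<le> ?W s" if "j < f" for j
      proof -
        have "g j \<le> W (length x + sum_list (j # map ((!) vs) \<rho>))"
          unfolding g_def by (rule W(2)) (simp add: \<rho>)
        also have "\<dots> \<le> ?W s"
        proof (rule polyfun_mono[OF W(1)])
          have "sum_list (map ((!) vs) \<rho>) \<le> n * sum_list vs"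
            using sum_list_map_nth_le[of \<rho> vs] \<rho> d by force
          then show "length x + sum_list (j # map ((!) vs) \<rho>) \<le> V' s + Suc n * s"
            using that f by (simp add: s_def algebra_simps)
        qed
        finally show ?thesis .
      qed
      let ?V = "\<lambda>j. vs[d := sum g {..<j}, d + 1 := f - j, d + 2 := j]"
      have A: "sum g {..<j} \<le> V' s * ?W s" if "j \<le> f" for j
      proof -
        have "sum g {..<j} \<le> j * ?W s"
          using sum_bounded_above[of "{..<j}" g "?W s"] g that by force
        also have "\<dots> \<le> V' s * ?W s" using f that by (intro mult_right_mono) auto
        finally show ?thesis .
      qed
      have "runs p (cfg x 0 w vs) (T s) (cfg x 0 w (?V 0))"
      proof -
        have "?V 0 = vs[d + 1 := f]" using zs d
            by (auto simp: nth_list_update intro!: nth_equalityI)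
        then show ?thesis using p(5)[of vs x w] len zero_from_mono[OF z, of "d + 1"]
            by (simp add: f_def s_def)
      qed
      moreover have "runs (loop (d + 1) ?body) (cfg x 0 w (?V 0)) (f * (?t s + 3)
          + 1) (cfg x 0 w (?V f))"
      proof (rule runs_loop[where J = "\<lambda>_. 0" and W = "\<lambda>_. w" and V = ?V])
        fix j assume j: "j < f"
        let ?v = "(?V j)[d + 1 := f - Suc j]"
        have args: "map ((!) ?v) ((d + 2) # \<rho>) = j # map ((!) vs) \<rho>"
          using \<rho> d by (auto simp: nth_list_update dest: \<rho>(2))
        have gj: "G x (map ((!) ?v) ((d + 2) # \<rho>)) = g j"
          unfolding args by (simp add: g_def)
        have "sum_list ?v \<le> sum_list vs + sum g {..<j} + j + (f - Suc j)"
        proof -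
          have eq: "?v = vs[d := sum g {..<j}, d + 2 := j, d + 1 := f - Suc j]"
            using d by (auto simp: nth_list_update intro!: nth_equalityI)
          show ?thesis unfolding eq
            using sum_list_update_le[of "vs[d := sum g {..<j}, d + 2 := j]" "d + 1" "f - Suc j"]
              sum_list_update_le[of "vs[d := sum g {..<j}]" "d + 2" j]
              sum_list_update_le[of vs d "sum g {..<j}"] by linarith
        qed
        then have sz: "length x + sum_list ?v \<le> s + V' s * ?W s + V' s + V' s"
          using A[of j] f j unfolding s_def by linarith
        have "zero_from (d + 3) ?v" using z by (auto simp: zero_from_def)
        then have "runs q (cfg x 0 w ?v) (U (length x + sum_list ?v))
            (cfg x 0 w (?v[d + 3 := G x (map ((!) ?v) ((d + 2) # \<rho>))]))"
          by (intro q(4)) (use len in auto)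
        then have "runs q (cfg x 0 w ?v) (U (length x + sum_list ?v)) (cfg x 0 w (?v[d
            + 3 := g j]))"
          by (simp only: gj)
        then have "runs q (cfg x 0 w ?v) (U (s + V' s * ?W s + V' s + V' s)) (cfg x 0 w (?v[d
            + 3 := g j]))"
          by (rule runs_mono) (rule polyfun_mono[OF q(1) sz])
        moreover have "runs (move_ctr (d + 3) d) (cfg x 0 w (?v[d + 3 := g j])) (4 * ?W s + 1)
            (cfg x 0 w (?v[d := sum g {..<Suc j}]))"
          using d zs g[OF j]
          by (intro runs_move_ctr_eq) (auto simp: nth_list_update intro!: nth_equalityI)
        moreover have "runs (inc (d + 2)) (cfg x 0 w (?v[d := sum g {..<Suc j}])) 1
            (cfg x 0 w (?V (Suc j)))"
          using d by (intro runs_inc_eq) (auto simp: nth_list_update intro!: nth_equalityI)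
        ultimately show "runs ?body (cfg x 0 w ?v) (?t s) (cfg x 0 w (?V (Suc j)))"
          using runs_Seq by blast
      qed (use d in auto)
      then have "runs (loop (d + 1) ?body) (cfg x 0 w (?V 0)) (V' s * (?t s + 3)
          + 1) (cfg x 0 w (?V f))"
        by (rule runs_mono) (use f in \<open>intro add_right_mono mult_right_mono, auto\<close>)
      moreover have "runs (clear (d + 2)) (cfg x 0 w (?V f)) (4 * V' s
          + 1) (cfg x 0 w (vs[d := sum g {..<f}]))"
        using d f zs by (intro runs_clear_eq) (auto simp: nth_list_update intro!: nth_equalityI)
      ultimately show ?thesis using runs_Seq unfolding f_def g_def s_def by blast
    qed
    moreover have "polyfun ?T"
      by (intro polyfun_intros polyfun_comp[OF q(1)] polyfun_comp[OF W(1)] p(1,2))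
    ultimately have "computes (\<lambda>x vs. \<Sum>k<F x vs. G x (k # vs)) \<rho> d ?p (max k l) ?T"
      using p(3,4) q(2,3) prog_ok_max by (auto simp: computes_def)
    then show "\<exists>p k T. computes (\<lambda>x vs. \<Sum>k<F x vs. G x (k # vs)) \<rho> d p k T" by blast
  qed
qed

lemma cf_tl:
  assumes "cf n F"
  shows "cf (Suc n) (\<lambda>x vs. F x (tl vs))"
proof (rule cf_cong[OF cf_rename[OF assms, of "[1..<Suc n]" "Suc n"]])
  show "F x (map ((!) vs) [1..<Suc n]) = F x (tl vs)" if "length vs = Suc n" for x vs
  proof -
    have "map ((!) vs) [1..<Suc n] = tl vs" using that
        by (intro nth_equalityI) (auto simp: nth_tl simp del: upt_Suc)
    then show ?thesis by simp
  qed
qed auto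

lemma input_symbol_eq:
  "input_symbol x j = (if j < length x then bit_symbol (x ! j) else 0)"
  by (simp add: input_symbol_def word_contents_def)

text \<open>The input head walks to the wanted position while \<open>d + 2\<close> counts its steps,
  and \<open>d + 2\<close> then drives the way back. Positions behind the input show the blank and
  give 0.\<close>

lemma cf_input:
  assumes F: "cf n F"
  shows "cf n (\<lambda>x vs. input_symbol x (F x vs))"
proof (rule cfI)
  show "polyfun (\<lambda>s. 2)" by (rule polyfun_const)
  have "input_symbol x j \<le> 2" for x j
    using bit_symbol_less_3[of "x ! j"] by (simp add: input_symbol_eq)
  then show "input_symbol x (F x vs) \<le> 2" for x vs .
next
  fix \<rho> :: "nat list" and d assume \<rho>: "length \<rho> = n" "\<And>i. i \<in> set \<rho> \<Longrightarrow> i < d"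
  have \<rho>1: "\<And>i. i \<in> set \<rho> \<Longrightarrow> i < d + 1" using \<rho>(2) by (simp add: less_SucI)
  obtain p k T V where p: "polyfun T" "polyfun V" "prog_ok (k + 2) p" "d + 1 < k"
    "\<And>x w vs. k \<le> length vs \<Longrightarrow> zero_from (d + 1) vs \<Longrightarrow>
      runs p (cfg x 0 w vs) (T (length x + sum_list vs)) (cfg x 0 w (vs[d + 1 := F x (map ((!) vs)
          \<rho>)]))"
    "\<And>x vs. d + 1 \<le> length vs \<Longrightarrow> F x (map ((!) vs) \<rho>) \<le> V (length x + sum_list vs)"
    using cf_prog_boundE[OF F \<rho>(1) \<rho>1] by metis
  let ?go = "loop (d + 1) (Seq (input_move Move_Right) (inc (d + 2)))"
  let ?get = "Cond 1 (\<lambda>s. s = 0) skip (Cond 1 (\<lambda>s. s = 1) (inc d) (Seq (inc d) (inc d)))"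
  let ?back = "loop (d + 2) (input_move Move_Left)"
  let ?p = "Seq p (Seq ?go (Seq ?get ?back))"
  let ?T = "\<lambda>s. T s + ((5 * V s + 1) + (6 + (4 * V s + 1)))"
  have "runs ?p (cfg x 0 w vs) (?T (length x + sum_list vs))
      (cfg x 0 w (vs[d := input_symbol x (F x (map ((!) vs) \<rho>))]))"
    if len: "k + 1 \<le> length vs" and z: "zero_from d vs" for x w vs
  proof -
    define f where "f = F x (map ((!) vs) \<rho>)"
    define s where "s = length x + sum_list vs"
    have f: "f \<le> V s" using p(4,6) len unfolding f_def s_def by auto
    have d: "d + 2 < length vs" using p(4) len by auto
    have zs: "vs ! d = 0" "vs ! (d + 1) = 0" "vs ! (d + 2) = 0" using d zero_fromD[OF z] by auto
    have "runs p (cfg x 0 w vs) (T s) (cfg x 0 w (vs[d + 1 := f]))"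
      using p(5)[of vs x w] len zero_from_mono[OF z, of "d + 1"] by (simp add: f_def s_def)
    moreover have "runs ?go (cfg x 0 w (vs[d + 1 := f])) (5 * V s + 1) (cfg x f w (vs[d + 2 := f]))"
    proof -
      let ?V = "\<lambda>j. vs[d + 1 := f - j, d + 2 := j]"
      have "runs ?go (cfg x 0 w (?V 0)) (f * (2 + 3) + 1) (cfg x f w (?V f))"
      proof (rule runs_loop[where J = "\<lambda>j. j" and W = "\<lambda>_. w" and V = ?V])
        fix j assume "j < f"
        have "runs (inc (d + 2)) (cfg x (Suc j) w ((?V j)[d + 1 := f - Suc j])) 1
            (cfg x (Suc j) w (?V (Suc j)))"
          using d by (intro runs_inc_eq) (auto simp: nth_list_update intro!: nth_equalityI)
        with runs_input_right[of x j w "(?V j)[d + 1 := f - Suc j]"]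
        show "runs (Seq (input_move Move_Right) (inc (d + 2))) (cfg x j w ((?V j)[d + 1 := f
            - Suc j])) 2
            (cfg x (Suc j) w (?V (Suc j)))"
          using runs_Seq by (metis nat_1_add_1)
      qed (use d in auto)
      moreover have "?V 0 = vs[d + 1 := f]" "?V f = vs[d + 2 := f]"
        using d zs by (auto simp: nth_list_update intro!: nth_equalityI)
      ultimately show ?thesis using f by (auto elim!: runs_mono)
    qed
    moreover have "runs ?get (cfg x f w (vs[d + 2 := f])) 6
        (cfg x f w (vs[d + 2 := f, d := input_symbol x f]))"
    proof -
      let ?v = "vs[d + 2 := f]"
      have r: "read_tape (cfg x f w ?v ! 1) = input_symbol x f" by (rule read_cfg)
      have "input_symbol x f \<in> {0, 1, 2}" by (cases "x ! f") (auto simp: input_symbol_eq)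
      then consider "input_symbol x f = 0" | "input_symbol x f = 1" | "input_symbol x f = 2"
        by (metis insert_iff empty_iff)
      then show ?thesis
      proof cases
        case 1
        then have "?v[d := input_symbol x f] = ?v" using zs d
          by (auto simp: nth_list_update intro!: nth_equalityI)
        then show ?thesis using runs_mono[OF runs_CondT[of _ _ 1, OF _ runs_skip]] r 1 by simp
      next
        case 2
        then have "runs (inc d) (cfg x f w ?v) 1 (cfg x f w (?v[d := input_symbol x f]))"
          using zs d by (intro runs_inc_eq) (auto simp: nth_list_update intro!: nth_equalityI)
        then have "runs (Cond 1 (\<lambda>s. s = 1) (inc d) (Seq (inc d) (inc d))) (cfg x f w ?v) (1 + 2)
            (cfg x f w (?v[d := input_symbol x f]))"
          by (rule runs_CondT[rotated]) (use r 2 in simp)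
        then have "runs ?get (cfg x f w ?v) (1 + 2 + 2) (cfg x f w (?v[d := input_symbol x f]))"
          by (rule runs_CondF[rotated]) (use r 2 in simp)
        then show ?thesis by (rule runs_mono) simp
      next
        case 3
        have "runs (inc d) (cfg x f w ?v) 1 (cfg x f w (?v[d := 1]))"
          using zs d by (intro runs_inc_eq) (auto simp: nth_list_update intro!: nth_equalityI)
        moreover have "runs (inc d) (cfg x f w (?v[d := 1])) 1
            (cfg x f w (?v[d := input_symbol x f]))"
          using zs d 3 by (intro runs_inc_eq) (auto simp: nth_list_update intro!: nth_equalityI)
        ultimately have "runs (Seq (inc d) (inc d)) (cfg x f w ?v) (1
            + 1) (cfg x f w (?v[d := input_symbol x f]))"
          by (rule runs_Seq)
        then have "runs (Cond 1 (\<lambda>s. s = 1) (inc d) (Seq (inc d) (inc d))) (cfg x f w ?v) (1 + 1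
            + 2)
            (cfg x f w (?v[d := input_symbol x f]))"
          by (rule runs_CondF[rotated]) (use r 3 in simp)
        then have "runs ?get (cfg x f w ?v) (1 + 1 + 2 + 2) (cfg x f w (?v[d := input_symbol x f]))"
          by (rule runs_CondF[rotated]) (use r 3 in simp)
        then show ?thesis by (rule runs_mono) simp
      qed
    qed
    moreover have "runs ?back (cfg x f w (vs[d + 2 := f, d := input_symbol x f])) (4 * V s + 1)
        (cfg x 0 w (vs[d := input_symbol x f]))"
    proof -
      let ?V = "\<lambda>j. vs[d + 2 := f - j, d := input_symbol x f]"
      have "runs ?back (cfg x (f - 0) w (?V 0)) (f * (1 + 3) + 1) (cfg x (f - f) w (?V f))"
      proof (rule runs_loop[where J = "\<lambda>j. f - j" and W = "\<lambda>_. w" and V = ?V])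
        fix j assume j: "j < f"
        have "(?V j)[d + 2 := f - Suc j] = ?V (Suc j)"
          using d by (auto simp: nth_list_update intro!: nth_equalityI)
        then show "runs (input_move Move_Left) (cfg x (f - j) w ((?V j)[d + 2 := f - Suc j])) 1
            (cfg x (f - Suc j) w (?V (Suc j)))"
          using runs_input_left[of "f - j" x w] j by simp
      qed (use d in auto)
      moreover have "?V f = vs[d := input_symbol x f]"
        using d zs by (auto simp: nth_list_update intro!: nth_equalityI)
      ultimately show ?thesis using f by (auto elim!: runs_mono)
    qed
    ultimately show ?thesis using runs_Seq unfolding f_def s_def by blast
  qed
  moreover have "polyfun ?T" by (intro polyfun_intros p(1,2))
  ultimately have "computes (\<lambda>x vs. input_symbol x (F x vs)) \<rho> d ?p (k + 1) ?T"
    using p(3,4) prog_ok_mono[OF p(3)] by (auto simp: computes_def)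
  then show "\<exists>p k T. computes (\<lambda>x vs. input_symbol x (F x vs)) \<rho> d p k T" by blast
qed

lemma bit_symbol_pos: "0 < bit_symbol b"
  by (cases b) auto

text \<open>The bits of the input are nonblank symbols, so its end is the first blank. The second
  copy of the count, in \<open>d + 1\<close>, returns the head.\<close>

lemma cf_length: "cf n (\<lambda>x vs. length x)"
proof (rule cfI)
  show "polyfun (\<lambda>s. s)" by (rule polyfun_id)
  fix \<rho> :: "nat list" and d :: nat
  let ?go = "While 1 (\<lambda>s. s \<noteq> 0) (Seq (input_move Move_Right) (Seq (inc d) (inc (d + 1))))"
  let ?back = "loop (d + 1) (input_move Move_Left)"
  let ?p = "Seq ?go ?back"
  let ?T = "\<lambda>s :: nat. (5 * s + 1) + (4 * s + 1)"
  have "runs ?p (cfg x 0 w vs) (?T (length x + sum_list vs)) (cfg x 0 w (vs[d := length x]))"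
    if d: "d + 2 \<le> length vs" and z: "zero_from d vs" for x w vs
  proof -
    have zs: "vs ! d = 0" "vs ! (d + 1) = 0" using d zero_fromD[OF z] by auto
    let ?m = "length x"
    have "runs ?go (cfg x 0 w vs) (5 * (length x + sum_list vs) + 1) (cfg x ?m w (vs[d := ?m, d
        + 1 := ?m]))"
    proof -
      let ?V = "\<lambda>j. vs[d := j, d + 1 := j]"
      let ?st = "\<lambda>j. cfg x j w (?V j)"
      have "runs ?go (?st 0) (?m * (3 + 2) + 1) (?st ?m)"
      proof (rule runs_While_iterate)
        fix j assume "j < ?m"
        then show "read_tape (?st j ! 1) \<noteq> 0"
          using read_cfg(2)[of x j w "?V j"] bit_symbol_pos[of "x ! j"]
              by (simp add: input_symbol_eq)
        have "runs (inc d) (cfg x (Suc j) w (?V j)) 1 (cfg x (Suc j) w (vs[d := Suc j, d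
            + 1 := j]))"
          using d by (intro runs_inc_eq) (auto simp: nth_list_update intro!: nth_equalityI)
        moreover have "runs (inc (d + 1)) (cfg x (Suc j) w (vs[d := Suc j, d
            + 1 := j])) 1 (?st (Suc j))"
          using d by (intro runs_inc_eq) (auto simp: nth_list_update intro!: nth_equalityI)
        ultimately have "runs (Seq (input_move Move_Right) (Seq (inc d) (inc (d + 1)))) (?st j) (1
            + (1 + 1)) (?st (Suc j))"
          by (rule runs_Seq[OF runs_input_right runs_Seq])
        then show "runs (Seq (input_move Move_Right) (Seq (inc d) (inc (d + 1)))) (?st j) 3
            (?st (Suc j))"
          by (rule runs_mono) simp
      next
        show "\<not> read_tape (?st ?m ! 1) \<noteq> 0"
          using read_cfg(2)[of x ?m w "?V ?m"] by (simp add: input_symbol_eq)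
      qed
      moreover have "?V 0 = vs" using zs d by (auto simp: nth_list_update intro!: nth_equalityI)
      ultimately show ?thesis by (auto elim!: runs_mono)
    qed
    moreover have "runs ?back (cfg x ?m w (vs[d := ?m, d + 1 := ?m])) (4 * (length x + sum_list vs)
        + 1)
        (cfg x 0 w (vs[d := ?m]))"
    proof -
      let ?V = "\<lambda>j. vs[d := ?m, d + 1 := ?m - j]"
      have "runs ?back (cfg x (?m - 0) w (?V 0)) (?m * (1 + 3) + 1) (cfg x (?m - ?m) w (?V ?m))"
      proof (rule runs_loop[where J = "\<lambda>j. ?m - j" and W = "\<lambda>_. w" and V = ?V])
        fix j assume j: "j < ?m"
        then show "runs (input_move Move_Left) (cfg x (?m - j) w ((?V j)[d + 1 := ?m - Suc j])) 1
            (cfg x (?m - Suc j) w (?V (Suc j)))"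
          using runs_input_left[of "?m - j" x w] by simp
      qed (use d in auto)
      moreover have "?V ?m = vs[d := ?m]"
        using d zs by (auto simp: nth_list_update intro!: nth_equalityI)
      ultimately show ?thesis by (auto elim!: runs_mono)
    qed
    ultimately show ?thesis by (rule runs_Seq)
  qed
  moreover have "polyfun ?T" by (intro polyfun_intros)
  ultimately have "computes (\<lambda>x vs. length x) \<rho> d ?p (d + 2) ?T"
    by (auto simp: computes_def)
  then show "\<exists>p k T. computes (\<lambda>x vs. length x) \<rho> d p k T" by blast
qed simp

section \<open>Words produced by counter programs\<close>

text \<open>In contrast to \<open>computes\<close>, counter \<open>d\<close> is scratch space too,
  and all counters are restored.\<close>

definition emits ::
    "(bool list \<Rightarrow> nat list \<Rightarrow> bool list) \<Rightarrow> nat list \<Rightarrow> nat \<Rightarrow> prog \<Rightarrow> nat \<Rightarrow> (nat \<Rightarrow> nat) \<Rightarrow> bool" where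
  "emits G \<rho> d p k T \<longleftrightarrow> polyfun T \<and> prog_ok (k + 2) p \<and> d < k \<and>
     (\<forall>x w vs. k \<le> length vs \<longrightarrow> zero_from d vs \<longrightarrow>
        runs p (cfg x 0 w vs) (T (length x + sum_list vs)) (cfg x 0 (w @ G x (map ((!) vs) \<rho>)) vs))"

definition emittable :: "nat \<Rightarrow> (bool list \<Rightarrow> nat list \<Rightarrow> bool list) \<Rightarrow> bool" where
  "emittable n G \<longleftrightarrow>
     (\<exists>V. polyfun V \<and> (\<forall>x vs. length vs = n \<longrightarrow> length (G x vs) \<le> V (length x + sum_list vs))) \<and>
     (\<forall>\<rho> d. length \<rho> = n \<longrightarrow> (\<forall>i\<in>set \<rho>. i < d) \<longrightarrow> (\<exists>p k T. emits G \<rho> d p k T))"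

lemma emittableI:
  assumes "polyfun V" "\<And>x vs. length vs = n \<Longrightarrow> length (G x vs) \<le> V (length x + sum_list vs)"
    and "\<And>\<rho> d. length \<rho> = n \<Longrightarrow> (\<And>i. i \<in> set \<rho> \<Longrightarrow> i < d) \<Longrightarrow> \<exists>p k T. emits G \<rho> d p k T"
  shows "emittable n G"
  unfolding emittable_def using assms by blast

lemma emittable_boundE:
  assumes "emittable n G"
  obtains V where "polyfun V"
    "\<And>x vs. length vs = n \<Longrightarrow> length (G x vs) \<le> V (length x + sum_list vs)"
  using assms unfolding emittable_def by blast

lemma emittable_progE:
  assumes "emittable n G" "length \<rho> = n" "\<And>i. i \<in> set \<rho> \<Longrightarrow> i < d"
  obtains p k T where "polyfun T" "prog_ok (k + 2) p" "d < k"
    "\<And>x w vs. k \<le> length vs \<Longrightarrow> zero_from d vs \<Longrightarrow>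
       runs p (cfg x 0 w vs) (T (length x + sum_list vs)) (cfg x 0 (w @ G x (map ((!) vs) \<rho>)) vs)"
proof -
  obtain p k T where "emits G \<rho> d p k T" using assms unfolding emittable_def by blast
  then show ?thesis using that[of T k p] unfolding emits_def by blast
qed

lemma emittable_cong:
  assumes "emittable n F" "\<And>x vs. length vs = n \<Longrightarrow> F x vs = G x vs"
  shows "emittable n G"
proof -
  have "emits F \<rho> d p k T \<longleftrightarrow> emits G \<rho> d p k T" if "length \<rho> = n" for \<rho> d p k T
    using assms(2)[of "map _ \<rho>"] that by (simp add: emits_def)
  moreover obtain V where "polyfun V"
    "\<And>x vs. length vs = n \<Longrightarrow> length (F x vs) \<le> V (length x + sum_list vs)"
    using emittable_boundE[OF assms(1)] by blast
  ultimately show ?thesis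
    using assms by (intro emittableI[of V]) (auto simp: emittable_def)
qed

lemma emittable_rename:
  assumes F: "emittable n F" and \<sigma>: "length \<sigma> = n" "\<forall>i\<in>set \<sigma>. i < m"
  shows "emittable m (\<lambda>x vs. F x (map ((!) vs) \<sigma>))"
proof -
  obtain V where V: "polyfun V" "\<And>x vs. length vs = n \<Longrightarrow>
      length (F x vs) \<le> V (length x + sum_list vs)"
    using emittable_boundE[OF F] by blast
  show ?thesis
  proof (rule emittableI)
    show "polyfun (\<lambda>s. V (Suc n * s))"
      by (intro polyfun_comp[OF V(1)] polyfun_intros)
    fix x and vs :: "nat list" assume vs: "length vs = m"
    have "length (F x (map ((!) vs) \<sigma>)) \<le> V (length x + sum_list (map ((!) vs) \<sigma>))"
      by (rule V(2)) (simp add: \<sigma>)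
    also have "\<dots> \<le> V (Suc n * (length x + sum_list vs))"
      using sum_list_map_nth_le[of \<sigma> vs] \<sigma> vs
      by (intro polyfun_mono[OF V(1)]) (simp add: algebra_simps)
    finally show "length (F x (map ((!) vs) \<sigma>)) \<le> V (Suc n * (length x + sum_list vs))" .
  next
    fix \<rho> :: "nat list" and d assume \<rho>: "length \<rho> = m" "\<And>i. i \<in> set \<rho> \<Longrightarrow> i < d"
    let ?\<tau> = "map ((!) \<rho>) \<sigma>"
    have "map ((!) vs) ?\<tau> = map ((!) (map ((!) vs) \<rho>)) \<sigma>" for vs :: "nat list"
      using \<rho> \<sigma> by auto
    moreover obtain p k T where "emits F ?\<tau> d p k T"
      using F \<rho> \<sigma> unfolding emittable_def
      by (metis (no_types, lifting) image_iff length_map list.set_map nth_mem)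
    ultimately show "\<exists>p k T. emits (\<lambda>x vs. F x (map ((!) vs) \<sigma>)) \<rho> d p k T"
      unfolding emits_def by metis
  qed
qed

lemma emittable_bit:
  assumes F: "cf n F"
  shows "emittable n (\<lambda>x vs. [F x vs \<noteq> 0])"
proof (rule emittableI)
  show "polyfun (\<lambda>s. 1)" by (rule polyfun_const)
  fix \<rho> :: "nat list" and d assume \<rho>: "length \<rho> = n" "\<And>i. i \<in> set \<rho> \<Longrightarrow> i < d"
  obtain p k T V where p: "polyfun T" "polyfun V" "prog_ok (k + 2) p" "d < k"
    "\<And>x w vs. k \<le> length vs \<Longrightarrow> zero_from d vs \<Longrightarrow>
      runs p (cfg x 0 w vs) (T (length x + sum_list vs)) (cfg x 0 w (vs[d := F x (map ((!) vs)
          \<rho>)]))"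
    "\<And>x vs. d \<le> length vs \<Longrightarrow> F x (map ((!) vs) \<rho>) \<le> V (length x + sum_list vs)"
    using cf_prog_boundE[OF F \<rho>] by metis
  let ?p = "Seq p (Seq (if_zero d (emit False) (emit True)) (clear d))"
  let ?T = "\<lambda>s. T s + ((1 + 2) + (4 * V s + 1))"
  have "runs ?p (cfg x 0 w vs) (?T (length x + sum_list vs))
      (cfg x 0 (w @ [F x (map ((!) vs) \<rho>) \<noteq> 0]) vs)"
    if len: "k \<le> length vs" and z: "zero_from d vs" for x w vs
  proof -
    let ?a = "F x (map ((!) vs) \<rho>)"
    have d: "d < length vs" and zs: "vs ! d = 0" using p(4) len zero_fromD[OF z, of d] by auto
    have "runs (if_zero d (emit False) (emit True)) (cfg x 0 w (vs[d := ?a])) (1 + 2)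
        (cfg x 0 (w @ [?a \<noteq> 0]) (vs[d := ?a]))"
    proof (rule runs_if_zero)
      assume "vs[d := ?a] ! d = 0"
      then show "runs (emit False) (cfg x 0 w (vs[d := ?a])) 1 (cfg x 0 (w @ [?a \<noteq> 0])
          (vs[d := ?a]))"
        using runs_emit[of False x 0 w "vs[d := ?a]"] d by simp
    next
      assume "vs[d := ?a] ! d \<noteq> 0"
      then show "runs (emit True) (cfg x 0 w (vs[d := ?a])) 1 (cfg x 0 (w @ [?a \<noteq> 0])
          (vs[d := ?a]))"
        using runs_emit[of True x 0 w "vs[d := ?a]"] d by simp
    qed (use d in simp)
    moreover have "runs (clear d) (cfg x 0 (w @ [?a \<noteq> 0]) (vs[d := ?a]))
        (4 * V (length x + sum_list vs) + 1) (cfg x 0 (w @ [?a \<noteq> 0]) vs)"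
      using d zs p(6) by (intro runs_clear_eq) (auto simp: nth_list_update intro!: nth_equalityI)
    ultimately show ?thesis using p(5)[OF len z] runs_Seq by blast
  qed
  moreover have "polyfun ?T" by (intro polyfun_intros p(1,2))
  ultimately have "emits (\<lambda>x vs. [F x vs \<noteq> 0]) \<rho> d ?p k ?T"
    using p(3,4) by (auto simp: emits_def)
  then show "\<exists>p k T. emits (\<lambda>x vs. [F x vs \<noteq> 0]) \<rho> d p k T" by blast
qed simp

lemma emittable_Nil: "emittable n (\<lambda>x vs. [])"
proof (rule emittableI)
  show "polyfun (\<lambda>s. 0)" by (rule polyfun_const)
  fix \<rho> :: "nat list" and d :: nat
  have "emits (\<lambda>x vs. []) \<rho> d skip (d + 1) (\<lambda>s. 1)"
    using runs_skip by (auto simp: emits_def polyfun_const)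
  then show "\<exists>p k T. emits (\<lambda>x vs. []) \<rho> d p k T" by blast
qed simp

lemma emittable_append:
  assumes F: "emittable n F" and G: "emittable n G"
  shows "emittable n (\<lambda>x vs. F x vs @ G x vs)"
proof -
  obtain V where V: "polyfun V" "\<And>x vs. length vs = n \<Longrightarrow>
      length (F x vs) \<le> V (length x + sum_list vs)"
    using emittable_boundE[OF F] by blast
  obtain W where W: "polyfun W" "\<And>x vs. length vs = n \<Longrightarrow>
      length (G x vs) \<le> W (length x + sum_list vs)"
    using emittable_boundE[OF G] by blast
  show ?thesis
  proof (rule emittableI)
    show "polyfun (\<lambda>s. V s + W s)" by (intro polyfun_intros V W)
    show "length (F x vs @ G x vs) \<le> V (length x + sum_list vs) + W (length x + sum_list vs)"
      if "length vs = n" for x vs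
      using V(2)[OF that, of x] W(2)[OF that, of x] by simp
    fix \<rho> :: "nat list" and d assume \<rho>: "length \<rho> = n" "\<And>i. i \<in> set \<rho> \<Longrightarrow> i < d"
    obtain p k T where p: "polyfun T" "prog_ok (k + 2) p" "d < k"
      "\<And>x w vs. k \<le> length vs \<Longrightarrow> zero_from d vs \<Longrightarrow>
        runs p (cfg x 0 w vs) (T (length x + sum_list vs)) (cfg x 0 (w @ F x (map ((!) vs) \<rho>)) vs)"
      using emittable_progE[OF F \<rho>] by metis
    obtain q l U where q: "polyfun U" "prog_ok (l + 2) q" "d < l"
      "\<And>x w vs. l \<le> length vs \<Longrightarrow> zero_from d vs \<Longrightarrow>
        runs q (cfg x 0 w vs) (U (length x + sum_list vs)) (cfg x 0 (w @ G x (map ((!) vs) \<rho>)) vs)"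
      using emittable_progE[OF G \<rho>] by metis
    have "runs (Seq p q) (cfg x 0 w vs) (T (length x + sum_list vs) + U (length x + sum_list vs))
        (cfg x 0 (w @ F x (map ((!) vs) \<rho>) @ G x (map ((!) vs) \<rho>)) vs)"
      if "max k l \<le> length vs" and z: "zero_from d vs" for x w vs
      using runs_Seq[OF p(4) q(4)] that by force
    then have "emits (\<lambda>x vs. F x vs @ G x vs) \<rho> d (Seq p q) (max k l) (\<lambda>s. T s + U s)"
      using p(1-3) q(1-3) prog_ok_max polyfun_add by (auto simp: emits_def)
    then show "\<exists>p k T. emits (\<lambda>x vs. F x vs @ G x vs) \<rho> d p k T" by blast
  qed
qed

lemma emittable_concat:
  assumes F: "cf n F" and G: "emittable (Suc n) G"
  shows "emittable n (\<lambda>x vs. concat (map (\<lambda>k. G x (k # vs)) [0..<F x vs]))"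
proof -
  obtain V where V: "polyfun V" "\<And>x vs. length vs = n \<Longrightarrow> F x vs \<le> V (length x + sum_list vs)"
    using cf_boundE[OF F] by blast
  obtain W where W: "polyfun W" "\<And>x vs. length vs = Suc n \<Longrightarrow>
      length (G x vs) \<le> W (length x + sum_list vs)"
    using emittable_boundE[OF G] by blast
  show ?thesis
  proof (rule emittableI)
    show "polyfun (\<lambda>s. V s * W (V s + s))" by (intro polyfun_intros polyfun_comp[OF W(1)] V)
    show "length (concat (map (\<lambda>k. G x (k # vs)) [0..<F x vs]))
        \<le> V (length x + sum_list vs) * W (V (length x + sum_list vs) + (length x + sum_list vs))"
      if len: "length vs = n" for x vs
    proof -
      let ?s = "length x + sum_list vs"
      have "length (G x (k # vs)) \<le> W (V ?s + ?s)" if "k < F x vs" for k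
        by (rule order.trans[OF W(2)]) (use len that V(2)[OF len, of x] in \<open>auto intro!:
            polyfun_mono[OF W(1)]\<close>)
      note G_le = this
      have "length (concat (map (\<lambda>k. G x (k # vs)) [0..<f])) \<le> f * W (V ?s + ?s)" if "f \<le> F x vs"
          for f
        using that
      proof (induction f)
        case (Suc f)
        then show ?case using G_le[of f] by simp
      qed simp
      from this[of "F x vs"] have "length (concat (map (\<lambda>k. G x (k # vs)) [0..<F x vs]))
          \<le> F x vs * W (V ?s + ?s)"
        by simp
      also have "\<dots> \<le> V ?s * W (V ?s + ?s)" using V(2)[OF len] by (simp add: mult_right_mono)
      finally show ?thesis .
    qed
    fix \<rho> :: "nat list" and d assume \<rho>: "length \<rho> = n" "\<And>i. i \<in> set \<rho> \<Longrightarrow> i < d"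
    have \<rho>2: "\<And>i. i \<in> set ((d + 1) # \<rho>) \<Longrightarrow> i < d + 2"
      and len2: "length ((d + 1) # \<rho>) = Suc n"
      using \<rho> by (auto simp: less_SucI dest!: \<rho>(2))
    obtain p k T V' where p: "polyfun T" "polyfun V'" "prog_ok (k + 2) p" "d < k"
      "\<And>x w vs. k \<le> length vs \<Longrightarrow> zero_from d vs \<Longrightarrow>
        runs p (cfg x 0 w vs) (T (length x + sum_list vs)) (cfg x 0 w (vs[d := F x (map ((!) vs)
            \<rho>)]))"
      "\<And>x vs. d \<le> length vs \<Longrightarrow> F x (map ((!) vs) \<rho>) \<le> V' (length x + sum_list vs)"
      using cf_prog_boundE[OF F \<rho>] by metis
    obtain q l U where q: "polyfun U" "prog_ok (l + 2) q" "d + 2 < l"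
      "\<And>x w vs. l \<le> length vs \<Longrightarrow> zero_from (d + 2) vs \<Longrightarrow>
        runs q (cfg x 0 w vs) (U (length x + sum_list vs)) (cfg x 0 (w @ G x (map ((!) vs) ((d + 1)
            # \<rho>))) vs)"
      using emittable_progE[OF G len2 \<rho>2] by metis
    let ?t = "\<lambda>s. U (s + V' s + V' s) + 1"
    let ?T = "\<lambda>s. T s + ((V' s * (?t s + 3) + 1) + (4 * V' s + 1))"
    let ?body = "Seq q (inc (d + 1))"
    let ?p = "Seq p (Seq (loop d ?body) (clear (d + 1)))"
    have "runs ?p (cfg x 0 w vs) (?T (length x + sum_list vs))
        (cfg x 0 (w @ concat (map (\<lambda>k. G x (k # map ((!) vs) \<rho>)) [0..<F x (map ((!) vs) \<rho>)])) vs)"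
      if len: "max k l \<le> length vs" and z: "zero_from d vs" for x w vs
    proof -
      define f where "f = F x (map ((!) vs) \<rho>)"
      define g where "g = (\<lambda>k. G x (k # map ((!) vs) \<rho>))"
      define s where "s = length x + sum_list vs"
      have f: "f \<le> V' s" using p(4,6) len unfolding f_def s_def by auto
      have d: "d + 2 < length vs" using q(3) len by auto
      have zs: "vs ! d = 0" "vs ! (d + 1) = 0" using d zero_fromD[OF z] by auto
      let ?V = "\<lambda>j. vs[d := f - j, d + 1 := j]"
      let ?W = "\<lambda>j. w @ concat (map g [0..<j])"
      have "runs p (cfg x 0 w vs) (T s) (cfg x 0 (?W 0) (?V 0))"
      proof -
        have "?V 0 = vs[d := f]" using zs d by (auto simp: nth_list_update intro!: nth_equalityI)
        then show ?thesis using p(5)[of vs x w] len z by (simp add: f_def s_def)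
      qed
      moreover have "runs (loop d ?body) (cfg x 0 (?W 0) (?V 0)) (f * (?t s + 3)
          + 1) (cfg x 0 (?W f) (?V f))"
      proof (rule runs_loop[where J = "\<lambda>_. 0" and W = ?W and V = ?V])
        fix j assume j: "j < f"
        let ?v = "(?V j)[d := f - Suc j]"
        have args: "map ((!) ?v) ((d + 1) # \<rho>) = j # map ((!) vs) \<rho>"
          using \<rho> d by (auto simp: nth_list_update dest: \<rho>(2))
        have gj: "G x (map ((!) ?v) ((d + 1) # \<rho>)) = g j"
          unfolding args by (simp add: g_def)
        have "sum_list ?v \<le> sum_list vs + j + (f - Suc j)"
        proof -
          have eq: "?v = vs[d + 1 := j, d := f - Suc j]"
            using d by (auto simp: nth_list_update intro!: nth_equalityI)
          show ?thesis unfolding eq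
            using sum_list_update_le[of "vs[d + 1 := j]" d "f - Suc j"]
              sum_list_update_le[of vs "d + 1" j] by linarith
        qed
        then have sz: "length x + sum_list ?v \<le> s + V' s + V' s"
          using f j unfolding s_def by linarith
        have "zero_from (d + 2) ?v" using z by (auto simp: zero_from_def)
        then have "runs q (cfg x 0 (?W j) ?v) (U (length x + sum_list ?v))
            (cfg x 0 (?W j @ G x (map ((!) ?v) ((d + 1) # \<rho>))) ?v)"
          by (intro q(4)) (use len in auto)
        then have "runs q (cfg x 0 (?W j) ?v) (U (length x
            + sum_list ?v)) (cfg x 0 (?W (Suc j)) ?v)"
          by (simp only: gj) simp
        then have "runs q (cfg x 0 (?W j) ?v) (U (s + V' s + V' s)) (cfg x 0 (?W (Suc j)) ?v)"
          by (rule runs_mono) (rule polyfun_mono[OF q(1) sz])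
        moreover have "runs (inc (d + 1)) (cfg x 0 (?W (Suc j)) ?v) 1
            (cfg x 0 (?W (Suc j)) (?V (Suc j)))"
          using d by (intro runs_inc_eq) (auto simp: nth_list_update intro!: nth_equalityI)
        ultimately show "runs ?body (cfg x 0 (?W j) ?v) (?t s) (cfg x 0 (?W (Suc j)) (?V (Suc j)))"
          by (rule runs_Seq)
      qed (use d in auto)
      then have "runs (loop d ?body) (cfg x 0 (?W 0) (?V 0)) (V' s * (?t s + 3)
          + 1) (cfg x 0 (?W f) (?V f))"
        by (rule runs_mono) (use f in \<open>intro add_right_mono mult_right_mono, auto\<close>)
      moreover have "runs (clear (d + 1)) (cfg x 0 (?W f) (?V f)) (4 * V' s
          + 1) (cfg x 0 (?W f) vs)"
        using d f zs by (intro runs_clear_eq) (auto simp: nth_list_update intro!: nth_equalityI)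
      ultimately show ?thesis using runs_Seq unfolding f_def g_def s_def by blast
    qed
    moreover have "polyfun ?T"
      by (intro polyfun_intros polyfun_comp[OF q(1)] p(1,2))
    ultimately have "emits (\<lambda>x vs. concat (map (\<lambda>k. G x (k # vs)) [0..<F x vs])) \<rho> d ?p (max k l)
        ?T"
      using p(3,4) q(2,3) prog_ok_max by (auto simp: emits_def)
    then show "\<exists>p k T. emits (\<lambda>x vs. concat (map (\<lambda>k. G x (k # vs)) [0..<F x vs])) \<rho> d p k T"
        by blast
  qed
qed

subsection \<open>The complete machine\<close>

fun mark_counters :: "nat \<Rightarrow> prog" where
  "mark_counters 0 = skip"
| "mark_counters (Suc k) = Seq (mark_counters k) (Act (k + 2) (\<lambda>s. (1, Stay)))"

text \<open>Tape 0 may finally hold nothing but the output, so the input is moved to tape 1 and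
  erased on the way; counter 0 records its length for the return of the head of tape 1.\<close>

definition copy_input :: prog where
  "copy_input = While 0 (\<lambda>s. s \<noteq> 0)
     (Seq (Cond 0 (\<lambda>s. s = 1) (Act 1 (\<lambda>s. (1, Move_Right))) (Act 1 (\<lambda>s. (2, Move_Right))))
       (Seq (Act 0 (\<lambda>s. (0, Move_Right))) (inc 0)))"

text \<open>The cell left of the output is blank, because the input there has been erased; it stops
  the search, and one move to the right follows.\<close>

definition rewind_output :: prog where
  "rewind_output = Seq (Act 0 (\<lambda>s. (s, Move_Left)))
     (Seq (While 0 (\<lambda>s. s \<noteq> 0) (Act 0 (\<lambda>s. (s, Move_Left)))) (Act 0 (\<lambda>s. (s, Move_Right))))"

abbreviation blank_tape :: tape where
  "blank_tape \<equiv> (0, \<lambda>z. 0)"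

lemma runs_mark_counters:
  assumes "k \<le> length ts" "\<And>i. i < k \<Longrightarrow> ts ! i = blank_tape"
  shows "runs (mark_counters k) (a # b # ts) (k + 1) (a # b # replicate k (ctr 0) @ drop k ts)"
  using assms
proof (induction k)
  case 0
  then show ?case using runs_skip by simp
next
  case (Suc k)
  have "runs (Act (k + 2) (\<lambda>s. (1, Stay))) (a # b # replicate k (ctr 0) @ drop k ts) 1
      (a # b # replicate (Suc k) (ctr 0) @ drop (Suc k) ts)"
  proof (rule runs_Act)
    have 1: "(replicate k (ctr 0) @ drop k ts) ! k = blank_tape"
      using Suc.prems by (simp add: nth_append)
    have 2: "act_tape (1, Stay) blank_tape = ctr 0" by (auto simp: ctr_def)
    have "(replicate k (ctr 0) @ drop k ts)[k := ctr 0]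
        = replicate (Suc k) (ctr 0) @ drop (Suc k) ts"
      using Suc.prems Cons_nth_drop_Suc[of k ts, symmetric]
      by (simp add: list_update_append replicate_app_Cons_same)
    then show "a # b # replicate (Suc k) (ctr 0) @ drop (Suc k) ts
        = (a # b # replicate k (ctr 0) @ drop k ts)[k + 2 := act_tape (1, Stay)
            ((a # b # replicate k (ctr 0) @ drop k ts) ! (k + 2))]"
      using 1 2 by simp
  qed
  then show ?case using runs_Seq[OF Suc.IH] Suc.prems by fastforce
qed

lemma runs_copy_input:
  assumes "0 < length cs" "cs ! 0 = 0"
  shows "runs copy_input ((0, word_contents x) # blank_tape # map ctr cs)
    (length x * 8 + 1) (cfg x (length x) [] (cs[0 := length x]))"
proof -
  let ?A = "\<lambda>j :: nat. (int j, \<lambda>z. if z < int j then 0 else word_contents x z)"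
  let ?B = "\<lambda>j :: nat. (int j, \<lambda>z. if z < int j then word_contents x z else 0)"
  let ?st = "\<lambda>j. ?A j # ?B j # map ctr (cs[0 := j])"
  have "runs copy_input (?st 0) (length x * (6 + 2) + 1) (?st (length x))"
    unfolding copy_input_def
  proof (rule runs_While_iterate)
    fix j assume j: "j < length x"
    then have r: "read_tape (?st j ! 0) = bit_symbol (x ! j)" by (simp add: word_contents_def)
    then show "read_tape (?st j ! 0) \<noteq> 0" by (cases "x ! j") auto
    let ?st1 = "?A j # ?B (Suc j) # map ctr (cs[0 := j])"
    let ?st2 = "?A (Suc j) # ?B (Suc j) # map ctr (cs[0 := j])"
    have B: "act_tape (bit_symbol (x ! j), Move_Right) (?B j) = ?B (Suc j)"
      using j by (auto simp: fun_eq_iff word_contents_def)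
    have "runs (Cond 0 (\<lambda>s. s = 1) (Act 1 (\<lambda>s. (1, Move_Right))) (Act 1 (\<lambda>s. (2, Move_Right))))
        (?st j) (1 + 2) ?st1"
    proof (cases "x ! j")
      case True
      have "runs (Act 1 (\<lambda>s. (2, Move_Right))) (?st j) 1 ?st1"
        using B True by (intro runs_Act) simp
      then show ?thesis using r True by (intro runs_CondF) auto
    next
      case False
      have "runs (Act 1 (\<lambda>s. (1, Move_Right))) (?st j) 1 ?st1"
        using B False by (intro runs_Act) simp
      then show ?thesis using r False by (intro runs_CondT) auto
    qed
    moreover have "runs (Act 0 (\<lambda>s. (0, Move_Right))) ?st1 1 ?st2"
      by (rule runs_Act) (auto simp: fun_eq_iff)
    moreover have "runs (inc 0) ?st2 1 (?st (Suc j))"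
      unfolding inc_def using assms
      by (intro runs_Act) (cases cs, auto simp: act_ctr)
    ultimately have "runs (Seq (Cond 0 (\<lambda>s. s
        = 1) (Act 1 (\<lambda>s. (1, Move_Right))) (Act 1 (\<lambda>s. (2, Move_Right))))
       (Seq (Act 0 (\<lambda>s. (0, Move_Right))) (inc 0))) (?st j) ((1 + 2) + (1 + 1)) (?st (Suc j))"
      using runs_Seq by blast
    then show "runs (Seq (Cond 0 (\<lambda>s. s
        = 1) (Act 1 (\<lambda>s. (1, Move_Right))) (Act 1 (\<lambda>s. (2, Move_Right))))
       (Seq (Act 0 (\<lambda>s. (0, Move_Right))) (inc 0))) (?st j) 6 (?st (Suc j))"
      by (rule runs_mono) simp
  next
    show "\<not> read_tape (?st (length x) ! 0) \<noteq> 0" by (simp add: word_contents_def)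
  qed
  moreover have "?st 0 = (0, word_contents x) # blank_tape # map ctr cs"
  proof -
    have "cs[0 := 0] = cs" using assms(2) by (metis list_update_id)
    moreover have "(\<lambda>z. if z < 0 then 0 else word_contents x z) = word_contents x"
      "(\<lambda>z. if z < 0 then word_contents x z else 0) = (\<lambda>z. 0)"
      by (auto simp: word_contents_def)
    ultimately show ?thesis by simp
  qed
  moreover have "?st (length x) = cfg x (length x) [] (cs[0 := length x])"
    by (auto simp: cfg_def word_contents_def fun_eq_iff)
  ultimately show ?thesis by simp
qed

lemma act_tape_move: "act_tape (read_tape t, m) t = (move_head m (fst t), snd t)"
  by (cases t) auto

lemma runs_rewind_output:
  shows "\<exists>us. tape_holds (us ! 0) w \<and> runs rewind_output (cfg x j w vs) (length w * 3 + 3) us"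
proof -
  let ?c = "\<lambda>z. word_contents w (z - int (length x))"
  let ?r = "(int j, word_contents x) # map ctr vs"
  let ?st = "\<lambda>i :: nat. (int (length x) + int (length w) - 1 - int i, ?c) # ?r"
  let ?L = "Act 0 (\<lambda>s. (s, Move_Left))" and ?us = "(int (length x), ?c) # ?r"
  have "runs ?L (cfg x j w vs) 1 (?st 0)"
    by (rule runs_Act) (auto simp: cfg_def fun_eq_iff)
  moreover have "runs (While 0 (\<lambda>s. s \<noteq> 0) ?L) (?st 0) (length w * (1 + 2) + 1) (?st (length w))"
  proof (rule runs_While_iterate)
    fix i assume i: "i < length w"
    show "read_tape (?st i ! 0) \<noteq> 0"
      using i bit_symbol_pos by (auto simp: word_contents_def)
    show "runs ?L (?st i) 1 (?st (Suc i))"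
      by (rule runs_Act) (simp add: act_tape_move del: read_tape.simps act_tape.simps)
  next
    show "\<not> read_tape (?st (length w) ! 0) \<noteq> 0" by (simp add: word_contents_def)
  qed
  moreover have "runs (Act 0 (\<lambda>s. (s, Move_Right))) (?st (length w)) 1 ?us"
    by (rule runs_Act) (simp add: act_tape_move del: read_tape.simps act_tape.simps)
  ultimately have "runs rewind_output (cfg x j w vs) (1 + ((length w * (1 + 2) + 1) + 1)) ?us"
    unfolding rewind_output_def using runs_Seq by blast
  moreover have "tape_holds (?us ! 0) w" by simp
  ultimately show ?thesis by (intro exI[of _ ?us] conjI) (auto elim: runs_mono)
qed

lemma prog_ok_mark_counters: "prog_ok (k + 2) (mark_counters k)"
proof (induction k)
  case (Suc k)
  then show ?case using prog_ok_mono[OF Suc.IH] by simp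
qed simp

theorem polytime_computable_emittable:
  assumes G: "emittable 0 G"
  shows "polytime_computable (\<lambda>x. G x [])"
proof -
  obtain V where V: "polyfun V" "\<And>x vs. length vs = 0 \<Longrightarrow>
      length (G x vs) \<le> V (length x + sum_list vs)"
    using emittable_boundE[OF G] by blast
  obtain p k T where p: "polyfun T" "prog_ok (k + 2) p" "0 < k"
    "\<And>x w vs. k \<le> length vs \<Longrightarrow> zero_from 0 vs \<Longrightarrow>
       runs p (cfg x 0 w vs) (T (length x + sum_list vs)) (cfg x 0 (w @ G x (map ((!) vs) [])) vs)"
    using emittable_progE[OF G, of "[]" 0] by auto metis
  let ?back = "loop 0 (input_move Move_Left)"
  let ?p = "Seq (mark_counters k) (Seq copy_input (Seq ?back (Seq p rewind_output)))"
  \<comment> \<open>The summands belong to marking the counters, moving the input, returning its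
    head, the program proper and rewinding the output.\<close>
  let ?T = "\<lambda>m. (k + 1) + ((m * 8 + 1) + ((m * 4 + 1) + (T m + (V m * 3 + 3))))"
  have "polyfun ?T" by (intro polyfun_intros polyfun_comp[OF V(1)] polyfun_comp[OF p(1)])
  then obtain q where q: "?T = poly q" unfolding polyfun_def by blast
  show ?thesis
  proof (rule polytime_computable_exec)
    show "prog_ok (k + 2) ?p"
      using p(2,3) prog_ok_mark_counters by (auto simp: copy_input_def rewind_output_def)
    show "1 \<le> k + 2" by simp
    fix x
    let ?m = "length x" and ?w = "G x []"
    let ?vs = "replicate k (0 :: nat)"
    have start: "map (\<lambda>i. (0, word_contents (if i = 0 then x else []))) [0..<k + 2]
        = (0, word_contents x) # blank_tape # replicate k blank_tape"
      by (rule nth_equalityI) (auto simp: nth_Cons' word_contents_def fun_eq_iff simp del: upt_Suc)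
    have "runs (mark_counters k) ((0, word_contents x) # blank_tape # replicate k blank_tape) (k
        + 1)
        ((0, word_contents x) # blank_tape # map ctr (replicate k 0))"
      using runs_mark_counters[of k "replicate k blank_tape"] by simp
    moreover have "runs copy_input ((0, word_contents x) # blank_tape # map ctr (replicate k 0))
        (?m * 8 + 1)
        (cfg x ?m [] ((replicate k 0)[0 := ?m]))"
      using p(3) by (intro runs_copy_input) auto
    moreover have "runs ?back (cfg x ?m [] ((replicate k 0)[0 := ?m])) (?m * 4
        + 1) (cfg x 0 [] ?vs)"
    proof -
      let ?V = "\<lambda>j. (replicate k 0)[0 := ?m - j]"
      have "runs ?back (cfg x (?m - 0) [] (?V 0)) (?m * (1 + 3) + 1) (cfg x (?m - ?m) [] (?V ?m))"
      proof (rule runs_loop[where J = "\<lambda>j. ?m - j" and W = "\<lambda>_. []" and V = ?V])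
        fix j assume j: "j < ?m"
        then show "runs (input_move Move_Left) (cfg x (?m - j) [] ((?V j)[0 := ?m - Suc j])) 1
            (cfg x (?m - Suc j) [] (?V (Suc j)))"
          using runs_input_left[of "?m - j" x "[]"] by simp
      qed (use p(3) in auto)
      moreover have "?V ?m = ?vs" using p(3) by (auto simp: nth_list_update intro!: nth_equalityI)
      ultimately show ?thesis by (auto elim: runs_mono)
    qed
    moreover have "runs p (cfg x 0 [] ?vs) (T ?m) (cfg x 0 ?w ?vs)"
      using p(4)[of ?vs x "[]"] by (simp add: zero_from_def sum_list_replicate)
    moreover obtain us where us: "tape_holds (us ! 0) ?w"
      "runs rewind_output (cfg x 0 ?w ?vs) (length ?w * 3 + 3) us"
      using runs_rewind_output by blast
    moreover have "length ?w * 3 + 3 \<le> V ?m * 3 + 3"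
      using V(2)[of "[]" x] by simp
    then have "runs rewind_output (cfg x 0 ?w ?vs) (V ?m * 3 + 3) us"
      using us(2) runs_mono by blast
    ultimately have "runs ?p ((0, word_contents x) # blank_tape # replicate k blank_tape) (?T ?m)
        us"
      using runs_Seq by meson
    then show "\<exists>n us. n \<le> poly q ?m \<and> tape_holds (us ! 0) ?w \<and>
        exec ?p (map (\<lambda>i. (0, word_contents (if i = 0 then x else []))) [0..<k + 2]) n us"
      unfolding start q[symmetric] runs_def using us(1) by blast
  qed
qed

section \<open>Arithmetic\<close>

abbreviation cfp :: "nat \<Rightarrow> (bool list \<Rightarrow> nat list \<Rightarrow> bool) \<Rightarrow> bool" where
  "cfp n P \<equiv> cf n (\<lambda>x vs. of_bool (P x vs))"

lemma cf_eqI: "cf n F \<Longrightarrow> (\<And>x vs. length vs = n \<Longrightarrow> G x vs = F x vs) \<Longrightarrow> cf n G"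
  by (rule cf_cong) auto

lemma cf_hd: "cf (Suc n) (\<lambda>x ws. hd ws)"
  by (rule cf_eqI[OF cf_var[of 0]]) (auto simp: length_Suc_conv)

lemma cf_Sum:
  assumes "cf n F" "cf (Suc n) (\<lambda>x ws. G x (tl ws) (hd ws))"
  shows "cf n (\<lambda>x vs. \<Sum>k<F x vs. G x vs k)"
  using cf_sum[OF assms] by simp

lemma cf_mult:
  assumes "cf n F" "cf n G"
  shows "cf n (\<lambda>x vs. F x vs * G x vs)"
  using cf_sum[OF assms(1) cf_tl[OF assms(2)]] by simp

lemma cf_le:
  assumes "cf n F" "cf n G"
  shows "cfp n (\<lambda>x vs. F x vs \<le> G x vs)"
  by (rule cf_eqI[OF cf_diff[OF cf_const[of n 1] cf_diff[OF assms]]]) auto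

lemma cf_less:
  assumes "cf n F" "cf n G"
  shows "cfp n (\<lambda>x vs. F x vs < G x vs)"
  by (rule cf_eqI[OF cf_le[OF cf_Suc[OF assms(1)] assms(2)]]) auto

lemma cf_not:
  assumes "cfp n P"
  shows "cfp n (\<lambda>x vs. \<not> P x vs)"
  by (rule cf_eqI[OF cf_diff[OF cf_const[of n 1] assms]]) auto

lemma cf_conj:
  assumes "cfp n P" "cfp n Q"
  shows "cfp n (\<lambda>x vs. P x vs \<and> Q x vs)"
  by (rule cf_eqI[OF cf_mult[OF assms]]) auto

lemma cf_disj:
  assumes "cfp n P" "cfp n Q"
  shows "cfp n (\<lambda>x vs. P x vs \<or> Q x vs)"
  by (rule cf_eqI[OF cf_not[OF cf_conj[OF assms[THEN cf_not]]]]) auto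

lemma cf_imp:
  assumes "cfp n P" "cfp n Q"
  shows "cfp n (\<lambda>x vs. P x vs \<longrightarrow> Q x vs)"
  by (rule cf_eqI[OF cf_disj[OF cf_not[OF assms(1)] assms(2)]]) auto

lemma cf_eq:
  assumes "cf n F" "cf n G"
  shows "cfp n (\<lambda>x vs. F x vs = G x vs)"
  by (rule cf_eqI[OF cf_conj[OF cf_le[OF assms] cf_le[OF assms(2,1)]]]) auto

text \<open>The sum of the truth values is positive.\<close>

lemma cf_ex:
  assumes "cf n F" "cfp (Suc n) (\<lambda>x ws. P x (tl ws) (hd ws))"
  shows "cfp n (\<lambda>x vs. \<exists>k<F x vs. P x vs k)"
  by (rule cf_eqI[OF cf_less[OF cf_const[of n 0]
      cf_Sum[where G = "\<lambda>x vs k. of_bool (P x vs k)", OF assms]]])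
    (auto simp: of_bool_def intro: ccontr)

lemma cf_all:
  assumes "cf n F" "cfp (Suc n) (\<lambda>x ws. P x (tl ws) (hd ws))"
  shows "cfp n (\<lambda>x vs. \<forall>k<F x vs. P x vs k)"
  by (rule cf_eqI[OF cf_not[OF cf_ex[where P = "\<lambda>x vs k. \<not> P x vs k", OF assms(1) cf_not[OF
      assms(2)]]]]) auto

lemma cf_if:
  assumes "cfp n P" "cf n F" "cf n G"
  shows "cf n (\<lambda>x vs. if P x vs then F x vs else G x vs)"
  by (rule cf_eqI[OF cf_add[OF cf_mult[OF assms(1,2)] cf_mult[OF cf_not[OF assms(1)] assms(3)]]])
      auto

lemmas cf_intros = cf_const cf_Suc cf_add cf_diff cf_mult cf_Sum cf_le cf_less cf_not cf_conj
  cf_disj cf_imp cf_eq cf_ex cf_all cf_if cf_length cf_input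

text \<open>The quotient counts the positive multiples of the divisor up to the dividend. The guard
  yields 0 for divisor 0, in agreement with \<open>div\<close>.\<close>

lemma cf_div:
  assumes "cf n F" "cf n G"
  shows "cf n (\<lambda>x vs. F x vs div G x vs)"
proof (rule cf_eqI)
  show "cf n (\<lambda>x vs. \<Sum>k<F x vs. of_bool (0 < G x vs \<and> Suc k * G x vs \<le> F x vs))"
    by (intro cf_intros assms cf_tl[OF assms(1)] cf_tl[OF assms(2)] cf_hd)
  have "a div b = (\<Sum>k<a. of_bool (0 < b \<and> Suc k * b \<le> a))" for a b :: nat
  proof (cases "b = 0")
    case False
    have "{k. k < a \<and> Suc k * b \<le> a} = {..<a div b}"
    proof -
      have "Suc k * b \<le> a \<longleftrightarrow> k < a div b" for k
        using False less_eq_div_iff_mult_less_eq[of b "Suc k" a] by auto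
      moreover have "k < a" if "k < a div b" for k
        using that div_le_dividend[of a b] by linarith
      ultimately show ?thesis by auto
    qed
    moreover have "(\<Sum>k<a. of_bool (0 < b \<and> Suc k * b \<le> a)) = card {k. k < a \<and> Suc k * b \<le> a}"
      using False by (simp add: of_bool_def sum.If_cases Int_def)
    ultimately show ?thesis by simp
  qed simp
  then show "F x vs div G x vs = (\<Sum>k<F x vs. of_bool (0 < G x vs \<and> Suc k * G x vs \<le> F x vs))"
      for x vs .
qed

lemma cf_mod:
  assumes "cf n F" "cf n G"
  shows "cf n (\<lambda>x vs. F x vs mod G x vs)"
  by (rule cf_eqI[OF cf_diff[OF assms(1) cf_mult[OF cf_div[OF assms] assms(2)]]])
    (simp add: minus_div_mult_eq_mod)

lemma cf_dvd:
  assumes "cf n F" "cf n G"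
  shows "cfp n (\<lambda>x vs. F x vs dvd G x vs)"
  by (rule cf_eqI[OF cf_eq[OF cf_mod[OF assms(2,1)] cf_const[of n 0]]]) (simp add: dvd_eq_mod_eq_0)

lemma cf_power: "cf n F \<Longrightarrow> cf n (\<lambda>x vs. F x vs ^ c)"
  by (induction c) (auto intro: cf_const cf_mult)

lemma cf_poly: "cf n F \<Longrightarrow> cf n (\<lambda>x vs. poly q (F x vs))"
  by (induction q) (auto intro: cf_const cf_mult cf_add)

text \<open>This is how the transition function of a Turing machine enters.\<close>

lemma cf_table: "cf n F \<Longrightarrow> cf n (\<lambda>x vs. if F x vs < c then g (F x vs) else 0)"
proof (induction c)
  case (Suc c)
  show ?case
    by (rule cf_eqI[OF cf_if[OF cf_eq[OF Suc.prems cf_const[of n c]] cf_const[of n "g c"]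
        Suc.IH[OF Suc.prems]]]) auto
qed (simp add: cf_const)

lemma cf_all_const:
  "(\<And>i. i < (c :: nat) \<Longrightarrow> cfp n (P i)) \<Longrightarrow> cfp n (\<lambda>x vs. \<forall>i<c. P i x vs)"
proof (induction c)
  case (Suc c)
  show ?case
    by (rule cf_eqI[OF cf_conj[OF Suc.prems[of c] Suc.IH[OF Suc.prems]]])
      (auto simp: less_Suc_eq)
qed (simp add: cf_const)

text \<open>Exhaustive search as a sum: exactly one candidate passes the test, and it contributes
  itself. If both arguments are 0, the only candidate is 0.\<close>

lemma cf_gcd:
  assumes F: "cf n F" and G: "cf n G"
  shows "cf n (\<lambda>x vs. gcd (F x vs) (G x vs))"
proof (rule cf_eqI)
  let ?c = "\<lambda>a b g. g dvd a \<and> g dvd b \<and> (\<forall>h<Suc (a + b). h dvd a \<and> h dvd b \<longrightarrow> h \<le> g)"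
  show "cf n (\<lambda>x vs. \<Sum>g<Suc (F x vs + G x vs). if ?c (F x vs) (G x vs) g then g else 0)"
    by (intro cf_intros cf_dvd F G cf_tl[OF F] cf_tl[OF G] cf_tl[OF cf_tl[OF F]] cf_tl[OF cf_tl[OF
        G]]
        cf_hd cf_tl[OF cf_hd])
  have "gcd a b = (\<Sum>g<Suc (a + b). if ?c a b g then g else 0)" for a b :: nat
  proof -
    have le: "gcd a b \<le> a + b"
      by (cases "a = 0") (auto intro: order.trans[OF gcd_le1_nat])
    have "?c a b g \<longleftrightarrow> g = gcd a b" if "g < Suc (a + b)" for g
    proof
      assume c: "?c a b g"
      then have "gcd a b \<le> g" using le by auto
      moreover have "g \<le> gcd a b"
      proof (cases "a = 0 \<and> b = 0")
        case True
        then show ?thesis using that by simp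
      next
        case False
        then show ?thesis using c by (intro dvd_imp_le) auto
      qed
      ultimately show "g = gcd a b" by simp
    next
      assume g: "g = gcd a b"
      have "h \<le> gcd a b" if "h < Suc (a + b)" "h dvd a" "h dvd b" for h
        using that by (cases "a = 0 \<and> b = 0") (auto intro: dvd_imp_le)
      then show "?c a b g" using g by auto
    qed
    then have "(\<Sum>g<Suc (a + b). if ?c a b g then g else 0) = (\<Sum>g<Suc (a + b). if g
        = gcd a b then g else 0)"
      by (intro sum.cong) auto
    also have "\<dots> = gcd a b" using le by (subst sum.delta) auto
    finally show ?thesis by simp
  qed
  then show "gcd (F x vs) (G x vs)
      = (\<Sum>g<Suc (F x vs + G x vs). if ?c (F x vs) (G x vs) g then g else 0)" for x vs .
qed

section \<open>Producing encodings\<close>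

lemma emittable_eqI: "emittable n F \<Longrightarrow> (\<And>x vs. length vs = n \<Longrightarrow> G x vs = F x vs) \<Longrightarrow> emittable n G"
  by (rule emittable_cong) auto

lemma emittable_tl:
  assumes "emittable n F"
  shows "emittable (Suc n) (\<lambda>x vs. F x (tl vs))"
proof (rule emittable_cong[OF emittable_rename[OF assms, of "[1..<Suc n]" "Suc n"]])
  show "F x (map ((!) vs) [1..<Suc n]) = F x (tl vs)" if "length vs = Suc n" for x vs
  proof -
    have "map ((!) vs) [1..<Suc n] = tl vs"
      using that by (intro nth_equalityI) (auto simp: nth_tl simp del: upt_Suc)
    then show ?thesis by simp
  qed
qed auto

lemma emittable_concat_map:
  assumes "cf n F" "emittable (Suc n) (\<lambda>x ws. G x (tl ws) (hd ws))"
  shows "emittable n (\<lambda>x vs. concat (map (\<lambda>k. G x vs k) [0..<F x vs]))"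
  using emittable_concat[OF assms] by simp

lemma emittable_bool: "cfp n P \<Longrightarrow> emittable n (\<lambda>x vs. [P x vs])"
  by (rule emittable_eqI[OF emittable_bit]) auto

lemma emittable_when:
  assumes P: "cfp n P" and G: "emittable n G"
  shows "emittable n (\<lambda>x vs. if P x vs then G x vs else [])"
  by (rule emittable_eqI[OF emittable_concat_map[where G = "\<lambda>x vs k. G x vs", OF P emittable_tl[OF
      G]]]) auto

lemma emittable_Cons: "cfp n P \<Longrightarrow> emittable n G \<Longrightarrow> emittable n (\<lambda>x vs. P x vs # G x vs)"
  using emittable_append[OF emittable_bool] by simp

section \<open>Binary digits by bounded search\<close>

definition power_of_2 :: "nat \<Rightarrow> bool" where
  "power_of_2 k \<longleftrightarrow> (\<exists>i. k = 2 ^ i)"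

lemma power_of_2_if:
  "0 < k \<Longrightarrow> (\<And>d. d dvd k \<Longrightarrow> d = 1 \<or> 2 dvd d) \<Longrightarrow> power_of_2 k"
proof (induction k rule: less_induct)
  case (less k)
  show ?case
  proof (cases "k = 1")
    case True
    then show ?thesis unfolding power_of_2_def by (intro exI[of _ 0]) simp
  next
    case False
    with less.prems(2)[of k] have "2 dvd k" by simp
    then obtain l where l: "k = 2 * l" by blast
    have "power_of_2 l"
    proof (rule less.IH)
      show "l < k" "0 < l" using l less.prems(1) by simp_all
      show "d = 1 \<or> 2 dvd d" if "d dvd l" for d
        by (rule less.prems(2)) (use that l in simp)
    qed
    then obtain i where "l = 2 ^ i" unfolding power_of_2_def by blast
    then have "k = 2 ^ Suc i" using l by simp
    then show ?thesis unfolding power_of_2_def by blast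
  qed
qed

text \<open>Powers with a variable exponent are not among the counter functions, whereas
  divisibility under a bounded quantifier is.\<close>

lemma power_of_2_iff: "power_of_2 k \<longleftrightarrow> 0 < k \<and> (\<forall>d<Suc k. d dvd k \<longrightarrow> d = 1 \<or> 2 dvd d)"
proof
  assume "power_of_2 k"
  then obtain i where i: "k = 2 ^ i" unfolding power_of_2_def by blast
  have "d = 1 \<or> 2 dvd d" if d: "d dvd k" for d
  proof -
    obtain j where "d = 2 ^ j"
      using iffD1[OF divides_primepow_nat[OF two_is_prime_nat] d[unfolded i]] by blast
    then show ?thesis by (cases j) simp_all
  qed
  moreover have "0 < k" using i by simp
  ultimately show "0 < k \<and> (\<forall>d<Suc k. d dvd k \<longrightarrow> d = 1 \<or> 2 dvd d)" by blast
next
  assume k: "0 < k \<and> (\<forall>d<Suc k. d dvd k \<longrightarrow> d = 1 \<or> 2 dvd d)"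
  show "power_of_2 k"
  proof (rule power_of_2_if)
    show "0 < k" using k by (rule conjunct1)
    fix d assume d: "d dvd k"
    have "d \<le> k" by (rule dvd_imp_le[OF d \<open>0 < k\<close>])
    then show "d = 1 \<or> 2 dvd d" using conjunct2[OF k] d by (simp add: less_Suc_eq_le)
  qed
qed

lemma nat_bits_map:
  "n < 2 ^ L \<Longrightarrow> (L = 0 \<or> 2 ^ (L - 1) \<le> n) \<Longrightarrow> nat_bits n = map (\<lambda>i. odd (n div 2 ^ i)) [0..<L]"
proof (induction L arbitrary: n)
  case 0
  then show ?case by (simp add: nat_bits.simps)
next
  case (Suc L)
  have n: "2 ^ L \<le> n" using Suc.prems by simp
  then have "n \<noteq> 0" by (metis not_le zero_less_numeral zero_less_power)
  moreover have "nat_bits (n div 2) = map (\<lambda>i. odd (n div 2 div 2 ^ i)) [0..<L]"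
  proof (rule Suc.IH)
    show "n div 2 < 2 ^ L" using Suc.prems by simp
    show "L = 0 \<or> 2 ^ (L - 1) \<le> n div 2" using n by (cases L) auto
  qed
  moreover have "[0..<Suc L] = 0 # map Suc [0..<L]"
      by (simp add: map_Suc_upt upt_conv_Cons del: upt_Suc)
  ultimately show ?case
    by (subst nat_bits.simps) (simp add: div_mult2_eq del: upt_Suc)
qed

lemma concat_map_if: "concat (map (\<lambda>k. if P k then f k else []) xs) = concat (map f (filter P xs))"
  by (induction xs) auto

text \<open>The hypotheses say that \<open>L\<close> is the binary length of \<open>n\<close>. Both
  lists are sorted and distinct, so it suffices to compare their sets.\<close>

lemma filter_power_of_2:
  assumes "n < 2 ^ L" "L = 0 \<or> 2 ^ (L - 1) \<le> n"
  shows "map Suc (filter (\<lambda>k. power_of_2 (Suc k)) [0..<n]) = map (\<lambda>i. 2 ^ i) [0..<L]"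
proof (rule sorted_distinct_set_unique)
  show "sorted (map Suc (filter (\<lambda>k. power_of_2 (Suc k)) [0..<n]))"
    by (simp add: sorted_map sorted_wrt_filter)
  show "sorted (map ((^) (2 :: nat)) [0..<L])"
    by (auto simp: sorted_iff_nth_mono intro: power_increasing)
  show "distinct (map Suc (filter (\<lambda>k. power_of_2 (Suc k)) [0..<n]))"
    by (simp add: distinct_map)
  show "distinct (map ((^) (2 :: nat)) [0..<L])"
    by (auto simp: distinct_map inj_on_def)
  have "(2 :: nat) ^ i \<le> n \<longleftrightarrow> i < L" for i
  proof
    assume "2 ^ i \<le> n"
    then have "(2 :: nat) ^ i < 2 ^ L" using assms(1) by (rule le_less_trans)
    then show "i < L" by simp
  next
    assume i: "i < L"
    then have "(2 :: nat) ^ i \<le> 2 ^ (L - 1)" by (intro power_increasing) auto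
    moreover have "2 ^ (L - 1) \<le> n" using assms(2) i by auto
    ultimately show "2 ^ i \<le> n" by (rule order.trans)
  qed
  note iff = this
  have "{k. 0 < k \<and> k \<le> n \<and> power_of_2 k} = (^) 2 ` {..<L}"
  proof (rule equalityI; rule subsetI)
    fix k assume "k \<in> {k. 0 < k \<and> k \<le> n \<and> power_of_2 k}"
    then obtain i where "k = 2 ^ i" "k \<le> n" unfolding power_of_2_def by blast
    then show "k \<in> (^) 2 ` {..<L}" using iff[of i] by blast
  next
    fix k :: nat assume "k \<in> (^) 2 ` {..<L}"
    then obtain i where i: "i < L" "k = 2 ^ i" by blast
    have "0 < k" unfolding i(2) by simp
    moreover have "k \<le> n" using iff[of i] i by blast
    ultimately show "k \<in> {k. 0 < k \<and> k \<le> n \<and> power_of_2 k}"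
      using i(2) unfolding power_of_2_def by blast
  qed
  moreover have "Suc ` {k. k < n \<and> power_of_2 (Suc k)} = {k. 0 < k \<and> k \<le> n \<and> power_of_2 k}"
    by (auto simp: image_iff gr0_conv_Suc)
  ultimately show "set (map Suc (filter (\<lambda>k. power_of_2 (Suc k)) [0..<n]))
      = set (map ((^) 2) [0..<L])"
    by (simp add: atLeast0LessThan)
qed

text \<open>Running through all \<open>k < n\<close> is affordable because numbers are unary. The
  powers of two are met in increasing order, so the digits appear with the least significant one
  first.\<close>

lemma encode_nat_eq:
  "encode_nat n =
     concat (map (\<lambda>k. if power_of_2 (Suc k) then [True, \<not> 2 dvd n div Suc k] else []) [0..<n]) @
         [False]"
proof -
  obtain L where L: "n < 2 ^ L" "L = 0 \<or> 2 ^ (L - 1) \<le> n"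
  proof (cases "n = 0")
    case True
    then show ?thesis using that[of 0] by simp
  next
    case False
    then obtain l where "2 ^ l \<le> n" "n < 2 ^ (l + 1)"
      using ex_power_ivl1[of 2 n] by auto
    then show ?thesis using that[of "l + 1"] by simp
  qed
  have d: "delimit w = concat (map (\<lambda>b. [True, b]) w) @ [False]" for w
    by (induction w rule: delimit.induct) auto
  have "concat (map (\<lambda>k. if power_of_2 (Suc k) then [True, \<not> 2 dvd n div Suc k] else []) [0..<n])
      = concat (map (\<lambda>k. [True, odd (n div k)]) (map Suc (filter (\<lambda>k. power_of_2 (Suc k))
          [0..<n])))"
    unfolding concat_map_if by (simp add: comp_def)
  also have "\<dots> = concat (map (\<lambda>b. [True, b]) (nat_bits n))"
    unfolding filter_power_of_2[OF L] nat_bits_map[OF L] by (simp add: comp_def)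
  finally show ?thesis by (simp add: encode_nat_def d)
qed

lemma emittable_encode_nat:
  assumes F: "cf n F"
  shows "emittable n (\<lambda>x vs. encode_nat (F x vs))"
  unfolding encode_nat_eq power_of_2_iff
  by (intro emittable_append emittable_concat_map F emittable_when emittable_Cons emittable_Nil
      cf_intros cf_dvd cf_div
      cf_hd cf_tl[OF F] cf_tl[OF cf_hd])

text \<open>Counters hold natural numbers only, so a rational is given as a difference over a
  positive denominator. One of the two truncated differences is 0, and their sum is the absolute
  value of the numerator.\<close>

lemma encode_rat_diff:
  assumes "0 < c"
  shows "encode_rat ((of_nat a - of_nat b) / of_nat c) =
    (a < b) # encode_nat (((a - b) + (b - a)) div gcd ((a - b) + (b - a)) c)
      @ encode_nat (c div gcd ((a - b) + (b - a)) c)"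
proof -
  let ?p = "int a - int b" and ?d = "(a - b) + (b - a)"
  let ?g = "gcd ?d c"
  have abs: "\<bar>?p\<bar> = int ?d" by auto
  have g: "gcd ?p (int c) = int ?g"
    by (metis abs gcd_abs1_int gcd_int_int_eq)
  have g0: "0 < ?g" using assms by simp
  have "(of_nat a - of_nat b) / of_nat c = (Fract ?p (int c) :: rat)"
    using assms by (simp add: Fract_of_int_quotient)
  then have q: "quotient_of ((of_nat a - of_nat b) / of_nat c) = (?p div int ?g, int c div int ?g)"
    using assms by (simp add: quotient_of_Fract Rat.normalize_def Let_def g)
  have dvd: "int ?g dvd ?p" using g by (metis gcd_dvd1)
  then obtain r where r: "?p = int ?g * r" by blast
  have "?p div int ?g = r" using r g0 by simp
  moreover have "r < 0 \<longleftrightarrow> ?p < 0" unfolding r using g0 by (simp add: mult_less_0_iff)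
  ultimately have "(?p div int ?g < 0) = (a < b)" by simp
  moreover have "nat \<bar>?p div int ?g\<bar> = ?d div ?g"
  proof -
    have "\<bar>?p div int ?g\<bar> = \<bar>?p\<bar> div int ?g" using r g0 by (simp add: abs_mult)
    then show ?thesis unfolding abs by (metis nat_int zdiv_int)
  qed
  moreover have "nat (int c div int ?g) = c div ?g" by (metis nat_int zdiv_int)
  ultimately show ?thesis by (simp add: encode_rat_def q)
qed

lemma emittable_encode_rat:
  assumes "cf n A" "cf n B" "cf n C" "\<And>x vs. 0 < C x vs"
  shows "emittable n (\<lambda>x vs. encode_rat ((of_nat (A x vs) - of_nat (B x vs)) / of_nat (C x vs)))"
  unfolding encode_rat_diff[OF assms(4)]
  by (intro emittable_Cons emittable_append emittable_encode_nat cf_intros cf_div cf_gcd assms(1-3))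

section \<open>Decompositions into cuts as probability distributions\<close>

text \<open>This is the covariance map from the correlation polytope to the cut polytope: if a sign
  vector is 1 exactly on a set, the product of two of its entries is the displayed expression in the
  indicators of membership.\<close>

definition moment_matrix :: "nat \<Rightarrow> (nat \<Rightarrow> nat \<Rightarrow> real) \<Rightarrow> real mat" where
  "moment_matrix n P = mat n n (\<lambda>(a, b). 1 + 4 * P a b - 2 * P a a - 2 * P b b)"

lemma CUT_iff: "X \<in> CUT n \<longleftrightarrow> (\<exists>\<rho>. cut_rank_le n \<rho> X)"
  unfolding CUT_def mat_convex_hull_def cut_rank_le_def by blast

text \<open>Different indices may give the same cut matrix; their weights are added, which can only
  reduce the number of matrices.\<close>

lemma cut_rank_leI:
  fixes w :: "'j \<Rightarrow> real"
  assumes J: "finite J" "\<And>j. j \<in> J \<Longrightarrow> 0 \<le> w j" "sum w J = 1"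
  shows "cut_rank_le n (card J)
    (mat n n (\<lambda>(a, b). \<Sum>j\<in>J. w j * (if (a \<in> A j) = (b \<in> A j) then 1 else -1)))"
proof -
  define y where "y j = vec n (\<lambda>a. if a \<in> A j then 1 else (-1 :: real))" for j
  define Y where "Y j = outer_self (y j)" for j
  define S where "S = Y ` J"
  define w' where "w' M = sum w {j \<in> J. Y j = M}" for M
  have Yab: "Y j $$ (a, b) = (if (a \<in> A j) = (b \<in> A j) then 1 else -1)" if "a < n" "b < n" for j a b
    using that by (simp add: Y_def y_def outer_self_def)
  have "S \<subseteq> cut_matrices n"
    unfolding S_def cut_matrices_def Y_def by (auto simp: sign_vecs_def y_def intro!: imageI)
  moreover have "card S \<le> card J" unfolding S_def using J(1) by (rule card_image_le)
  moreover have "convex_combination n S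
      (mat n n (\<lambda>(a, b). \<Sum>j\<in>J. w j * (if (a \<in> A j) = (b \<in> A j) then 1 else -1)))"
    unfolding convex_combination_def
  proof (intro conjI exI[of _ w'])
    show "finite S" using J(1) by (simp add: S_def)
    show "\<forall>M\<in>S. 0 \<le> w' M" unfolding w'_def using J(2) by (auto intro: sum_nonneg)
    show "sum w' S = 1"
      unfolding w'_def S_def using sum.image_gen[OF J(1), of w Y] J(3) by simp
    have "(\<Sum>M\<in>S. w' M * M $$ (a, b)) = (\<Sum>j\<in>J. w j * Y j $$ (a, b))" for a b
    proof -
      have "(\<Sum>M\<in>S. w' M * M $$ (a, b)) = (\<Sum>M\<in>S. \<Sum>j\<in>{j \<in> J. Y j = M}. w j * Y j $$ (a, b))"
        unfolding w'_def by (intro sum.cong) (auto simp: sum_distrib_right)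
      also have "\<dots> = (\<Sum>j\<in>J. w j * Y j $$ (a, b))"
        unfolding S_def by (rule sum.image_gen[OF J(1), symmetric])
      finally show ?thesis .
    qed
    then show "mat n n (\<lambda>(a, b). \<Sum>j\<in>J. w j * (if (a \<in> A j) = (b \<in> A j) then 1 else -1))
        = mat n n (\<lambda>(a, b). \<Sum>M\<in>S. w' M * M $$ (a, b))"
      by (intro eq_matI) (auto simp: Yab)
  qed
  ultimately show ?thesis unfolding cut_rank_le_def by blast
qed

lemma cut_rank_le_moment_matrixI:
  fixes w :: "'j \<Rightarrow> real"
  assumes J: "finite J" "\<And>j. j \<in> J \<Longrightarrow> 0 \<le> w j" "sum w J = 1"
    and P: "\<And>a b. a < n \<Longrightarrow> b < n \<Longrightarrow> P a b = (\<Sum>j\<in>J. w j * of_bool (a \<in> A j \<and> b \<in> A j))"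
  shows "cut_rank_le n (card J) (moment_matrix n P)"
proof -
  have "(\<Sum>j\<in>J. w j * (if (a \<in> A j) = (b \<in> A j) then 1 else -1)) = 1 + 4 * P a b - 2 * P a a
      - 2 * P b b"
    if "a < n" "b < n" for a b
  proof -
    have "(\<Sum>j\<in>J. w j * (if (a \<in> A j) = (b \<in> A j) then 1 else -1))
      = (\<Sum>j\<in>J. w j + 4 * (w j * of_bool (a \<in> A j \<and> b \<in> A j)) - 2 * (w j * of_bool (a \<in> A j \<and> a \<in> A
          j))
          - 2 * (w j * of_bool (b \<in> A j \<and> b \<in> A j)))"
      by (intro sum.cong) auto
    then show ?thesis
      by (simp add: P that J(3) sum.distrib sum_subtractf sum_distrib_left)
  qed
  then have "moment_matrix n P = mat n n (\<lambda>(a, b). \<Sum>j\<in>J. w j * (if (a \<in> A j)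
      = (b \<in> A j) then 1 else -1))"
    unfolding moment_matrix_def by (intro eq_matI) auto
  then show ?thesis using cut_rank_leI[OF J] by simp
qed

text \<open>A cut matrix determines its sign vector only up to sign. Normalising entry 0 to be 1
  puts index 0 into every set, which is why index 0 has to be the certain event. Matrices of weight
  0 are discarded, since strictly positive weights are needed to turn vanishing sums into vanishing
  terms.\<close>

lemma cut_rank_le_moment_matrixE:
  assumes "cut_rank_le n \<rho> (moment_matrix n P)" "0 < n" "P 0 0 = 1" "\<And>b. b < n \<Longrightarrow> P 0 b = P b b"
  obtains J :: "real mat set" and w A where "finite J" "card J \<le> \<rho>" "\<And>j. j \<in> J \<Longrightarrow>
      0 < w j" "sum w J = 1"
    "\<And>a b. a < n \<Longrightarrow> b < n \<Longrightarrow> P a b = (\<Sum>j\<in>J. w j * of_bool (a \<in> A j \<and> b \<in> A j))"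
proof -
  obtain S w where S: "S \<subseteq> cut_matrices n" "card S \<le> \<rho>" "finite S"
      and w: "\<forall>Y\<in>S. 0 \<le> w Y" "sum w S = (1 :: real)"
    and X: "moment_matrix n P = mat n n (\<lambda>(i, j). \<Sum>Y\<in>S. w Y * Y $$ (i, j))"
    using assms(1) unfolding cut_rank_le_def convex_combination_def by blast
  define J where "J = {Y \<in> S. w Y \<noteq> 0}"
  define A where "A Y = {a. a < n \<and> Y $$ (0, a) = 1}" for Y :: "real mat"
  define q where "q a b = (\<Sum>Y\<in>J. w Y * of_bool (a \<in> A Y \<and> b \<in> A Y))" for a b
  have JS: "sum f J = sum f S" if "\<And>Y. w Y = 0 \<Longrightarrow> f Y = 0" for f :: "_ \<Rightarrow> real"
    unfolding J_def using S(3) that by (intro sum.mono_neutral_left) auto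
  have fin: "finite J" using S(3) by (simp add: J_def)
  have w1: "sum w J = 1" using JS[of w] w(2) by simp
  have Y: "Y $$ (a, b) = 1 + 4 * of_bool (a \<in> A Y \<and> b \<in> A Y) - 2 * of_bool (a \<in> A Y)
      - 2 * of_bool (b \<in> A Y)"
    and Y0: "0 \<in> A Y" if YJ: "Y \<in> J" and "a < n" "b < n" for Y a b
  proof -
    obtain y where y: "y \<in> sign_vecs n" "Y = outer_self y"
      using YJ S(1) unfolding J_def cut_matrices_def by blast
    have e: "Y $$ (a, b) = y $ a * y $ b" if "a < n" "b < n" for a b
      using y that by (auto simp: outer_self_def sign_vecs_def)
    have pm: "y $ a = 1 \<or> y $ a = -1" if "a < n" for a
      using y(1) that by (auto simp: sign_vecs_def)
    show "Y $$ (a, b) = 1 + 4 * of_bool (a \<in> A Y \<and> b \<in> A Y) - 2 * of_bool (a \<in> A Y)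
        - 2 * of_bool (b \<in> A Y)"
      using that pm[of a] pm[of b] pm[of 0] assms(2) by (auto simp: e A_def)
    show "0 \<in> A Y" using pm[of 0] assms(2) by (auto simp: e A_def)
  qed
  have Pq: "1 + 4 * P a b - 2 * P a a - 2 * P b b = 1 + 4 * q a b - 2 * q a a - 2 * q b b"
    if "a < n" "b < n" for a b
  proof -
    have "1 + 4 * P a b - 2 * P a a - 2 * P b b = moment_matrix n P $$ (a, b)"
      using that by (simp add: moment_matrix_def)
    also have "\<dots> = (\<Sum>Y\<in>S. w Y * Y $$ (a, b))" using that by (simp add: X)
    also have "\<dots> = (\<Sum>Y\<in>J. w Y * Y $$ (a, b))" by (rule JS[symmetric]) simp
    also have "\<dots> = (\<Sum>Y\<in>J. w Y + 4 * (w Y * of_bool (a \<in> A Y \<and> b \<in> A Y))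
        - 2 * (w Y * of_bool (a \<in> A Y \<and> a \<in> A Y)) - 2 * (w Y * of_bool (b \<in> A Y \<and> b \<in> A Y)))"
    proof (intro sum.cong refl)
      fix Y assume "Y \<in> J"
      show "w Y * Y $$ (a, b) = w Y + 4 * (w Y * of_bool (a \<in> A Y \<and> b \<in> A Y))
          - 2 * (w Y * of_bool (a \<in> A Y \<and> a \<in> A Y)) - 2 * (w Y * of_bool (b \<in> A Y \<and> b \<in> A Y))"
        unfolding Y[OF \<open>Y \<in> J\<close> that] conj_absorb by (simp only: right_diff_distrib distrib_left)
    qed
    also have "\<dots> = 1 + 4 * q a b - 2 * q a a - 2 * q b b"
      by (simp add: w1 q_def sum.distrib sum_subtractf sum_distrib_left)
    finally show ?thesis .
  qed
  have q0: "q 0 b = q b b" if "b < n" for b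
    unfolding q_def using Y0 that assms(2) by (intro sum.cong) auto
  have q00: "q 0 0 = 1" unfolding q_def using Y0 assms(2) w1 by simp
  \<comment> \<open>Entry \<open>(0, b)\<close> reduces to \<open>2 * P b b - 1\<close>, and
    likewise for \<open>q\<close>; the remaining entries then give the joint probabilities.\<close>
  have Pbb: "P b b = q b b" if "b < n" for b
    using Pq[OF assms(2) that] q0[OF that] q00 assms(3) assms(4)[OF that] by linarith
  have "P a b = q a b" if "a < n" "b < n" for a b
    using Pq[OF that] Pbb[OF that(1)] Pbb[OF that(2)] by linarith
  moreover have "0 < w Y" if "Y \<in> J" for Y using w(1) that by (auto simp: J_def less_le)
  moreover have "card J \<le> \<rho>" using S(2,3) card_mono[of S J] by (auto simp: J_def)
  ultimately show ?thesis using fin w1 that[of J w A] unfolding q_def by blast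
qed

section \<open>Literal systems\<close>

text \<open>Index 0 stands for the certain event, index 1 for the flag, index \<open>i + 2\<close> for literal \<open>i\<close>.
  Given the flag, exactly one literal of every cell holds, literal \<open>i\<close> with conditional probability
  \<open>a i / W\<close>. Joint probabilities of two literals are not prescribed by the flag: sets consisting of
  two compatible literals and not containing the flag make up for the difference.\<close>

locale literal_system =
  fixes n N W :: nat and cell :: "nat \<Rightarrow> nat" and ok :: "nat \<Rightarrow> nat \<Rightarrow> bool" and a :: "nat \<Rightarrow> nat"
  assumes cell_less: "i < n \<Longrightarrow> cell i < N"
    and ok_sym: "ok i j \<Longrightarrow> ok j i"
    and ok_cell: "ok i j \<Longrightarrow> cell i \<noteq> cell j"
    and W_pos: "0 < W"
    and N_ge: "2 \<le> N"
    and sum_a: "v < N \<Longrightarrow> (\<Sum>i\<in>{i. i < n \<and> cell i = v}. a i) = W"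
    and degree_ge: "i < n \<Longrightarrow> N - 1 \<le> card {j. j < n \<and> ok i j}"
begin

definition pairs :: "(nat \<times> nat) set" where
  "pairs = {(i, j). i < j \<and> j < n \<and> ok i j}"

definition degree :: "nat \<Rightarrow> nat" where
  "degree i = card {j. j < n \<and> ok i j}"

text \<open>Total mass before normalisation: the flagged sets have mass 1, and every compatible pair
  contributes 1 minus its flagged joint probability. These probabilities add up to the number of
  pairs within a set of \<open>N\<close> literals.\<close>

definition D :: nat where
  "D = 1 + card pairs - N * (N - 1) div 2"

definition prob :: "nat \<Rightarrow> real" where
  "prob i = real (a i) / real W"

text \<open>Literal \<open>i\<close> has flagged mass \<open>prob i\<close>, and the two-literal
  sets containing it have mass \<open>degree i - prob i * (N - 1)\<close>; the sum is divided by
  \<open>D\<close>.\<close>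

definition event :: "nat \<Rightarrow> real" where
  "event b = (if b = 0 then 1 else if b = 1 then 1 / D
     else (degree (b - 2) - prob (b - 2) * (N - 2)) / D)"

text \<open>For compatible literals the flagged and unflagged masses always add up to 1 before
  division by \<open>D\<close>, so the last case does not depend on a solution.\<close>

definition moment :: "nat \<Rightarrow> nat \<Rightarrow> real" where
  "moment b c =
     (if b = c then event b else if b = 0 then event c else if c = 0 then event b
      else if b = 1 then prob (c - 2) / D else if c = 1 then prob (b - 2) / D
      else of_bool (ok (b - 2) (c - 2)) / D)"

definition clique :: "nat set \<Rightarrow> bool" where
  "clique S \<longleftrightarrow> S \<subseteq> {..<n} \<and> (\<forall>v<N. card {i \<in> S. cell i = v} = 1) \<and>
     (\<forall>i\<in>S. \<forall>j\<in>S. i \<noteq> j \<longrightarrow> ok i j)"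

lemma finite_pairs: "finite pairs"
  by (rule finite_subset[of _ "{..<n} \<times> {..<n}"]) (auto simp: pairs_def)

lemma ok_irrefl: "\<not> ok i i"
  using ok_cell by blast

lemma sum_pairs:
  fixes f :: "nat \<Rightarrow> nat \<Rightarrow> real"
  assumes sym: "\<And>i j. f i j = f j i"
  shows "2 * (\<Sum>(i, j)\<in>pairs. f i j) = (\<Sum>i<n. \<Sum>j<n. of_bool (ok i j) * f i j)"
proof -
  let ?O = "{(i, j). i < n \<and> j < n \<and> ok i j}"
  have O: "?O = pairs \<union> prod.swap ` pairs"
  proof (rule equalityI; rule subsetI)
    fix p assume "p \<in> ?O"
    then obtain i j where p: "p = (i, j)" "i < n" "j < n" "ok i j" by blast
    then have "i < j \<or> j < i" using ok_irrefl by (metis nat_neq_iff)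
    then show "p \<in> pairs \<union> prod.swap ` pairs"
    proof
      assume "j < i"
      then have "(j, i) \<in> pairs" using p ok_sym by (simp add: pairs_def)
      then have "prod.swap (j, i) \<in> prod.swap ` pairs" by (rule imageI)
      then show ?thesis using p by simp
    qed (use p in \<open>simp add: pairs_def\<close>)
  qed (auto simp: pairs_def intro: ok_sym)
  have disj: "pairs \<inter> prod.swap ` pairs = {}" by (auto simp: pairs_def)
  have "(\<Sum>i<n. \<Sum>j<n. of_bool (ok i j) * f i j)
      = (\<Sum>(i, j)\<in>{..<n} \<times> {..<n}. of_bool (ok i j) * f i j)"
    by (rule sum.cartesian_product)
  also have "\<dots> = (\<Sum>(i, j)\<in>?O. f i j)"
    by (intro sum.mono_neutral_cong_right) auto
  also have "\<dots> = (\<Sum>(i, j)\<in>pairs. f i j) + (\<Sum>(i, j)\<in>prod.swap ` pairs. f i j)"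
    unfolding O using finite_pairs disj by (intro sum.union_disjoint) auto
  also have "(\<Sum>(i, j)\<in>prod.swap ` pairs. f i j) = (\<Sum>(i, j)\<in>pairs. f j i)"
    by (subst sum.reindex) (auto simp: case_prod_unfold inj_on_def)
  also have "\<dots> = (\<Sum>(i, j)\<in>pairs. f i j)" using sym by (intro sum.cong) auto
  finally show ?thesis by simp
qed

lemma degree_sum: "real (degree i) = (\<Sum>j<n. of_bool (ok i j))"
proof -
  have "{..<n} \<inter> {j. ok i j} = {j. j < n \<and> ok i j}" by auto
  then show ?thesis by (simp add: degree_def of_bool_def sum.If_cases)
qed

lemma sum_degree: "(\<Sum>i<n. real (degree i)) = 2 * real (card pairs)"
  using sum_pairs[of "\<lambda>_ _. 1"] by (simp add: degree_sum)

lemma sum_cells: "(\<Sum>i<n. f i) = (\<Sum>v<N. \<Sum>i\<in>{i. i < n \<and> cell i = v}. f i)"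
    for f :: "nat \<Rightarrow> 'b :: comm_monoid_add"
proof -
  have "(\<Sum>v<N. \<Sum>i\<in>{i \<in> {..<n}. cell i = v}. f i) = (\<Sum>i<n. f i)"
    by (rule sum.group) (auto dest: cell_less)
  then show ?thesis by (simp add: lessThan_def)
qed

lemma sum_prob_cell: "v < N \<Longrightarrow> (\<Sum>i\<in>{i. i < n \<and> cell i = v}. prob i) = 1"
  using sum_a[of v] W_pos unfolding prob_def
  by (metis (mono_tags, lifting) divide_self_if of_nat_0_eq_iff of_nat_sum order_less_irrefl
      sum.cong sum_divide_distrib)

lemma sum_prob: "(\<Sum>i<n. prob i) = N"
  unfolding sum_cells using sum_prob_cell by simp

lemma a_le: "i < n \<Longrightarrow> a i \<le> W"
  using sum_a[OF cell_less, of i] member_le_sum[of i "{j. j < n \<and> cell j = cell i}" a] by simp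

lemma prob_le: "i < n \<Longrightarrow> prob i \<le> 1"
  using a_le[of i] W_pos by (simp add: prob_def)

lemma N_le_n: "N \<le> n"
proof -
  have "real N \<le> (\<Sum>i<n. 1)" unfolding sum_prob[symmetric] by (intro sum_mono) (simp add: prob_le)
  then show ?thesis by simp
qed

text \<open>Makes the truncated subtraction in \<open>D\<close> exact: there are at least
  \<open>N\<close> literals, each of degree at least \<open>N - 1\<close>.\<close>

lemma half_le_pairs: "N * (N - 1) div 2 \<le> card pairs"
proof -
  have "real (N * (N - 1)) \<le> real (n * (N - 1))" using N_le_n
      by (intro of_nat_mono mult_right_mono) auto
  also have "\<dots> = (\<Sum>i<n. real (N - 1))" by simp
  also have "\<dots> \<le> (\<Sum>i<n. real (degree i))"
    unfolding degree_def by (intro sum_mono of_nat_mono degree_ge) simp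
  finally have "real (N * (N - 1)) \<le> real (2 * card pairs)" unfolding sum_degree by simp
  then have "N * (N - 1) \<le> 2 * card pairs" by (simp only: of_nat_le_iff)
  then show ?thesis by simp
qed

lemma real_D: "real D = 1 + real (card pairs) - real N * (real N - 1) / 2"
proof -
  have "even (N * (N - 1))" by auto
  then have "real (N * (N - 1) div 2) = real (N * (N - 1)) / 2" by (simp add: real_of_nat_div)
  then have "real (N * (N - 1) div 2) = real N * (real N - 1) / 2"
    using N_ge by (simp add: of_nat_diff)
  then show ?thesis unfolding D_def using half_le_pairs by (subst of_nat_diff) auto
qed

lemma D_pos: "0 < D"
  using half_le_pairs by (simp add: D_def)

lemma sum_pairs_containing:
  fixes h :: "nat \<Rightarrow> nat \<Rightarrow> real"
  assumes sym: "\<And>k l. h k l = h l k" and i: "i < n"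
  shows "(\<Sum>(k, l)\<in>pairs. h k l * of_bool (i = k \<or> i = l)) = (\<Sum>l<n. of_bool (ok i l) * h i l)"
proof -
  have "2 * (\<Sum>(k, l)\<in>pairs. h k l * of_bool (i = k \<or> i = l))
      = (\<Sum>k<n. \<Sum>l<n. of_bool (ok k l) * (h k l * of_bool (i = k \<or> i = l)))"
    by (rule sum_pairs) (use sym in auto)
  also have "\<dots> = (\<Sum>k<n. \<Sum>l<n. (if k = i then of_bool (ok i l) * h i l else 0)
      + (if l = i then of_bool (ok i k) * h i k else 0))"
  proof (intro sum.cong refl)
    fix k l
    show "of_bool (ok k l) * (h k l * of_bool (i = k \<or> i = l))
      = (if k = i then of_bool (ok i l) * h i l else 0) + (if l = i then of_bool (ok i k) * h i k
          else 0)"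
      using ok_irrefl[of i] ok_sym[of k l] ok_sym[of l k] sym[of k l]
          by (cases "k = i"; cases "l = i") auto
  qed
  also have "\<dots> = (\<Sum>k<n. if k = i then (\<Sum>l<n. of_bool (ok i l) * h i l) else 0)
      + (\<Sum>k<n. of_bool (ok i k) * h i k)"
  proof -
    have "(\<Sum>l<n. if k = i then of_bool (ok i l) * h i l else 0)
        = (if k = i then (\<Sum>l<n. of_bool (ok i l) * h i l) else 0)" for k by simp
    moreover have "(\<Sum>l<n. if l = i then of_bool (ok i k) * h i k else 0) = of_bool (ok i k) * h i k"
        for k
      using i by (subst sum.delta) auto
    ultimately show ?thesis by (simp only: sum.distrib)
  qed
  also have "(\<Sum>k<n. if k = i then (\<Sum>l<n. of_bool (ok i l) * h i l) else 0)
      = (\<Sum>l<n. of_bool (ok i l) * h i l)"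
    using i by (subst sum.delta) auto
  finally show ?thesis by simp
qed

lemma sum_pairs_both:
  fixes h :: "nat \<Rightarrow> nat \<Rightarrow> real"
  assumes sym: "\<And>k l. h k l = h l k" and ij: "i < n" "j < n" "i \<noteq> j"
  shows "(\<Sum>(k, l)\<in>pairs. h k l * of_bool ((i = k \<or> i = l) \<and> (j = k \<or> j = l)))
      = of_bool (ok i j) * h i j"
proof -
  let ?m = "(min i j, max i j)"
  have "(\<Sum>(k, l)\<in>pairs. h k l * of_bool ((i = k \<or> i = l) \<and> (j = k \<or> j = l)))
      = (\<Sum>p\<in>pairs. if p = ?m then h i j else 0)"
  proof (intro sum.cong refl)
    fix p assume "p \<in> pairs"
    then obtain k l where p: "p = (k, l)" "k < l" by (auto simp: pairs_def)
    have "(i = k \<or> i = l) \<and> (j = k \<or> j = l) \<longleftrightarrow> p = ?m"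
      using p ij(3) by (auto simp: min_def max_def)
    moreover have "h k l = h i j" if "p = ?m"
      using that p sym[of i j] by (auto simp: min_def max_def split: if_splits)
    ultimately show "(case p of (k, l) \<Rightarrow> h k l * of_bool ((i = k \<or> i = l) \<and> (j = k \<or> j = l)))
        = (if p = ?m then h i j else 0)"
      using p by auto
  qed
  also have "\<dots> = (if ?m \<in> pairs then h i j else 0)"
    using finite_pairs by (subst sum.delta) auto
  also have "?m \<in> pairs \<longleftrightarrow> ok i j"
    using ij ok_sym[of i j] ok_sym[of j i] by (auto simp: pairs_def min_def max_def)
  finally show ?thesis by auto
qed

section \<open>Decompositions built from cliques\<close>

lemma clique_cell_sum:
  assumes "clique S" "v < N"
  shows "(\<Sum>i\<in>{i. i < n \<and> cell i = v}. of_bool (i \<in> S)) = (1 :: real)"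
proof -
  have "{i. i < n \<and> cell i = v} \<inter> {i. i \<in> S} = {i \<in> S. cell i = v}"
    using assms(1) by (auto simp: clique_def)
  then show ?thesis using assms by (simp add: of_bool_def sum.If_cases clique_def)
qed

lemma clique_sum:
  assumes "clique S"
  shows "(\<Sum>i<n. of_bool (i \<in> S)) = real N"
proof -
  have "(\<Sum>i<n. of_bool (i \<in> S)) = (\<Sum>v<N. 1 :: real)"
    unfolding sum_cells using assms by (intro sum.cong refl clique_cell_sum) auto
  then show ?thesis by simp
qed

lemma clique_neighbours:
  assumes S: "clique S" and i: "i \<in> S"
  shows "(\<Sum>j<n. of_bool (ok i j) * of_bool (j \<in> S)) = real N - 1"
proof -
  have "i < n" using S i by (auto simp: clique_def)
  have "(\<Sum>j<n. of_bool (ok i j) * of_bool (j \<in> S))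
      = (\<Sum>j<n. of_bool (j \<in> S) - (if j = i then 1 else 0 :: real))"
    using S i ok_irrefl by (intro sum.cong) (auto simp: clique_def)
  also have "\<dots> = real N - 1"
    using clique_sum[OF S] \<open>i < n\<close> by (simp add: sum_subtractf)
  finally show ?thesis .
qed

text \<open>The decomposition consists of the given cliques together with indices 0 and 1, and of
  one set \<open>{0, i + 2, j + 2}\<close> for each compatible pair. The latter gets weight
  \<open>1 - c i j\<close> because the cliques already contribute \<open>c i j\<close>; all weights
  are divided by \<open>D\<close>.\<close>

lemma cut_rank_le_cliquesI:
  fixes u :: "'j \<Rightarrow> real"
  assumes J: "finite J" "\<And>k. k \<in> J \<Longrightarrow> 0 \<le> u k" and S: "\<And>k. k \<in> J \<Longrightarrow> clique (S k)"
    and marginal: "\<And>i. i < n \<Longrightarrow> (\<Sum>k\<in>J. u k * of_bool (i \<in> S k)) = prob i"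
  shows "cut_rank_le (n + 2) (card J + card pairs) (moment_matrix (n + 2) moment)"
proof -
  define c where "c i j = (\<Sum>k\<in>J. u k * of_bool (i \<in> S k \<and> j \<in> S k))" for i j
  have c_sym: "c i j = c j i" for i j unfolding c_def by (simp add: conj_commute)
  have c_le: "c i j \<le> 1" if "i < n" for i j
  proof -
    have "c i j \<le> (\<Sum>k\<in>J. u k * of_bool (i \<in> S k))"
      unfolding c_def using J(2) by (intro sum_mono) auto
    then show ?thesis using marginal[OF that] prob_le[OF that] by simp
  qed
  have c_ok: "of_bool (ok i j) * c i j = c i j" if "i \<noteq> j" for i j
    unfolding c_def using S that
    by (cases "ok i j") (auto intro!: sum.neutral simp: clique_def)
  have sum_c: "(\<Sum>j<n. of_bool (ok i j) * c i j) = prob i * (N - 1)" if "i < n" for i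
  proof -
    have "(\<Sum>j<n. of_bool (ok i j) * c i j)
        = (\<Sum>k\<in>J. \<Sum>j<n. of_bool (ok i j) * (u k * of_bool (i \<in> S k \<and> j \<in> S k)))"
      unfolding c_def sum_distrib_left by (rule sum.swap)
    also have "\<dots> = (\<Sum>k\<in>J. u k * of_bool (i \<in> S k) * (N - 1))"
    proof (intro sum.cong refl)
      fix k assume k: "k \<in> J"
      show "(\<Sum>j<n. of_bool (ok i j) * (u k * of_bool (i \<in> S k \<and> j \<in> S k)))
          = u k * of_bool (i \<in> S k) * (N - 1)"
      proof (cases "i \<in> S k")
        case True
        have "(\<Sum>j<n. of_bool (ok i j) * (u k * of_bool (i \<in> S k \<and> j \<in> S k)))
            = u k * (\<Sum>j<n. of_bool (ok i j) * of_bool (j \<in> S k))"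
          unfolding sum_distrib_left using True by (intro sum.cong) auto
        also have "\<dots> = u k * (real N - 1)" by (simp only: clique_neighbours[OF S[OF k] True])
        finally show ?thesis using True N_ge by (simp add: of_nat_diff)
      qed simp
    qed
    also have "\<dots> = prob i * (N - 1)" using marginal[OF that]
        by (simp add: sum_distrib_right[symmetric])
    finally show ?thesis .
  qed
  \<comment> \<open>Each clique has exactly one literal in cell 0, so the marginals of this cell
    determine the total weight.\<close>
  have sum_u: "sum u J = 1"
  proof -
    have "(\<Sum>i\<in>{i. i < n \<and> cell i = 0}. prob i) = (\<Sum>i\<in>{i. i < n \<and> cell i
        = 0}. \<Sum>k\<in>J. u k * of_bool (i \<in> S k))"
      using marginal by (intro sum.cong) auto
    also have "\<dots> = (\<Sum>k\<in>J. \<Sum>i\<in>{i. i < n \<and> cell i = 0}. u k * of_bool (i \<in> S k))" by (rule sum.swap)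
    also have "\<dots> = sum u J"
    proof (rule sum.cong)
      fix k assume "k \<in> J"
      then show "(\<Sum>i\<in>{i. i < n \<and> cell i = 0}. u k * of_bool (i \<in> S k)) = u k"
        using clique_cell_sum[OF S, of k 0] N_ge by (simp only: sum_distrib_left[symmetric])
    qed simp
    finally show ?thesis using sum_prob_cell[of 0] N_ge by simp
  qed
  have sum_c_pairs: "(\<Sum>(i, j)\<in>pairs. c i j) = N * (real N - 1) / 2"
  proof -
    have "2 * (\<Sum>(i, j)\<in>pairs. c i j) = (\<Sum>i<n. prob i * (N - 1))"
      unfolding sum_pairs[OF c_sym] using sum_c by (intro sum.cong) auto
    also have "\<dots> = N * (real N - 1)"
      using N_ge by (simp add: sum_distrib_right[symmetric] sum_prob of_nat_diff)
    finally show ?thesis by simp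
  qed
  define w where "w = case_sum (\<lambda>k. u k / D) (\<lambda>(i, j). (1 - c i j) / D)"
  define A where "A = case_sum (\<lambda>k. insert 0 (insert 1 ((\<lambda>i. i + 2) ` S k))) (\<lambda>(i, j). {0, i + 2, j
      + 2 :: nat})"
  let ?M = "\<lambda>b c. (\<Sum>k\<in>J <+> pairs. w k * of_bool (b \<in> A k \<and> c \<in> A k))"
  have split: "(\<Sum>k\<in>J <+> pairs. w k * f k)
      = ((\<Sum>k\<in>J. u k * f (Inl k)) + (\<Sum>(i, j)\<in>pairs. (1 - c i j) * f (Inr (i, j)))) / D" for f
    by (simp add: sum.Plus J(1) finite_pairs w_def case_prod_unfold sum_divide_distrib
        add_divide_distrib)
  have w_sum: "sum w (J <+> pairs) = 1"
  proof -
    have "sum w (J <+> pairs) = (sum u J + (card pairs - (\<Sum>(i, j)\<in>pairs. c i j))) / D"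
      using split[of "\<lambda>_. 1"] by (simp add: case_prod_unfold sum_subtractf)
    also have "sum u J + (card pairs - (\<Sum>(i, j)\<in>pairs. c i j)) = real D"
      unfolding sum_u sum_c_pairs real_D by simp
    also have "real D / real D = 1" using D_pos by simp
    finally show ?thesis .
  qed
  have lit: "?M (i + 2) (i + 2) = event (i + 2)" if i: "i < n" for i
  proof -
    have "?M (i + 2) (i + 2) = ((\<Sum>k\<in>J. u k * of_bool (i \<in> S k))
        + (\<Sum>(k, l)\<in>pairs. (1 - c k l) * of_bool (i = k \<or> i = l))) / D"
      unfolding split by (simp add: A_def image_iff)
    also have "(\<Sum>(k, l)\<in>pairs. (1 - c k l) * of_bool (i = k \<or> i = l))
        = (\<Sum>l<n. of_bool (ok i l) * (1 - c i l))"
      by (rule sum_pairs_containing) (use c_sym i in auto)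
    also have "\<dots> = degree i - prob i * (N - 1)"
      unfolding degree_sum sum_c[OF i, symmetric] by (simp add: right_diff_distrib sum_subtractf)
    finally show ?thesis
      using N_ge by (simp add: marginal[OF i] event_def of_nat_diff algebra_simps)
  qed
  have diag: "?M b b = event b" if b: "b < n + 2" for b
  proof -
    consider "b = 0" | "b = 1" | "2 \<le> b" by linarith
    then show ?thesis
    proof cases
      case 1
      have "?M b b = sum w (J <+> pairs)" by (intro sum.cong) (auto simp: 1 A_def)
      then show ?thesis using 1 w_sum by (simp add: event_def)
    next
      case 2
      have "?M b b = (sum u J) / D" unfolding split by (simp add: A_def 2 case_prod_unfold)
      then show ?thesis using 2 sum_u by (simp add: event_def)
    next
      case 3
      then show ?thesis using lit[of "b - 2"] b by (simp only: le_add_diff_inverse2)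
    qed
  qed
  have flag: "?M 1 (i + 2) = prob i / D" if "i < n" for i
    unfolding split by (simp add: A_def case_prod_unfold image_iff marginal[OF that])
  have two: "?M (i + 2) (j + 2) = of_bool (ok i j) / D" if ij: "i < n" "j < n" "i \<noteq> j" for i j
  proof -
    have "?M (i + 2) (j + 2) = (c i j
        + (\<Sum>(k, l)\<in>pairs. (1 - c k l) * of_bool ((i = k \<or> i = l) \<and> (j = k \<or> j = l)))) / D"
      unfolding split c_def by (simp add: A_def image_iff)
    also have "(\<Sum>(k, l)\<in>pairs. (1 - c k l) * of_bool ((i = k \<or> i = l) \<and> (j = k \<or> j = l)))
        = of_bool (ok i j) * (1 - c i j)"
      by (rule sum_pairs_both) (use c_sym ij in auto)
    also have "c i j + of_bool (ok i j) * (1 - c i j) = of_bool (ok i j)"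
      using c_ok[OF ij(3)] by (simp add: right_diff_distrib)
    finally show ?thesis .
  qed
  have M_sym: "?M b c = ?M c b" for b c by (simp add: conj_commute)
  have zero: "?M 0 b = ?M b b" for b by (intro sum.cong) (auto simp: A_def)
  have moment: "moment b c = ?M b c" if bc: "b < n + 2" "c < n + 2" for b c
  proof -
    consider "b = c" | "b = 0" | "c = 0" | "b = 1" "2 \<le> c" | "c = 1" "2 \<le> b" | "2 \<le> b" "2
        \<le> c" "b \<noteq> c"
      by linarith
    then show ?thesis
    proof cases
      case 1 then show ?thesis using diag bc by (simp add: moment_def)
    next
      case 2 then show ?thesis using diag bc zero by (simp add: moment_def)
    next
      case 3 then show ?thesis using diag bc zero M_sym[of b 0] by (simp add: moment_def)
    next
      case 4
      then obtain i where "c = i + 2" using le_add_diff_inverse2 by metis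
      then show ?thesis using 4 bc flag[of i] by (simp add: moment_def)
    next
      case 5
      then obtain i where "b = i + 2" using le_add_diff_inverse2 by metis
      then show ?thesis using 5 bc flag[of i] M_sym[of b 1] by (simp add: moment_def)
    next
      case 6
      then obtain i j where "b = i + 2" "c = j + 2" using le_add_diff_inverse2 by metis
      then show ?thesis using 6 bc two[of i j] by (simp add: moment_def)
    qed
  qed
  have "cut_rank_le (n + 2) (card (J <+> pairs)) (moment_matrix (n + 2) moment)"
  proof (rule cut_rank_le_moment_matrixI[OF _ _ w_sum moment])
    show "finite (J <+> pairs)" using J(1) finite_pairs by simp
    fix k assume "k \<in> J <+> pairs"
    then show "0 \<le> w k"
      using J(2) c_le by (auto simp: w_def pairs_def)
  qed
  then show ?thesis using card_Plus[OF J(1) finite_pairs] by simp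
qed

section \<open>Cliques extracted from decompositions\<close>

lemma decomposition_flagged:
  fixes J :: "'j set" and w :: "'j \<Rightarrow> real" and A :: "'j \<Rightarrow> nat set"
  assumes J: "finite J" "\<forall>k\<in>J. 0 < w k"
    and M: "\<forall>b<n + 2. \<forall>c<n + 2. moment b c = (\<Sum>k\<in>J. w k * of_bool (b \<in> A k \<and> c \<in> A k))"
  defines "lits \<equiv> \<lambda>k. {i. i < n \<and> i + 2 \<in> A k}" and "flagged \<equiv> {k \<in> J. 1 \<in> A k}"
  shows "k \<in> J \<Longrightarrow> i \<in> lits k \<Longrightarrow> j \<in> lits k \<Longrightarrow> i \<noteq> j \<Longrightarrow> ok i j"
    and "i < n \<Longrightarrow> (\<Sum>k\<in>flagged. w k * of_bool (i \<in> lits k)) = prob i / D"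
    and "sum w flagged = 1 / D"
    and "k \<in> flagged \<Longrightarrow> clique (lits k)"
proof -
  have fin: "finite flagged" using J(1) by (simp add: flagged_def)
  \<comment> \<open>All weights are positive, so joint probability 0 keeps two literals from
    occurring in a common set.\<close>
  show ok: "ok i j" if "k \<in> J" "i \<in> lits k" "j \<in> lits k" "i \<noteq> j" for k i j
  proof (rule ccontr)
    assume "\<not> ok i j"
    then have "moment (i + 2) (j + 2) = 0" using that by (simp add: moment_def)
    then have "(\<Sum>k\<in>J. w k * of_bool (i + 2 \<in> A k \<and> j + 2 \<in> A k)) = 0"
      using M[rule_format, of "i + 2" "j + 2"] that by (simp add: lits_def)
    then have "w k * of_bool (i + 2 \<in> A k \<and> j + 2 \<in> A k) = 0"
      using sum_nonneg_eq_0_iff[OF J(1), of "\<lambda>k. w k * of_bool (i + 2 \<in> A k \<and> j + 2 \<in> A k)"]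
        J(2) that(1) by (simp add: less_imp_le)
    then show False using J(2)[rule_format, OF that(1)] that by (simp add: lits_def)
  qed
  have restrict: "(\<Sum>k\<in>flagged. f k) = (\<Sum>k\<in>J. f k * of_bool (1 \<in> A k))" for f :: "_ \<Rightarrow> real"
    unfolding flagged_def using J(1) by (intro sum.mono_neutral_cong_left) auto
  show lit: "(\<Sum>k\<in>flagged. w k * of_bool (i \<in> lits k)) = prob i / D" if "i < n" for i
  proof -
    have "(\<Sum>k\<in>flagged. w k * of_bool (i \<in> lits k)) = (\<Sum>k\<in>J. w k * of_bool (1 \<in> A k \<and> i + 2 \<in> A k))"
      unfolding restrict using that by (intro sum.cong) (auto simp: lits_def)
    also have "\<dots> = prob i / D" using M[rule_format, of 1 "i + 2"] that by (simp add: moment_def)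
    finally show ?thesis .
  qed
  show total: "sum w flagged = 1 / D"
  proof -
    have "sum w flagged = (\<Sum>k\<in>J. w k * of_bool (1 \<in> A k \<and> 1 \<in> A k))"
      unfolding restrict by (intro sum.cong) auto
    also have "\<dots> = 1 / D" using M[rule_format, of 1 1] by (simp add: moment_def event_def)
    finally show ?thesis .
  qed
  show "clique (lits k)" if k: "k \<in> flagged" for k
  proof -
    have kJ: "k \<in> J" using k by (simp add: flagged_def)
    have "card {i \<in> lits k. cell i = v} = 1" if v: "v < N" for v
    proof -
      \<comment> \<open>The number of literals of cell \<open>v\<close> is at most 1 in each set,
        and its average over the flagged mass is 1; hence it is 1 in every flagged set.\<close>
      define c where "c k = card {i \<in> lits k. cell i = v}" for k
      have c_sum: "real (c k) = (\<Sum>i\<in>{i. i < n \<and> cell i = v}. of_bool (i \<in> lits k))" for k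
      proof -
        have "{i. i < n \<and> cell i = v} \<inter> {i. i \<in> lits k} = {i \<in> lits k. cell i = v}"
          by (auto simp: lits_def)
        then show ?thesis by (simp add: c_def of_bool_def sum.If_cases)
      qed
      have c_le: "c k \<le> 1" if "k \<in> J" for k
      proof -
        have "i = j" if "i \<in> {i \<in> lits k. cell i = v}" "j \<in> {i \<in> lits k. cell i = v}" for i j
          using ok[OF \<open>k \<in> J\<close>, of i j] ok_cell[of i j] that by auto
        moreover have "finite {i \<in> lits k. cell i = v}" by (simp add: lits_def)
        ultimately show ?thesis
          unfolding c_def One_nat_def using iffD2[OF card_le_Suc0_iff_eq] by blast
      qed
      have "(\<Sum>k\<in>flagged. w k * c k) = (\<Sum>i\<in>{i. i < n \<and> cell i
          = v}. \<Sum>k\<in>flagged. w k * of_bool (i \<in> lits k))"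
        unfolding c_sum sum_distrib_left by (rule sum.swap)
      also have "\<dots> = (\<Sum>i\<in>{i. i < n \<and> cell i = v}. prob i / D)" using lit by (intro sum.cong) auto
      also have "\<dots> = 1 / D" using sum_prob_cell[OF v] by (simp add: sum_divide_distrib[symmetric])
      finally have "(\<Sum>k\<in>flagged. w k * (1 - real (c k))) = 0" using total
          by (simp add: right_diff_distrib sum_subtractf)
      moreover have "0 \<le> w k * (1 - real (c k))" if "k \<in> flagged" for k
        using c_le[of k] J(2)[rule_format, of k] that by (auto simp: flagged_def)
      ultimately have "w k * (1 - real (c k)) = 0"
        using sum_nonneg_eq_0_iff[OF fin, of "\<lambda>k. w k * (1 - real (c k))"] k by simp
      then show ?thesis using J(2)[rule_format, OF kJ] by (simp add: c_def)
    qed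
    then show ?thesis using ok[OF kJ] by (auto simp: clique_def lits_def)
  qed
qed

text \<open>The flag has positive probability, so a flagged set exists. Any one will do: a literal
  of weight 0 lies in no flagged set.\<close>

lemma CUT_moment_matrix_clique:
  assumes "moment_matrix (n + 2) moment \<in> CUT (n + 2)"
  shows "\<exists>S. clique S \<and> (\<forall>i\<in>S. 0 < a i)"
proof -
  obtain \<rho> where "cut_rank_le (n + 2) \<rho> (moment_matrix (n + 2) moment)"
    using assms CUT_iff by blast
  then obtain J :: "real mat set" and w A where J: "finite J" "\<And>k. k \<in> J \<Longrightarrow> 0 < w k"
    and M: "\<And>b c. b < n + 2 \<Longrightarrow> c < n + 2 \<Longrightarrow> moment b c = (\<Sum>k\<in>J. w k * of_bool (b \<in> A k \<and> c \<in> A k))"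
    by (rule cut_rank_le_moment_matrixE) (auto simp: moment_def event_def)
  have J': "\<forall>k\<in>J. 0 < w k"
    and M': "\<forall>b<n + 2. \<forall>c<n + 2. moment b c = (\<Sum>k\<in>J. w k * of_bool (b \<in> A k \<and> c \<in> A k))"
    using J(2) M by blast+
  define lits where "lits k = {i. i < n \<and> i + 2 \<in> A k}" for k
  define flagged where "flagged = {k \<in> J. 1 \<in> A k}"
  note dec = decomposition_flagged[OF J(1) J' M', folded lits_def flagged_def]
  have "flagged \<noteq> {}" using dec(3) D_pos by auto
  then obtain k where k: "k \<in> flagged" by blast
  have "0 < a i" if i: "i \<in> lits k" for i
  proof (rule ccontr)
    assume "\<not> 0 < a i"
    then have "(\<Sum>k\<in>flagged. w k * of_bool (i \<in> lits k)) = 0"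
      using dec(2)[of i] i by (simp add: prob_def lits_def)
    then have "w k * of_bool (i \<in> lits k) = 0"
      using sum_nonneg_eq_0_iff[of flagged "\<lambda>k. w k * of_bool (i \<in> lits k)"] J k
      by (auto simp: flagged_def less_imp_le)
    then show False using J(2)[of k] i k by (simp add: flagged_def)
  qed
  then show ?thesis using dec(4)[OF k] by blast
qed

text \<open>The bound on the rank is tight: the unflagged sets number at least
  \<open>card pairs\<close>, and every literal of cell 0 needs a flagged set of its own. So the wild
  card of cell 0 lies in a single flagged set; by \<open>W < 2 * m\<close> the other wild cards must
  lie there too, and they exhaust their probability in it.\<close>

lemma cut_rank_le_moment_matrix_clique:
  assumes rank: "cut_rank_le (n + 2) (card {i. i < n \<and> cell i
      = 0} + card pairs) (moment_matrix (n + 2) moment)"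
    and a_pos: "\<And>i. i < n \<Longrightarrow> cell i = 0 \<Longrightarrow> 0 < a i" and a_less: "\<And>i. i < n \<Longrightarrow> a i < W"
    and null: "\<And>v. v < N \<Longrightarrow> null v < n \<and> cell (null v) = v \<and> a (null v) = m" and m: "W < 2 * m"
  shows "\<exists>S. clique S \<and> (\<forall>v<N. null v \<notin> S)"
proof -
  obtain J :: "real mat set" and w A where J: "finite J" "\<And>k. k \<in> J \<Longrightarrow> 0 < w k"
    and card_J: "card J \<le> card {i. i < n \<and> cell i = 0} + card pairs" and w_sum: "sum w J = 1"
    and M: "\<And>b c. b < n + 2 \<Longrightarrow> c < n + 2 \<Longrightarrow> moment b c = (\<Sum>k\<in>J. w k * of_bool (b \<in> A k \<and> c \<in> A k))"
    using rank by (rule cut_rank_le_moment_matrixE) (auto simp: moment_def event_def)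
  have J': "\<forall>k\<in>J. 0 < w k"
    and M': "\<forall>b<n + 2. \<forall>c<n + 2. moment b c = (\<Sum>k\<in>J. w k * of_bool (b \<in> A k \<and> c \<in> A k))"
    using J(2) M by blast+
  define lits where "lits k = {i. i < n \<and> i + 2 \<in> A k}" for k
  define F where "F = {k \<in> J. 1 \<in> A k}"
  define G where "G = J - F"
  note dec = decomposition_flagged[OF J(1) J' M', folded lits_def F_def]
  have fin: "finite F" "finite G" using J(1) by (auto simp: F_def G_def)
  have JFG: "J = F \<union> G" "F \<inter> G = {}" by (auto simp: F_def G_def)
  have JFG_sum: "(\<Sum>k\<in>J. f k) = (\<Sum>k\<in>F. f k) + (\<Sum>k\<in>G. f k)" for f :: "_ \<Rightarrow> real"
    unfolding JFG(1) using fin JFG(2) by (rule sum.union_disjoint)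
  define T where "T k = real (card (lits k))" for k
  have T_sum: "T k = (\<Sum>i<n. of_bool (i \<in> lits k))" for k
  proof -
    have "{..<n} \<inter> {i. i \<in> lits k} = lits k" by (auto simp: lits_def)
    then show ?thesis by (simp add: T_def of_bool_def sum.If_cases)
  qed
  have T_F: "T k = N" if "k \<in> F" for k
    unfolding T_sum using clique_sum[OF dec(4)[OF that]] .
  have lit: "(\<Sum>k\<in>J. w k * of_bool (i \<in> lits k \<and> j \<in> lits k)) = moment (i + 2) (j + 2)"
    if "i < n" "j < n" for i j
    using M[of "i + 2" "j + 2"] that by (simp add: lits_def)
  let ?p = "real (card pairs)"
  define E where "E = (2 * ?p - (real N - 2) * N) / D"
  have sum_event: "(\<Sum>i<n. event (i + 2)) = E"
  proof -
    have "(\<Sum>i<n. event (i + 2)) = ((\<Sum>i<n. real (degree i)) - (\<Sum>i<n. prob i) * (real N - 2)) / D"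
      using N_ge by (simp add: event_def of_nat_diff sum_subtractf sum_divide_distrib[symmetric]
          sum_distrib_right)
    then show ?thesis unfolding sum_degree sum_prob E_def by (simp add: mult.commute)
  qed
  have ET: "(\<Sum>k\<in>J. w k * T k) = E"
  proof -
    have "(\<Sum>k\<in>J. w k * T k) = (\<Sum>i<n. \<Sum>k\<in>J. w k * of_bool (i \<in> lits k))"
      unfolding T_sum sum_distrib_left by (rule sum.swap)
    also have "\<dots> = (\<Sum>i<n. event (i + 2))"
      using lit[of i i for i] by (intro sum.cong) (auto simp: moment_def)
    finally show ?thesis using sum_event by simp
  qed
  have ET2: "(\<Sum>k\<in>J. w k * (T k * T k)) = E + 2 * ?p / D"
  proof -
    have "(\<Sum>k\<in>J. w k * (T k * T k)) = (\<Sum>k\<in>J. \<Sum>i<n. \<Sum>j<n. w k * of_bool (i \<in> lits k \<and> j \<in> lits k))"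
      unfolding T_sum sum_product sum_distrib_left by (intro sum.cong) auto
    also have "\<dots> = (\<Sum>i<n. \<Sum>k\<in>J. \<Sum>j<n. w k * of_bool (i \<in> lits k \<and> j \<in> lits k))" by (rule sum.swap)
    also have "\<dots> = (\<Sum>i<n. \<Sum>j<n. \<Sum>k\<in>J. w k * of_bool (i \<in> lits k \<and> j \<in> lits k))"
      by (intro sum.cong refl sum.swap)
    also have "\<dots> = (\<Sum>i<n. \<Sum>j<n. moment (i + 2) (j + 2))"
      by (intro sum.cong refl lit) auto
    also have "\<dots> = (\<Sum>i<n. \<Sum>j<n. (if j = i then event (i + 2) else 0) + of_bool (ok i j) / D)"
      using ok_irrefl by (intro sum.cong refl) (auto simp: moment_def)
    also have "\<dots> = (\<Sum>i<n. event (i + 2) + degree i / D)"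
    proof (intro sum.cong refl)
      fix i assume "i \<in> {..<n}"
      then show "(\<Sum>j<n. (if j = i then event (i + 2) else 0) + of_bool (ok i j) / D)
          = event (i + 2) + degree i / D"
        unfolding sum.distrib degree_sum sum_divide_distrib[symmetric] by simp
    qed
    also have "\<dots> = E + 2 * ?p / D"
      unfolding sum.distrib sum_event sum_divide_distrib[symmetric] sum_degree ..
    finally show ?thesis .
  qed
  have wF: "(\<Sum>k\<in>F. w k) = 1 / D" by (rule dec(3))
  have wFT: "(\<Sum>k\<in>F. w k * T k) = N / D"
    using T_F wF by (simp add: sum_distrib_right[symmetric])
  have wFT2: "(\<Sum>k\<in>F. w k * (T k * T k)) = N * N / D"
    using T_F wF by (simp add: sum_distrib_right[symmetric])
  have D0: "real D \<noteq> 0" using D_pos by simp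
  \<comment> \<open>The mean square of \<open>T - 2 - (N - 2) * flag\<close> vanishes, so unflagged sets have two literals.\<close>
  have "(\<Sum>k\<in>G. w k * ((T k - 2) * (T k - 2)))
      = (\<Sum>k\<in>G. w k * (T k * T k)) - 4 * (\<Sum>k\<in>G. w k * T k) + 4 * (\<Sum>k\<in>G. w k)"
    by (simp add: algebra_simps sum.distrib sum_subtractf sum_distrib_left sum_distrib_right)
  also have "\<dots> = (E + 2 * ?p / D - N * N / D) - 4 * (E - N / D) + 4 * (1 - 1 / D)"
  proof -
    have "(\<Sum>k\<in>G. w k * (T k * T k)) = E + 2 * ?p / D - N * N / D"
      using JFG_sum[of "\<lambda>k. w k * (T k * T k)"] unfolding ET2 wFT2
          by (simp only: add_diff_cancel_left')
    moreover have "(\<Sum>k\<in>G. w k * T k) = E - N / D"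
      using JFG_sum[of "\<lambda>k. w k * T k"] unfolding ET wFT by (simp only: add_diff_cancel_left')
    moreover have "(\<Sum>k\<in>G. w k) = 1 - 1 / D"
      using JFG_sum[of w] unfolding wF w_sum by (simp only: add_diff_cancel_left')
    ultimately show ?thesis by (simp only:)
  qed
  \<comment> \<open>The value of \<open>D\<close> enters here: after clearing denominators the claim
    is \<open>4 * D = 4 + 4 * ?p - 2 * N * (N - 1)\<close>.\<close>
  also have "\<dots> = 0"
    unfolding E_def using D0 by (simp add: field_simps) (simp add: real_D field_simps)
  finally have "(\<Sum>k\<in>G. w k * ((T k - 2) * (T k - 2))) = 0" .
  then have T_G: "T k = 2" if "k \<in> G" for k
    using sum_nonneg_eq_0_iff[of G "\<lambda>k. w k * ((T k - 2) * (T k - 2))"] fin that J(2)[of k] J(2)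
    by (force simp: G_def less_imp_le)
  \<comment> \<open>Flagged sets account for at most \<open>prob i / D < 1 / D\<close> of the joint
    probability of a compatible pair, so each pair lies in some unflagged set. Having just two
    literals, that set determines the pair.\<close>
  have "card pairs \<le> card G"
  proof -
    have "pairs \<subseteq> (\<lambda>k. (Min (lits k), Max (lits k))) ` G"
    proof
      fix p assume "p \<in> pairs"
      then obtain i j where p: "p = (i, j)" "i < j" "i < n" "j < n" "ok i j"
          by (auto simp: pairs_def)
      have "\<exists>k\<in>G. i \<in> lits k \<and> j \<in> lits k"
      proof (rule ccontr)
        assume "\<not> (\<exists>k\<in>G. i \<in> lits k \<and> j \<in> lits k)"
        then have "(\<Sum>k\<in>G. w k * of_bool (i \<in> lits k \<and> j \<in> lits k)) = 0" by (intro sum.neutral) auto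
        then have "moment (i + 2) (j + 2) = (\<Sum>k\<in>F. w k * of_bool (i \<in> lits k \<and> j \<in> lits k))"
          using lit[OF p(3,4)] JFG_sum[of "\<lambda>k. w k * of_bool (i \<in> lits k \<and> j \<in> lits k)"] by simp
        also have "\<dots> \<le> (\<Sum>k\<in>F. w k * of_bool (i \<in> lits k))"
          using J(2) by (intro sum_mono) (auto simp: F_def less_imp_le)
        also have "\<dots> = prob i / D" by (rule dec(2)[OF p(3)])
        also have "prob i < 1" using a_less[OF p(3)] W_pos by (simp add: prob_def)
        then have "prob i / D < 1 / D" using D_pos by (intro divide_strict_right_mono) auto
        also have "\<dots> = moment (i + 2) (j + 2)" using p by (simp add: moment_def)
        finally show False by simp
      qed
      then obtain k where k: "k \<in> G" "i \<in> lits k" "j \<in> lits k" by blast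
      have "card (lits k) = 2" using T_G[OF k(1)] by (simp add: T_def)
      moreover have "finite (lits k)" by (simp add: lits_def)
      ultimately have "{i, j} = lits k" using k(2,3) p(2) by (intro card_subset_eq) auto
      then have "p = (Min (lits k), Max (lits k))" using p
          by (auto simp: min_def max_def simp flip: \<open>{i, j} = lits k\<close>)
      then show "p \<in> (\<lambda>k. (Min (lits k), Max (lits k))) ` G" using k(1) by blast
    qed
    then have "card pairs \<le> card ((\<lambda>k. (Min (lits k), Max (lits k))) ` G)"
      using fin(2) by (intro card_mono) auto
    also have "\<dots> \<le> card G" by (rule card_image_le[OF fin(2)])
    finally show ?thesis .
  qed
  moreover have "card J = card F + card G" unfolding JFG(1) using fin JFG(2)
      by (rule card_Un_disjoint)
  ultimately have card_F: "card F \<le> card {i. i < n \<and> cell i = 0}" using card_J by linarith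
  define val where "val k = (THE i. i \<in> lits k \<and> cell i = 0)" for k
  have val: "i = val k" if "k \<in> F" "i \<in> lits k" "cell i = 0" for k i
    unfolding val_def
  proof (rule the_equality[symmetric])
    fix j assume "j \<in> lits k \<and> cell j = 0"
    then show "j = i"
      using dec(1)[of k j i] ok_cell[of j i] that by (auto simp: F_def)
  qed (use that in simp)
  have hit: "\<exists>k\<in>F. i \<in> lits k" if "i < n" "0 < a i" for i
  proof (rule ccontr)
    assume "\<not> (\<exists>k\<in>F. i \<in> lits k)"
    then have "(\<Sum>k\<in>F. w k * of_bool (i \<in> lits k)) = 0" by (intro sum.neutral) auto
    then show False using dec(2)[OF that(1)] that D_pos W_pos by (simp add: prob_def)
  qed
  \<comment> \<open>\<open>val\<close> maps the flagged sets onto the literals of cell 0; as there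
    are no more flagged sets than such literals, it is injective.\<close>
  have surj: "{i. i < n \<and> cell i = 0} \<subseteq> val ` F"
    using hit a_pos val by fastforce
  have "card {i. i < n \<and> cell i = 0} \<le> card (val ` F)" using fin by (intro card_mono surj) auto
  then have "card (val ` F) = card F" using card_F card_image_le[OF fin(1), of val] by linarith
  then have inj: "inj_on val F" by (rule eq_card_imp_inj_on[OF fin(1)])
  have N0: "0 < N" using N_ge by simp
  have m_pos: "0 < m" using m by simp
  obtain z where z: "z \<in> F" "null 0 \<in> lits z" using hit[of "null 0"] null[OF N0] m_pos by auto
  have others: "null 0 \<notin> lits k" if "k \<in> F" "k \<noteq> z" for k
    using val[OF that(1), of "null 0"] val[OF z(1,2)] null[OF N0] inj that z(1)
        by (auto dest: inj_onD)
  have F_split: "(\<Sum>k\<in>F. f k) = f z + (\<Sum>k\<in>F - {z}. f k)" for f :: "_ \<Rightarrow> real"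
    using fin(1) z(1) by (rule sum.remove)
  have null_sum: "(\<Sum>k\<in>F. w k * of_bool (null v \<in> lits k)) = (m / W) / D" if "v < N" for v
    using dec(2)[of "null v"] null[OF that] by (simp add: prob_def)
  have wz: "w z = (m / W) / D"
  proof -
    have "(\<Sum>k\<in>F - {z}. w k * of_bool (null 0 \<in> lits k)) = 0" using others
        by (intro sum.neutral) auto
    then show ?thesis using null_sum[OF N0] F_split[of "\<lambda>k. w k * of_bool (null 0 \<in> lits k)"] z(2)
        by simp
  qed
  \<comment> \<open>The weight of \<open>z\<close> is that of each wild card and more than half of the flagged weight.\<close>
  have avoid: "null v \<notin> lits k" if v: "v < N" and k: "k \<in> F" "k \<noteq> z" for v k
  proof -
    have pos: "0 \<le> w k * of_bool (null v \<in> lits k)" if "k \<in> F - {z}" for k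
      using that J(2)[of k] by (auto simp: F_def)
    have "null v \<in> lits z"
    proof (rule ccontr)
      assume "null v \<notin> lits z"
      then have "(m / W) / D = (\<Sum>k\<in>F - {z}. w k * of_bool (null v \<in> lits k))"
        using null_sum[OF v] F_split[of "\<lambda>k. w k * of_bool (null v \<in> lits k)"] by simp
      also have "\<dots> \<le> (\<Sum>k\<in>F - {z}. w k)"
        using J(2) by (intro sum_mono) (auto simp: F_def less_imp_le)
      also have "\<dots> = 1 / D - (m / W) / D" using F_split[of w] wF wz by simp
      finally have "2 * real m / W \<le> 1" using D_pos by (simp add: field_simps)
      then show False using m W_pos by (simp add: field_simps)
    qed
    then have "(\<Sum>k\<in>F - {z}. w k * of_bool (null v \<in> lits k)) = 0"
      using null_sum[OF v] F_split[of "\<lambda>k. w k * of_bool (null v \<in> lits k)"] wz by simp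
    then have "w k * of_bool (null v \<in> lits k) = 0"
      using sum_nonneg_eq_0_iff[of "F - {z}" "\<lambda>k. w k * of_bool (null v \<in> lits k)"] fin(1) pos k
          by auto
    then show ?thesis using J(2)[of k] k by (auto simp: F_def)
  qed
  \<comment> \<open>Otherwise the wild cards would carry the whole flagged mass, although
    \<open>m\<close> is less than \<open>W\<close>.\<close>
  have "F \<noteq> {z}"
  proof
    assume "F = {z}"
    then have "(m / W) / D = 1 / D" using wF wz by simp
    then have "m / W = 1" unfolding divide_cancel_right using D0 by blast
    then show False using a_less[of "null 0"] null[OF N0] W_pos by simp
  qed
  then obtain k where "k \<in> F" "k \<noteq> z" using z(1) by blast
  then show ?thesis using dec(4) avoid by blast
qed
end

section \<open>Shift-invariant constraint systems\<close>

text \<open>Values are shifted cyclically to make all values of a cell equally likely. Value \<open>M\<close> of a cell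
  is a wild card, compatible with all values of the other cells.\<close>

locale shift_csp =
  fixes N M kappa :: nat and R :: "nat \<Rightarrow> nat \<Rightarrow> nat \<Rightarrow> nat \<Rightarrow> bool"
  assumes N_ge_3: "3 \<le> N" and M_pos: "0 < M" and kappa: "kappa = 1 \<or> kappa = N"
    and R_sym: "R v v' c c' \<Longrightarrow> R v' v c' c"
    and R_shift: "R v v' c c' \<Longrightarrow> R v v' ((c + r) mod M) ((c' + r) mod M)"
begin

definition num_lits :: nat where "num_lits = N * (M + 1)"
definition cell_of :: "nat \<Rightarrow> nat" where "cell_of i = i div (M + 1)"
definition val_of :: "nat \<Rightarrow> nat" where "val_of i = i mod (M + 1)"
definition lit :: "nat \<Rightarrow> nat \<Rightarrow> nat" where "lit v c = v * (M + 1) + c"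
definition compatible :: "nat \<Rightarrow> nat \<Rightarrow> bool" where
  "compatible i j \<longleftrightarrow> cell_of i \<noteq> cell_of j \<and>
     (val_of i = M \<or> val_of j = M \<or> R (cell_of i) (cell_of j) (val_of i) (val_of j))"
text \<open>A wild card has conditional probability \<open>1 - 1 / kappa\<close>. The choice
  \<open>kappa = 1\<close>, for membership, excludes wild cards; \<open>kappa = N\<close> serves the
  rank problem.\<close>

definition weight :: "nat \<Rightarrow> nat" where
  "weight i = (if val_of i = M then kappa * M - M else 1)"

definition total :: nat where
  "total = kappa * M"

definition solvable :: bool where
  "solvable \<longleftrightarrow> (\<exists>b. (\<forall>v<N. b v < M) \<and> (\<forall>v<N. \<forall>v'<N. v \<noteq> v' \<longrightarrow> R v v' (b v) (b v')))"

lemma cell_lit [simp]: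
  assumes "c \<le> M"
  shows "cell_of (lit v c) = v"
proof -
  have "(v * (M + 1) + c) div (M + 1) = v + c div (M + 1)" by (rule div_mult_self3) simp
  then show ?thesis using assms by (simp only: cell_of_def lit_def) simp
qed

lemma val_lit [simp]:
  assumes "c \<le> M"
  shows "val_of (lit v c) = c"
proof -
  have "(v * (M + 1) + c) mod (M + 1) = c mod (M + 1)" by (rule mod_mult_self3)
  then show ?thesis using assms by (simp only: val_of_def lit_def) simp
qed

lemma lit_cell_val: "lit (cell_of i) (val_of i) = i"
  by (simp only: lit_def cell_of_def val_of_def div_mult_mod_eq)

lemma val_le: "val_of i \<le> M"
  using mod_less_divisor[of "M + 1" i] by (simp add: val_of_def)

lemma cell_less_iff: "cell_of i < N \<longleftrightarrow> i < num_lits"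
  by (simp add: cell_of_def num_lits_def div_less_iff_less_mult)

lemma lit_less: "v < N \<Longrightarrow> c \<le> M \<Longrightarrow> lit v c < num_lits"
  using cell_less_iff[of "lit v c"] by simp

lemma cell_lits:
  assumes "v < N"
  shows "{i. i < num_lits \<and> cell_of i = v} = lit v ` {..M}"
proof (intro equalityI subsetI)
  fix i assume "i \<in> {i. i < num_lits \<and> cell_of i = v}"
  then have "i = lit v (val_of i)" using lit_cell_val[of i] by simp
  moreover have "val_of i \<in> {..M}" by (simp add: val_le)
  ultimately show "i \<in> lit v ` {..M}" by (rule image_eqI)
qed (use assms lit_less in auto)

lemma inj_lit: "inj_on (lit v) {..M}"
  by (auto simp: inj_on_def lit_def)

sublocale literal_system num_lits N total cell_of compatible weight
proof
  show "cell_of i < N" if "i < num_lits" for i using that by (simp add: cell_less_iff)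
  show "compatible j i" if "compatible i j" for i j
    using that R_sym unfolding compatible_def by metis
  show "cell_of i \<noteq> cell_of j" if "compatible i j" for i j using that by (simp add: compatible_def)
  show "0 < total" "2 \<le> N" using kappa N_ge_3 M_pos by (auto simp: total_def)
  show "(\<Sum>i\<in>{i. i < num_lits \<and> cell_of i = v}. weight i) = total" if "v < N" for v
  proof -
    have "(\<Sum>i\<in>{i. i < num_lits \<and> cell_of i = v}. weight i) = (\<Sum>c\<le>M. weight (lit v c))"
      unfolding cell_lits[OF that] by (simp add: sum.reindex[OF inj_lit])
    also have "\<dots> = (\<Sum>c<M. 1) + (kappa * M - M)"
      unfolding lessThan_Suc_atMost[symmetric] sum.lessThan_Suc by (simp add: weight_def)
    also have "\<dots> = total" unfolding total_def using kappa N_ge_3 by auto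
    finally show ?thesis .
  qed
  \<comment> \<open>The wild cards of the other \<open>N - 1\<close> cells are compatible with every
    literal.\<close>
  show "N - 1 \<le> card {j. j < num_lits \<and> compatible i j}" if "i < num_lits" for i
  proof -
    let ?V = "{..<N} - {cell_of i}"
    have "card ?V = N - 1" using that by (subst card_Diff_singleton) (auto simp: cell_less_iff)
    moreover have "card ?V \<le> card {j. j < num_lits \<and> compatible i j}"
    proof (rule card_inj_on_le[where f = "\<lambda>v. lit v M"])
      show "inj_on (\<lambda>v. lit v M) ?V" by (rule inj_on_inverseI[of _ cell_of]) simp
      show "(\<lambda>v. lit v M) ` ?V \<subseteq> {j. j < num_lits \<and> compatible i j}"
        by (auto simp: compatible_def lit_less)
    qed simp
    ultimately show ?thesis by simp
  qed
qed

lemma clique_lits: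
  assumes "\<And>v. v < N \<Longrightarrow> g v \<le> M"
    and "\<And>v v'. v < N \<Longrightarrow> v' < N \<Longrightarrow> v \<noteq> v' \<Longrightarrow> g v = M \<or> g v' = M \<or> R v v' (g v) (g v')"
  shows "clique {i. i < num_lits \<and> val_of i = g (cell_of i)}"
  unfolding clique_def
proof (intro conjI allI impI ballI)
  fix v assume v: "v < N"
  have "{i \<in> {i. i < num_lits \<and> val_of i = g (cell_of i)}. cell_of i = v} = {lit v (g v)}"
  proof (intro equalityI subsetI)
    fix i assume "i \<in> {i \<in> {i. i < num_lits \<and> val_of i = g (cell_of i)}. cell_of i = v}"
    then show "i \<in> {lit v (g v)}" using lit_cell_val[of i] by auto
  qed (use assms(1)[OF v] v lit_less in auto)
  then show "card {i \<in> {i. i < num_lits \<and> val_of i = g (cell_of i)}. cell_of i = v} = 1" by simp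
next
  fix i j assume "i \<in> {i. i < num_lits \<and> val_of i = g (cell_of i)}"
    "j \<in> {i. i < num_lits \<and> val_of i = g (cell_of i)}" "i \<noteq> j"
  moreover from this have "cell_of i \<noteq> cell_of j" using lit_cell_val[of i] lit_cell_val[of j]
      by auto
  ultimately show "compatible i j" using assms(2) by (auto simp: compatible_def cell_less_iff)
qed auto

lemma solvable_if_clique:
  assumes S: "clique S" and no_wild: "\<And>v. v < N \<Longrightarrow> lit v M \<notin> S"
  shows solvable
proof -
  have "\<exists>i. i \<in> S \<and> cell_of i = v" if "v < N" for v
  proof -
    have "card {i \<in> S. cell_of i = v} = 1" using S that by (auto simp: clique_def)
    then show ?thesis by (metis (mono_tags, lifting) card_1_singletonE mem_Collect_eq singletonI)
  qed
  then obtain f where f: "\<And>v. v < N \<Longrightarrow> f v \<in> S \<and> cell_of (f v) = v" by metis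
  have val: "val_of (f v) < M" if "v < N" for v
    using f[OF that] no_wild[OF that] lit_cell_val[of "f v"] val_le[of "f v"]
        by (auto simp: le_less)
  have "R v v' (val_of (f v)) (val_of (f v'))" if "v < N" "v' < N" "v \<noteq> v'" for v v'
  proof -
    have "compatible (f v) (f v')" using S f that unfolding clique_def by metis
    then show ?thesis using val[OF that(1)] val[OF that(2)] f[OF that(1)] f[OF that(2)]
      by (simp add: compatible_def)
  qed
  then show ?thesis unfolding solvable_def using val by (intro exI[of _ "\<lambda>v. val_of (f v)"]) blast
qed

text \<open>The \<open>M\<close> cyclic shifts of a solution share the mass \<open>1 / kappa\<close>
  equally, and each value of a cell occurs in exactly one of them. Index \<open>k = M\<close>
  denotes the clique of all wild cards, which takes the remaining mass.\<close>

lemma cut_rank_le_if_solvable: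
  assumes solvable
  shows "cut_rank_le (num_lits + 2) (M + 1 + card pairs) (moment_matrix (num_lits + 2) moment)"
proof -
  obtain b where b: "\<And>v. v < N \<Longrightarrow> b v < M"
    "\<And>v v'. v < N \<Longrightarrow> v' < N \<Longrightarrow> v \<noteq> v' \<Longrightarrow> R v v' (b v) (b v')"
    using assms unfolding solvable_def by blast
  define g where "g k v = (if k = M then M else (b v + k) mod M)" for k v
  define S where "S k = {i. i < num_lits \<and> val_of i = g k (cell_of i)}" for k
  define u :: "nat \<Rightarrow> real" where "u k = (if k = M then 1 - 1 / kappa else 1 / (kappa * M))" for k
  have kap: "1 \<le> kappa" using kappa N_ge_3 by auto
  have "cut_rank_le (num_lits + 2) (card {..M} + card pairs) (moment_matrix (num_lits + 2) moment)"
  proof (rule cut_rank_le_cliquesI)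
    show "0 \<le> u k" for k using kap by (simp add: u_def)
    show "clique (S k)" for k
      unfolding S_def
    proof (rule clique_lits)
      show "g k v \<le> M" for v using M_pos by (simp add: g_def less_imp_le)
      show "g k v = M \<or> g k v' = M \<or> R v v' (g k v) (g k v')" if "v < N" "v' < N" "v \<noteq> v'" for v v'
        using R_shift[OF b(2)[OF that], of k] by (simp add: g_def)
    qed
    fix i assume i: "i < num_lits"
    have split: "(\<Sum>k\<le>M. u k * of_bool (i \<in> S k))
        = (\<Sum>k<M. of_bool (val_of i = (b (cell_of i) + k) mod M)) / (kappa * M)
        + (1 - 1 / kappa) * of_bool (val_of i = M)"
      unfolding lessThan_Suc_atMost[symmetric] sum.lessThan_Suc sum_divide_distrib
      by (intro arg_cong2[of _ _ _ _ "(+)"] sum.cong) (auto simp: S_def u_def g_def i)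
    show "(\<Sum>k\<le>M. u k * of_bool (i \<in> S k)) = prob i"
    proof (cases "val_of i = M")
      case True
      have "(\<Sum>k<M. of_bool (val_of i = (b (cell_of i) + k) mod M)) = (0 :: real)"
        using M_pos True mod_less_divisor
            by (intro sum.neutral) (metis (full_types) of_bool_eq(1) less_irrefl)
      moreover have "1 - 1 / real kappa = prob i"
        unfolding prob_def unfolding weight_def total_def using True kap M_pos
            by (simp add: of_nat_diff field_simps)
      ultimately show ?thesis unfolding split using True by simp
    next
      case False
      then have c: "val_of i < M" using val_le[of i] by simp
      \<comment> \<open>The only shift that moves the value of the solution in this cell to
        \<open>val_of i\<close>.\<close>
      define q where "q = (val_of i + (M - b (cell_of i))) mod M"
      have bM: "b (cell_of i) < M" using b(1) i by (simp add: cell_less_iff)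
      have "val_of i = (b (cell_of i) + k) mod M \<longleftrightarrow> k = q" if k: "k < M" for k
      proof
        assume "val_of i = (b (cell_of i) + k) mod M"
        then have "q = ((b (cell_of i) + k) mod M + (M - b (cell_of i))) mod M" by (simp add: q_def)
        also have "\<dots> = ((b (cell_of i) + k) + (M - b (cell_of i))) mod M" by (rule mod_add_left_eq)
        also have "(b (cell_of i) + k) + (M - b (cell_of i)) = k + M" using bM by simp
        finally show "k = q" using k by simp
      next
        assume "k = q"
        then have "(b (cell_of i) + k) mod M
            = (b (cell_of i) + (val_of i + (M - b (cell_of i)))) mod M"
          unfolding q_def by (simp only: mod_add_right_eq)
        also have "b (cell_of i) + (val_of i + (M - b (cell_of i))) = val_of i + M" using bM by simp
        finally show "val_of i = (b (cell_of i) + k) mod M" using c by simp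
      qed
      then have "(\<Sum>k<M. of_bool (val_of i = (b (cell_of i) + k) mod M))
          = (\<Sum>k<M. if k = q then 1 else 0 :: real)"
        by (intro sum.cong) auto
      also have "\<dots> = 1" using M_pos by (simp add: q_def)
      finally show ?thesis unfolding split prob_def unfolding weight_def total_def using False
          by simp
    qed
  qed simp
  then show ?thesis by simp
qed

text \<open>One ordinary value in one cell and wild cards elsewhere always form a clique. Of these
  \<open>N * M\<close> cliques, taken with equal weights, one contains a given value and
  \<open>N * M - M\<close> contain a given wild card.\<close>

lemma moment_matrix_in_CUT:
  assumes k: "kappa = N"
  shows "moment_matrix (num_lits + 2) moment \<in> CUT (num_lits + 2)"
proof -
  define g where "g = (\<lambda>(w, c) v :: nat. if v = w then c else M)"
  define S where "S k = {i. i < num_lits \<and> val_of i = g k (cell_of i)}" for k :: "nat \<times> nat"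
  have "cut_rank_le (num_lits + 2) (card ({..<N} \<times> {..<M}) + card pairs) (moment_matrix (num_lits
      + 2) moment)"
  proof (rule cut_rank_le_cliquesI[where u = "\<lambda>_. 1 / (N * M)"])
    show "clique (S k)" if "k \<in> {..<N} \<times> {..<M}" for k
      unfolding S_def using that by (intro clique_lits) (auto simp: g_def)
    fix i assume i: "i < num_lits"
    have "(\<Sum>k\<in>{..<N} \<times> {..<M}. 1 / real (N * M) * of_bool (i \<in> S k))
        = (\<Sum>w<N. \<Sum>c<M. of_bool (val_of i = (if cell_of i = w then c else M))) / real (N * M)"
      unfolding sum.cartesian_product sum_divide_distrib
      by (intro sum.cong) (auto simp: S_def g_def i)
    also have "(\<Sum>w<N. \<Sum>c<M. of_bool (val_of i = (if cell_of i = w then c else M)))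
        = real (weight i)"
    proof (cases "val_of i = M")
      case True
      have "(\<Sum>w<N. \<Sum>c<M. of_bool (val_of i = (if cell_of i = w then c else M)))
          = (\<Sum>w<N. real M - (if w = cell_of i then real M else 0))"
        using True by (intro sum.cong) auto
      also have "\<dots> = real (N * M) - real M" using i by (simp add: sum_subtractf cell_less_iff)
      also have "\<dots> = real (weight i)"
        unfolding weight_def using True N_ge_3 k by (simp add: of_nat_diff)
      finally show ?thesis .
    next
      case False
      have "(\<Sum>w<N. \<Sum>c<M. of_bool (val_of i = (if cell_of i = w then c else M)))
          = (\<Sum>w<N. if w = cell_of i then (\<Sum>c<M. if c = val_of i then 1 else 0) else (0 :: real))"
        using False by (intro sum.cong) auto
      also have "\<dots> = 1" using i False val_le[of i] by (simp add: cell_less_iff)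
      finally show ?thesis using False by (simp add: weight_def)
    qed
    finally show "(\<Sum>k\<in>{..<N} \<times> {..<M}. 1 / real (N * M) * of_bool (i \<in> S k)) = prob i"
      unfolding prob_def unfolding total_def by (simp only: k)
  qed auto
  then show ?thesis using CUT_iff by blast
qed

theorem moment_matrix_in_CUT_iff:
  assumes "kappa = 1"
  shows "moment_matrix (num_lits + 2) moment \<in> CUT (num_lits + 2) \<longleftrightarrow> solvable"
proof
  assume "moment_matrix (num_lits + 2) moment \<in> CUT (num_lits + 2)"
  then obtain S where S: "clique S" "\<forall>i\<in>S. 0 < weight i" using CUT_moment_matrix_clique by blast
  show solvable
  proof (rule solvable_if_clique[OF S(1)])
    fix v
    have "weight (lit v M) = 0" unfolding weight_def using assms by simp
    then show "lit v M \<notin> S" using S(2) by auto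
  qed
next
  assume solvable
  then show "moment_matrix (num_lits + 2) moment \<in> CUT (num_lits + 2)"
    using cut_rank_le_if_solvable CUT_iff by blast
qed

text \<open>Cell 0 has \<open>M + 1\<close> literals, as many as the flagged sets obtained from a
  solution. With at least three cells, \<open>total - M\<close> is more than half of
  \<open>total\<close>.\<close>

theorem cut_rank_le_moment_matrix_iff:
  assumes k: "kappa = N"
  shows "cut_rank_le (num_lits + 2) (M + 1 + card pairs) (moment_matrix (num_lits + 2) moment) \<longleftrightarrow>
      solvable"
proof
  assume rank: "cut_rank_le (num_lits + 2) (M + 1 + card pairs) (moment_matrix (num_lits
      + 2) moment)"
  have M2: "2 * M < N * M" "M < N * M" using N_ge_3 M_pos by auto
  then have M1: "1 < N * M" using M_pos by linarith
  have t: "total - M < total" "1 < total"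
    unfolding total_def unfolding k using M1 M2 M_pos by linarith+
  have "\<exists>S. clique S \<and> (\<forall>v<N. lit v M \<notin> S)"
  proof (rule cut_rank_le_moment_matrix_clique)
    have "card {i. i < num_lits \<and> cell_of i = 0} = M + 1"
      using N_ge_3 by (subst cell_lits) (auto simp: card_image[OF inj_lit])
    then show "cut_rank_le (num_lits + 2) (card {i. i < num_lits \<and> cell_of i = 0} + card pairs)
        (moment_matrix (num_lits + 2) moment)"
      using rank by simp
    show "0 < weight i" for i unfolding weight_def using M2 k by simp
    show "weight i < total" for i
      unfolding weight_def total_def[symmetric] using t by simp
    show "lit v M < num_lits \<and> cell_of (lit v M) = v \<and> weight (lit v M) = total - M" if "v < N"
        for v
      using that lit_less unfolding weight_def total_def by simp
    show "total < 2 * (total - M)" unfolding total_def unfolding k using M2 by linarith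
  qed
  then show solvable using solvable_if_clique by blast
qed (rule cut_rank_le_if_solvable)


subsection \<open>The matrix as rational data\<close>

text \<open>Numerators over the common denominator \<open>D * total\<close>, which brings all matrix
  entries into the form handled by \<open>encode_rat_diff\<close>.\<close>

definition event_num :: "nat \<Rightarrow> nat" where
  "event_num b = (if b = 0 then D * total else if b = 1 then total
     else degree (b - 2) * total - weight (b - 2) * (N - 2))"

definition moment_num :: "nat \<Rightarrow> nat \<Rightarrow> nat" where
  "moment_num b c =
     (if b = c then event_num b else if b = 0 then event_num c else if c = 0 then event_num b
      else if b = 1 then weight (c - 2) else if c = 1 then weight (b - 2)
      else if compatible (b - 2) (c - 2) then total else 0)"

definition Gamma :: "rat mat" where
  "Gamma = mat (num_lits + 2) (num_lits + 2) (\<lambda>(b, c).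
     (of_nat (D * total + 4 * moment_num b c) - of_nat (2 * event_num b + 2 * event_num c))
       / of_nat (D * total))"

definition num_pairs :: nat where
  "num_pairs = card pairs"

lemma num_pairs_eq:
  "num_pairs = (\<Sum>i<num_lits. \<Sum>j<num_lits. of_bool (i < j \<and> compatible i j))"
proof -
  have "pairs = {p \<in> {..<num_lits} \<times> {..<num_lits}. fst p < snd p \<and> compatible (fst p) (snd p)}"
    by (auto simp: pairs_def)
  then have "num_pairs = (\<Sum>p\<in>{..<num_lits} \<times> {..<num_lits}. of_bool (fst p < snd p
      \<and> compatible (fst p) (snd p)))"
    by (simp add: num_pairs_def of_bool_def sum.If_cases Int_def)
  then show ?thesis unfolding sum.cartesian_product case_prod_unfold .
qed

lemma degree_eq: "degree i = (\<Sum>j<num_lits. of_bool (compatible i j))"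
proof -
  have "{..<num_lits} \<inter> {j. compatible i j} = {j. j < num_lits \<and> compatible i j}" by auto
  then show ?thesis by (simp add: degree_def of_bool_def sum.If_cases)
qed

lemma event_eq:
  assumes "b < num_lits + 2"
  shows "event b = real (event_num b) / real (D * total)"
proof -
  have D0: "real D \<noteq> 0" "real total \<noteq> 0" using D_pos W_pos by linarith+
  consider "b = 0" | "b = 1" | "2 \<le> b" by linarith
  then show ?thesis
  proof cases
    case 3
    let ?i = "b - 2"
    have i: "?i < num_lits" using assms 3 by simp
    \<comment> \<open>This makes the truncated subtraction in \<open>event_num\<close>
      exact.\<close>
    have "weight ?i * (N - 2) \<le> degree ?i * total"
      using mult_le_mono[OF a_le[OF i], of "N - 2" "degree ?i"] degree_ge[OF i]
      by (simp add: degree_def mult.commute)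
    then have "real (event_num b) = degree ?i * real total - real (weight ?i) * (real N - 2)"
      using 3 N_ge by (simp add: event_num_def of_nat_diff del: of_nat_mult) (simp add: of_nat_diff)
    then have "real (event_num b) / real total = degree ?i - prob ?i * (real N - 2)"
      using D0(2) by (simp only: prob_def diff_divide_distrib nonzero_mult_div_cancel_right
          times_divide_eq_left not_False_eq_True)
    moreover have "event b = (degree ?i - prob ?i * (real N - 2)) / D"
      using 3 N_ge by (simp add: event_def of_nat_diff)
    ultimately have "event b = real (event_num b) / real total / real D" by (simp only:)
    then show ?thesis by (simp add: mult.commute)
  qed (use D0 in \<open>auto simp: event_def event_num_def\<close>)
qed

lemma moment_eq:
  assumes "b < num_lits + 2" "c < num_lits + 2"
  shows "moment b c = real (moment_num b c) / real (D * total)"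
proof -
  have D0: "real total \<noteq> 0" using W_pos by linarith
  have "prob i / D = real (weight i) / real (D * total)" for i
    by (simp add: prob_def mult.commute)
  moreover have "of_bool P / D = real (if P then total else 0) / real (D * total)" for P
    using D0 by auto
  ultimately show ?thesis
    using event_eq assms by (simp add: moment_def moment_num_def)
qed

lemma map_Gamma: "map_mat of_rat Gamma = moment_matrix (num_lits + 2) moment"
proof (rule eq_matI)
  fix b c assume "b < dim_row (moment_matrix (num_lits + 2) moment)" "c
      < dim_col (moment_matrix (num_lits + 2) moment)"
  then have bc: "b < num_lits + 2" "c < num_lits + 2" by (auto simp: moment_matrix_def)
  define C where "C = real (D * total)"
  have C: "C \<noteq> 0" using D_pos W_pos unfolding C_def by (metis mult_is_0 not_gr0 of_nat_0_eq_iff)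
  have m: "moment x x = event x" for x by (simp add: moment_def)
  have "map_mat of_rat Gamma $$ (b, c)
      = (C + 4 * real (moment_num b c) - (2 * real (event_num b) + 2 * real (event_num c))) / C"
    using bc unfolding C_def by (simp add: Gamma_def of_rat_divide of_rat_diff of_rat_add
        of_rat_mult del: of_nat_mult)
  also have "\<dots> = 1 + 4 * (real (moment_num b c) / C) - 2 * (real (event_num b) / C)
      - 2 * (real (event_num c) / C)"
    using C by (simp add: field_simps)
  also have "\<dots> = moment_matrix (num_lits + 2) moment $$ (b, c)"
    unfolding C_def moment_eq[OF bc, symmetric] event_eq[OF bc(1), symmetric] event_eq[OF bc(2),
        symmetric]
    using bc by (simp add: moment_matrix_def m)
  finally show "map_mat of_rat Gamma $$ (b, c) = moment_matrix (num_lits + 2) moment $$ (b, c)" .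
qed (auto simp: Gamma_def moment_matrix_def)

lemma symmetric_Gamma: "symmetric_rat_mat (num_lits + 2) Gamma"
proof -
  have "moment_num b c = moment_num c b" for b c
    using ok_sym[of "b - 2" "c - 2"] ok_sym[of "c - 2" "b - 2"] by (auto simp: moment_num_def)
  then have "transpose_mat Gamma = Gamma"
    by (intro eq_matI) (auto simp: Gamma_def add.commute)
  then show ?thesis by (simp add: symmetric_rat_mat_def Gamma_def)
qed
end

section \<open>Making constraint systems shift-invariant\<close>

text \<open>The numbers \<open>sidon m c\<close> for \<open>c < m\<close> form a Sidon set modulo \<open>8 * m ^ 3\<close>, so that two distinct
  values are determined by the difference of their images.\<close>

definition sidon :: "nat \<Rightarrow> nat \<Rightarrow> nat" where
  "sidon m c = 2 * m * m * c + c * c"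

text \<open>The difference \<open>a - a'\<close> equals \<open>sidon m c - sidon m c'\<close> modulo
  \<open>8 * m ^ 3\<close> for some admissible pair, written with sums to stay within natural
  numbers. Only the difference of \<open>a\<close> and \<open>a'\<close> matters, whence shift
  invariance.\<close>

definition shift_rel ::
    "nat \<Rightarrow> (nat \<Rightarrow> nat \<Rightarrow> nat \<Rightarrow> nat \<Rightarrow> bool) \<Rightarrow> nat \<Rightarrow> nat \<Rightarrow> nat \<Rightarrow> nat \<Rightarrow> bool" where
  "shift_rel m R v v' a a' \<longleftrightarrow>
     (\<exists>c<m. \<exists>c'<m. R v v' c c' \<and> (a + sidon m c') mod (8 * m ^ 3) = (a' + sidon m c) mod (8 * m ^
         3))"

text \<open>Sums of two such numbers stay below the modulus \<open>8 * m ^ 3\<close>, so congruent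
  sums are equal.\<close>

lemma sidon_less:
  assumes "c < m"
  shows "sidon m c < 3 * m ^ 3"
proof -
  have "c * c \<le> m * m" using assms by (intro mult_le_mono) auto
  also have "m * m \<le> m * m * (m - c)" using assms by simp
  also have "\<dots> \<le> 3 * m * m * (m - c)" by simp
  finally have "sidon m c \<le> 2 * m * m * c + m * m * (m - c)" using assms
    by (simp add: sidon_def) (metis \<open>c * c \<le> m * m\<close> \<open>m * m \<le> m * m * (m - c)\<close> order.trans)
  also have "\<dots> < 3 * m ^ 3"
  proof -
    have "m * m * (m - c) + m * m * c = m ^ 3" using assms
      by (simp add: power3_eq_cube diff_mult_distrib2 add.commute)
    moreover have "m * m * c < m * m * m" using assms by simp
    moreover have "m * m * m = m ^ 3" by (simp add: power3_eq_cube)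
    moreover have "0 < m ^ 3" using assms by simp
    moreover have "2 * m * m * c = m * m * c + m * m * c" by simp
    ultimately show ?thesis by linarith
  qed
  finally show ?thesis .
qed

lemma mod_add_left_cancel:
  assumes "(a + b) mod k = (a + c) mod (k :: nat)"
  shows "b mod k = c mod k"
proof -
  have "int (a + b) mod int k = int (a + c) mod int k" using assms by (metis zmod_int)
  then have "int k dvd int b - int c" by (simp add: mod_eq_dvd_iff)
  then have "int b mod int k = int c mod int k" by (simp add: mod_eq_dvd_iff)
  then show ?thesis by (metis zmod_int of_nat_eq_iff)
qed

text \<open>The sums of squares on the two sides differ by less than \<open>2 * m * m\<close>, the
  coefficient of the linear part. So the sums and the sums of squares agree separately, which
  determines the two summands up to order; \<open>c \<noteq> c'\<close> excludes the other
  order.\<close>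

lemma sidon_unique:
  assumes less: "x < m" "y < m" "c < m" "c' < m"
    and eq: "sidon m x + sidon m c' = sidon m y + sidon m c" and "c \<noteq> c'"
  shows "x = c \<and> y = c'"
proof -
  define X Y C C' where "X = int x" "Y = int y" "C = int c" "C' = int c'"
  let ?m = "int m"
  have eq': "2 * (?m * ?m) * (X + C' - (Y + C)) = (Y * Y + C * C) - (X * X + C' * C')"
    using arg_cong[OF eq, of int] unfolding X_Y_C_C'_def by (simp add: sidon_def algebra_simps)
  have sq: "0 \<le> Z * Z \<and> Z * Z < ?m * ?m" if "0 \<le> Z" "Z < ?m" for Z
    using that by (auto intro: mult_strict_mono')
  have "0 \<le> X * X \<and> X * X < ?m * ?m" "0 \<le> Y * Y \<and> Y * Y < ?m * ?m"
    "0 \<le> C * C \<and> C * C < ?m * ?m" "0 \<le> C' * C' \<and> C' * C' < ?m * ?m"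
    using less unfolding X_Y_C_C'_def by (intro sq; simp)+
  then have bound: "\<bar>2 * (?m * ?m) * (X + C' - (Y + C))\<bar> < 2 * (?m * ?m)" unfolding eq' by linarith
  have sum: "X + C' - (Y + C) = 0"
  proof (rule ccontr)
    assume "X + C' - (Y + C) \<noteq> 0"
    then have "1 \<le> \<bar>X + C' - (Y + C)\<bar>" by linarith
    then have "2 * (?m * ?m) * 1 \<le> 2 * (?m * ?m) * \<bar>X + C' - (Y + C)\<bar>"
        by (intro mult_left_mono) auto
    then show False using bound by (simp add: abs_mult)
  qed
  then have "Y * Y + C * C = X * X + C' * C'" using eq' by simp
  then have "(X - C) * (X + C) = (Y - C') * (Y + C')" by (simp add: algebra_simps)
  moreover have d: "X - C = Y - C'" using sum by linarith
  ultimately have "X - C = 0 \<or> X + C = Y + C'" by auto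
  moreover have "C \<noteq> C'" using \<open>c \<noteq> c'\<close> by (simp add: X_Y_C_C'_def)
  ultimately have "X = C \<and> Y = C'" using d by auto
  then show ?thesis by (simp add: X_Y_C_C'_def)
qed

lemma shift_rel_sym:
  assumes "\<And>v v' c c'. R v v' c c' \<Longrightarrow> R v' v c' c" and "shift_rel m R v v' a a'"
  shows "shift_rel m R v' v a' a"
  using assms unfolding shift_rel_def by metis

lemma shift_rel_shift:
  assumes "shift_rel m R v v' a a'"
  shows "shift_rel m R v v' ((a + r) mod (8 * m ^ 3)) ((a' + r) mod (8 * m ^ 3))"
proof -
  let ?M = "8 * m ^ 3"
  obtain c c' where c: "c < m" "c' < m" "R v v' c c'" "(a + sidon m c') mod ?M
      = (a' + sidon m c) mod ?M"
    using assms unfolding shift_rel_def by blast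
  have "((a + r) mod ?M + sidon m c') mod ?M = ((a + r) + sidon m c') mod ?M"
      by (rule mod_add_left_eq)
  also have "\<dots> = ((a + sidon m c') + r) mod ?M" by (simp only: ac_simps)
  also have "\<dots> = ((a' + sidon m c) + r) mod ?M" using c(4) by (rule mod_add_cong) simp
  also have "\<dots> = ((a' + r) + sidon m c) mod ?M" by (simp only: ac_simps)
  also have "\<dots> = ((a' + r) mod ?M + sidon m c) mod ?M" by (rule mod_add_left_eq[symmetric])
  finally show ?thesis unfolding shift_rel_def using c(1-3) by blast
qed

text \<open>Cell 0 only admits the value 0, with \<open>sidon m 0 = 0\<close>, so its shifted value
  is the common shift, and the relations to cell 0 make every other cell this shift plus the image
  of a value. Distinctness is required because difference 0 does not determine a pair.\<close>

lemma shift_rel_solvable_iff: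
  assumes m: "0 < m" and ref: "\<And>v c c'. R 0 v c c' \<Longrightarrow> c = 0"
    and neq: "\<And>v v' c c'. R v v' c c' \<Longrightarrow> v \<noteq> v' \<Longrightarrow> c \<noteq> c'"
  shows "(\<exists>b. (\<forall>v<N. b v < 8 * m ^ 3) \<and> (\<forall>v<N. \<forall>v'<N. v \<noteq> v' \<longrightarrow> shift_rel m R v v' (b v) (b v')))
    \<longleftrightarrow> (\<exists>g. (\<forall>v<N. g v < m) \<and> (\<forall>v<N. \<forall>v'<N. v \<noteq> v' \<longrightarrow> R v v' (g v) (g v')))"
    (is "?L \<longleftrightarrow> ?R")
proof
  let ?M = "8 * m ^ 3"
  assume ?L
  then obtain b where b: "\<And>v. v < N \<Longrightarrow> b v < ?M"
    and rel: "\<And>v v'. v < N \<Longrightarrow> v' < N \<Longrightarrow> v \<noteq> v' \<Longrightarrow> shift_rel m R v v' (b v) (b v')" by blast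
  have "\<exists>c<m. b v mod ?M = (b 0 + sidon m c) mod ?M" if v: "v < N" for v
  proof (cases "v = 0")
    case True
    then show ?thesis using m by (intro exI[of _ 0]) (simp add: sidon_def)
  next
    case False
    then obtain c c' where c: "c < m" "c' < m" "R 0 v c c'" "(b 0 + sidon m c') mod ?M
        = (b v + sidon m c) mod ?M"
      using rel[of 0 v] v unfolding shift_rel_def by force
    then show ?thesis using ref[OF c(3)] by (intro exI[of _ c']) (simp add: sidon_def)
  qed
  then obtain g where g: "\<And>v. v < N \<Longrightarrow> g v < m \<and> b v mod ?M = (b 0 + sidon m (g v)) mod ?M" by metis
  have "R v v' (g v) (g v')" if v: "v < N" "v' < N" "v \<noteq> v'" for v v'
  proof -
    obtain c c' where c: "c < m" "c' < m" "R v v' c c'"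
        and e: "(b v + sidon m c') mod ?M = (b v' + sidon m c) mod ?M"
      using rel[OF v] unfolding shift_rel_def by blast
    have "(b 0 + sidon m (g v) + sidon m c') mod ?M = (b v + sidon m c') mod ?M"
      using g[OF v(1)] by (intro mod_add_cong) auto
    also have "\<dots> = (b 0 + sidon m (g v') + sidon m c) mod ?M"
      unfolding e using g[OF v(2)] by (intro mod_add_cong) auto
    finally have "(sidon m (g v) + sidon m c') mod ?M = (sidon m (g v') + sidon m c) mod ?M"
      unfolding add.assoc by (rule mod_add_left_cancel)
    moreover have "sidon m (g v) + sidon m c' < ?M" "sidon m (g v') + sidon m c < ?M"
      using sidon_less[of "g v" m] sidon_less[of "g v'" m] sidon_less[OF c(1)] sidon_less[OF c(2)]
          g[OF v(1)] g[OF v(2)]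
      by linarith+
    ultimately have "sidon m (g v) + sidon m c' = sidon m (g v') + sidon m c" by simp
    then have "g v = c \<and> g v' = c'"
      using sidon_unique g[OF v(1)] g[OF v(2)] c neq[OF c(3) v(3)] by blast
    then show ?thesis using c(3) by simp
  qed
  then show ?R using g by blast
next
  let ?M = "8 * m ^ 3"
  assume ?R
  then obtain g where g: "\<And>v. v < N \<Longrightarrow> g v < m"
    "\<And>v v'. v < N \<Longrightarrow> v' < N \<Longrightarrow> v \<noteq> v' \<Longrightarrow> R v v' (g v) (g v')" by blast
  have "sidon m (g v) < ?M" if "v < N" for v using sidon_less[OF g(1)[OF that]] by linarith
  moreover have "shift_rel m R v v' (sidon m (g v)) (sidon m (g v'))" if "v < N" "v' < N" "v \<noteq> v'"
      for v v'
    unfolding shift_rel_def using g(1)[OF that(1)] g(1)[OF that(2)] g(2)[OF that]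
        by (metis add.commute)
  ultimately show ?L by (intro exI[of _ "\<lambda>v. sidon m (g v)"]) blast
qed

section \<open>Digits\<close>

definition digit :: "nat \<Rightarrow> nat \<Rightarrow> nat \<Rightarrow> nat" where
  "digit B c j = c div B ^ j mod B"

lemma ex_digits:
  assumes "\<And>j. j < r \<Longrightarrow> f j < B"
  shows "\<exists>c<B ^ r. \<forall>j<r. digit B c j = f j"
  using assms
proof (induction r)
  case (Suc r)
  then obtain c where c: "c < B ^ r" "\<forall>j<r. digit B c j = f j" by auto
  have B: "0 < B" using Suc.prems[of r] by auto
  let ?c = "c + f r * B ^ r"
  have "?c < B ^ r + f r * B ^ r" using c(1) by simp
  also have "\<dots> \<le> B * B ^ r" using mult_le_mono1[of "Suc (f r)" B "B ^ r"] Suc.prems[of r] by simp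
  finally have "?c < B ^ Suc r" by simp
  moreover have "digit B ?c j = f j" if "j < Suc r" for j
  proof (cases "j = r")
    case True
    then show ?thesis using c(1) B Suc.prems[of r] by (simp add: digit_def)
  next
    case False
    then have j: "j < r" using that by simp
    then have "B ^ r = B ^ j * (B * B ^ (r - j - 1))"
      by (metis Suc_diff_Suc diff_Suc_eq_diff_pred less_imp_add_positive mult.assoc power_Suc
          power_add Suc_leI add_diff_cancel_left' diff_commute le_add_diff_inverse less_imp_le_nat
          power_Suc2 mult.commute)
    then have "?c div B ^ j = c div B ^ j + f r * (B * B ^ (r - j - 1))"
      using B by (simp add: div_mult_self2 mult.left_commute[of "f r"])
    then have "digit B ?c j = digit B c j"
      unfolding digit_def by (simp add: mult.left_commute[of "f r"])
    then show ?thesis using c(2) j by simp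
  qed
  ultimately show ?case by blast
qed simp

section \<open>Computations as constraint systems\<close>

text \<open>Allows a tape cell to be read off from the history of head positions and writes, so that
  contents need not be recorded.\<close>

lemma contents_after_last_visit:
  assumes "\<And>v. 1 \<le> v \<Longrightarrow> v < u \<Longrightarrow> C (Suc v) = (C v)(pos v := wr v)"
    and "1 \<le> t" "t < u" "pos t = z" "\<And>v. t < v \<Longrightarrow> v < u \<Longrightarrow> pos v \<noteq> z"
  shows "C u z = wr t"
proof -
  have "C (Suc v) z = wr t" if "t \<le> v" "v < u" for v
    using that
  proof (induction rule: dec_induct)
    case base
    then show ?case using assms by simp
  next
    case (step v)
    then show ?case using assms(1)[of "Suc v"] assms(2) assms(5)[of "Suc v"] by simp
  qed
  from this[of "u - 1"] show ?thesis using assms(3) by simp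
qed

lemma contents_unvisited:
  assumes "\<And>v. 1 \<le> v \<Longrightarrow> v < u \<Longrightarrow> C (Suc v) = (C v)(pos v := wr v)"
    and "1 \<le> u" "\<And>v. 1 \<le> v \<Longrightarrow> v < u \<Longrightarrow> pos v \<noteq> z"
  shows "C u z = C 1 z"
  using assms(2,1,3)
proof (induction u rule: dec_induct)
  case (step v)
  have "C v z = C 1 z" by (rule step.IH) (use step.prems in auto)
  then show ?case using step.prems(1)[of v] step.prems(2)[of v] step.hyps by simp
qed simp

definition move_code :: "move \<Rightarrow> nat" where
  "move_code m = (case m of Move_Left \<Rightarrow> 0 | Stay \<Rightarrow> 1 | Move_Right \<Rightarrow> 2)"

lemma move_head_code: "move_head m h = h + int (move_code m) - 1"
  by (cases m) (auto simp: move_code_def)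

locale verifier =
  fixes V :: tm
  assumes wf: "wf_tm V" and tapes_ge: "2 \<le> tm_tapes V"
begin

abbreviation K :: nat where "K \<equiv> tm_tapes V"

text \<open>State and scanned symbols only: a finite set independent of the input, so the transition
  function restricted to it is a fixed table.\<close>

definition situations :: "(nat \<times> nat list) set" where
  "situations = {(q, ss). q < tm_states V \<and> length ss = K \<and> set ss \<subseteq> {..<tm_symbols V}}"

lemma finite_situations: "finite situations"
proof -
  have "situations \<subseteq> {..<tm_states V} \<times> {ss. set ss \<subseteq> {..<tm_symbols V} \<and> length ss = K}"
    by (auto simp: situations_def)
  then show ?thesis by (rule finite_subset) (intro finite_cartesian_product finite_lists_length_eq
      finite_lessThan)
qed

definition num_sit :: nat where "num_sit = card situations"

text \<open>Outside its domain the enumeration is constant, which makes it a finite table.\<close>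

definition sit :: "nat \<Rightarrow> nat \<times> nat list" where
  "sit = (SOME f. bij_betw f {0..<num_sit} situations \<and> (\<forall>e\<ge>num_sit. f e = f num_sit))"

lemma sit_props: "bij_betw sit {0..<num_sit} situations \<and> (\<forall>e\<ge>num_sit. sit e = sit num_sit)"
proof -
  obtain f where f: "bij_betw f {0..<num_sit} situations"
    using ex_bij_betw_nat_finite[OF finite_situations] unfolding num_sit_def by blast
  define g where "g e = (if e < num_sit then f e else f num_sit)" for e
  define P where "P f \<longleftrightarrow> bij_betw f {0..<num_sit} situations \<and> (\<forall>e\<ge>num_sit. f e = f num_sit)" for f
  have "bij_betw g {0..<num_sit} situations"
    by (rule iffD2[OF bij_betw_cong f]) (simp add: g_def)
  then have "P g" unfolding P_def by (simp add: g_def)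
  then have "P (SOME f. P f)" by (rule someI[of P g])
  then show ?thesis unfolding sit_def P_def .
qed

lemmas bij_sit = conjunct1[OF sit_props]

text \<open>In halting states this changes nothing, in agreement with \<open>tm_step\<close>; so
  runs can be described over a fixed number of steps.\<close>

definition act :: "nat \<times> nat list \<Rightarrow> nat \<times> (nat \<times> move) list" where
  "act s = (if fst s = tm_accept V \<or> fst s = tm_reject V then (fst s, keep (snd s))
     else tm_delta V (fst s) (snd s))"

definition st :: "nat \<Rightarrow> nat" where "st e = fst (sit e)"
definition sy :: "nat \<Rightarrow> nat \<Rightarrow> nat" where "sy i e = snd (sit e) ! i"
definition nx :: "nat \<Rightarrow> nat" where "nx e = fst (act (sit e))"
definition wr :: "nat \<Rightarrow> nat \<Rightarrow> nat" where "wr i e = fst (snd (act (sit e)) ! i)"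
definition mv :: "nat \<Rightarrow> nat \<Rightarrow> nat" where "mv i e = move_code (snd (snd (act (sit e)) ! i))"

lemma step_act:
  "tm_step V (q, ts) = (fst (act (q, map read_tape ts)), map2 act_tape
      (snd (act (q, map read_tape ts))) ts)"
  by (simp add: tm_step_def act_def halted_def map2_keep split: prod.splits)

lemma act_wf:
  assumes "s \<in> situations"
  shows "fst (act s) < tm_states V" "length (snd (act s)) = K" "i < K \<Longrightarrow>
      fst (snd (act s) ! i) < tm_symbols V"
proof -
  obtain q ss where s: "s = (q, ss)" "q < tm_states V" "length ss = K" "set ss \<subseteq> {..<tm_symbols V}"
    using assms by (auto simp: situations_def)
  have *: "fst (act s) < tm_states V \<and> length (snd (act s)) = K
      \<and> fst ` set (snd (act s)) \<subseteq> {..<tm_symbols V}"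
  proof (cases "q = tm_accept V \<or> q = tm_reject V")
    case True
    then show ?thesis using s by (auto simp: act_def keep_def)
  next
    case False
    have "\<forall>q ss. q < tm_states V \<and> length ss = K \<and> set ss \<subseteq> {..<tm_symbols V} \<longrightarrow>
        (case tm_delta V q ss of (q', as) \<Rightarrow>
          q' < tm_states V \<and> length as = K \<and> fst ` set as \<subseteq> {..<tm_symbols V})"
      using wf unfolding wf_tm_def by (elim conjE)
    from this[rule_format, of q ss] s(2-4)
    have "case tm_delta V q ss of (q', as) \<Rightarrow>
        q' < tm_states V \<and> length as = K \<and> fst ` set as \<subseteq> {..<tm_symbols V}"
      by simp
    then show ?thesis using s(1) False by (simp add: act_def case_prod_unfold)
  qed
  then show "fst (act s) < tm_states V" "length (snd (act s)) = K" by auto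
  show "fst (snd (act s) ! i) < tm_symbols V" if "i < K"
    using * that by (metis imageI lessThan_iff nth_mem subsetD)
qed

lemma sit_mem: "e < num_sit \<Longrightarrow> sit e \<in> situations"
  using bij_sit by (auto simp: bij_betw_def)

text \<open>At step \<open>v\<close> (counted from 1) the machine is in situation \<open>e\<close>, with the head of tape \<open>i\<close> at
  position \<open>h i - T\<close>; \<open>l i\<close> is the previous step at which the head was there, or 0 if there
  is none.\<close>

definition local_ok :: "bool list \<Rightarrow> nat \<Rightarrow> nat \<Rightarrow> nat \<Rightarrow> nat \<Rightarrow> (nat \<Rightarrow> nat) \<Rightarrow> (nat \<Rightarrow> nat) \<Rightarrow> bool" where
  "local_ok x T c v e h l \<longleftrightarrow>
     e < num_sit \<and> (\<forall>i<K. l i < v) \<and>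
     (v = 1 \<longrightarrow> st e = tm_start V \<and> (\<forall>i<K. h i = T)) \<and> (v = T \<longrightarrow> st e = tm_accept V) \<and>
     (\<forall>i<K. l i = 0 \<longrightarrow>
        (if i = 0 then sy i e = (if T \<le> h i then input_symbol x (h i - T) else 0)
         else if i = 1 then sy i e \<le> 2 \<and> (sy i e \<noteq> 0 \<longrightarrow> T \<le> h i \<and> h i < T + c)
         else sy i e = 0))"

text \<open>The first conjunct makes \<open>l'\<close> the true previous visit and the symbol read
  the one written then. The last one, about first visits to two certificate cells, forbids a blank
  to the left of a bit; cells left of the start, at positions below \<open>T\<close>, are exempt,
  being blank anyway.\<close>

definition pair_ok ::
    "nat \<Rightarrow> nat \<Rightarrow> nat \<Rightarrow> (nat \<Rightarrow> nat) \<Rightarrow> (nat \<Rightarrow> nat) \<Rightarrow> nat \<Rightarrow> nat \<Rightarrow> (nat \<Rightarrow> nat) \<Rightarrow> (nat \<Rightarrow> nat) \<Rightarrow> bool"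
        where
  "pair_ok T v e h l v' e' h' l' \<longleftrightarrow>
     (\<forall>i<K. (l' i = v \<longrightarrow> h i = h' i \<and> sy i e' = wr i e) \<and> (l' i < v \<longrightarrow> h i \<noteq> h' i)) \<and>
     (v' = Suc v \<longrightarrow> st e' = nx e \<and> (\<forall>i<K. h' i + 1 = h i + mv i e)) \<and>
     (l 1 = 0 \<and> l' 1 = 0 \<longrightarrow>
        (sy 1 e = 0 \<and> sy 1 e' \<noteq> 0 \<and> T \<le> h 1 \<longrightarrow> h' 1 < h 1) \<and>
        (sy 1 e' = 0 \<and> sy 1 e \<noteq> 0 \<and> T \<le> h' 1 \<longrightarrow> h 1 < h' 1))"

definition trace_ok ::
    "bool list \<Rightarrow> nat \<Rightarrow> nat \<Rightarrow> (nat \<Rightarrow> nat) \<Rightarrow> (nat \<Rightarrow> nat \<Rightarrow> nat) \<Rightarrow> (nat \<Rightarrow> nat \<Rightarrow> nat) \<Rightarrow> bool" where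
  "trace_ok x T c e h l \<longleftrightarrow>
     (\<forall>v\<in>{1..T}. local_ok x T c v (e v) (h v) (l v)) \<and>
     (\<forall>v\<in>{1..T}. \<forall>v'\<in>{1..T}. v < v' \<longrightarrow> pair_ok T v (e v) (h v) (l v) v' (e v') (h v') (l v'))"

section \<open>Accepting runs recovered from traces\<close>

lemma trace_certificate:
  assumes tr: "trace_ok x T c e h l"
  shows "\<exists>w. length w \<le> c \<and>
    (\<forall>v\<in>{1..T}. l v 1 = 0 \<longrightarrow> word_contents w (int (h v 1) - int T) = sy 1 (e v))"
proof -
  define F where "F = {v \<in> {1..T}. l v 1 = 0}"
  \<comment> \<open>Its maximum is the length of the certificate: it ends with the last bit ever
    read, and has length 0 if none is read. Unread positions inside it get the bit
    \<open>False\<close>.\<close>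
  define Z where "Z = insert 0 ((\<lambda>v. Suc (h v 1 - T)) ` {v \<in> F. sy 1 (e v) \<noteq> 0})"
  define w where "w = map (\<lambda>j. \<exists>v\<in>F. h v 1 = T + j \<and> sy 1 (e v) = 2) [0..<Max Z]"
  have fin: "finite Z" by (simp add: Z_def F_def)
  have loc: "sy 1 (e v) \<le> 2" "sy 1 (e v) \<noteq> 0 \<Longrightarrow> T \<le> h v 1 \<and> h v 1 < T + c" if "v \<in> F" for v
  proof -
    have "local_ok x T c v (e v) (h v) (l v)" using tr that by (auto simp: trace_ok_def F_def)
    moreover have "(1 :: nat) < K" using tapes_ge by simp
    ultimately show "sy 1 (e v) \<le> 2" "sy 1 (e v) \<noteq> 0 \<Longrightarrow> T \<le> h v 1 \<and> h v 1 < T + c"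
      using that by (auto simp: local_ok_def F_def)
  qed
  have pair: "h v 1 \<noteq> h v' 1"
    "sy 1 (e v) = 0 \<Longrightarrow> sy 1 (e v') \<noteq> 0 \<Longrightarrow> T \<le> h v 1 \<Longrightarrow> h v' 1 < h v 1"
    if "v \<in> F" "v' \<in> F" "v \<noteq> v'" for v v'
  proof -
    have k: "(1 :: nat) < K" using tapes_ge by simp
    have *: "pair_ok T u (e u) (h u) (l u) u' (e u') (h u') (l u')" if "u \<in> F" "u' \<in> F" "u < u'"
        for u u'
      using tr that by (auto simp: trace_ok_def F_def)
    have "h v 1 \<noteq> h v' 1 \<and> (sy 1 (e v) = 0 \<longrightarrow> sy 1 (e v') \<noteq> 0 \<longrightarrow> T \<le> h v 1 \<longrightarrow> h v' 1 < h v 1)"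
    proof (cases "v < v'")
      case True
      have "1 \<le> v" using that(1) by (simp add: F_def)
      then show ?thesis using *[OF that(1,2) True] k that unfolding pair_ok_def F_def by force
    next
      case False
      then have "v' < v" using that(3) by simp
      moreover have "1 \<le> v'" using that(2) by (simp add: F_def)
      ultimately show ?thesis using *[OF that(2,1)] k that unfolding pair_ok_def F_def by force
    qed
    then show "h v 1 \<noteq> h v' 1"
      "sy 1 (e v) = 0 \<Longrightarrow> sy 1 (e v') \<noteq> 0 \<Longrightarrow> T \<le> h v 1 \<Longrightarrow> h v' 1 < h v 1" by auto
  qed
  have "Max Z \<le> c"
    using fin loc(2) by (subst Max_le_iff) (fastforce simp: Z_def)+
  then have "length w \<le> c" by (simp add: w_def)
  moreover have "word_contents w (int (h v 1) - int T) = sy 1 (e v)" if v: "v \<in> F" for v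
  proof (cases "sy 1 (e v) = 0")
    case True
    have "\<not> h v 1 - T < Max Z" if T: "T \<le> h v 1"
    proof
      assume "h v 1 - T < Max Z"
      moreover have "Max Z \<in> Z" using fin by (intro Max_in) (auto simp: Z_def)
      ultimately obtain v' where v': "v' \<in> F" "sy 1 (e v') \<noteq> 0" "h v 1 - T < Suc (h v' 1 - T)"
        by (auto simp: Z_def)
      have "h v' 1 < h v 1" using pair(2)[OF v v'(1)] True v'(2) T by (cases "v = v'") auto
      then show False using v'(3) T loc(2)[OF v'(1,2)] by linarith
    qed
    then show ?thesis using True by (auto simp: word_contents_def w_def nat_diff_distrib')
  next
    case False
    then have hv: "T \<le> h v 1" using loc[OF v] by simp
    have "Suc (h v 1 - T) \<in> Z" using v False by (auto simp: Z_def)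
    then have "Suc (h v 1 - T) \<le> Max Z" using fin by (rule Max_ge[rotated])
    then have len: "h v 1 - T < length w" by (simp add: w_def)
    have "w ! (h v 1 - T) \<longleftrightarrow> sy 1 (e v) = 2"
    proof -
      have "v' = v" if "v' \<in> F" "h v' 1 = h v 1" for v' using pair(1)[OF that(1) v] that(2) by blast
      then show ?thesis using len v hv by (auto simp: w_def)
    qed
    moreover have "sy 1 (e v) = 1 \<or> sy 1 (e v) = 2" using loc(1)[OF v] False by linarith
    ultimately have "bit_symbol (w ! (h v 1 - T)) = sy 1 (e v)"
      by (cases "w ! (h v 1 - T)") simp_all
    moreover have "int (h v 1) - int T = int (h v 1 - T)" using hv by simp
    moreover have "word_contents w (int (h v 1 - T)) = bit_symbol (w ! (h v 1 - T))"
      using len by (simp add: word_contents_def)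
    ultimately show ?thesis by (simp only:)
  qed
  ultimately show ?thesis by (intro exI[of _ w]) (auto simp: F_def)
qed

lemma trace_sound:
  assumes tr: "trace_ok x T c e h l" and T: "1 \<le> T"
  shows "\<exists>w. length w \<le> c \<and> fst (tm_run V [x, w] (T - 1)) = tm_accept V"
proof -
  obtain w where w: "length w \<le> c"
    "\<And>v. v \<in> {1..T} \<Longrightarrow> l v 1 = 0 \<Longrightarrow> word_contents w (int (h v 1) - int T) = sy 1 (e v)"
    using trace_certificate[OF tr] by blast
  define pos where "pos i v = int (h v i) - int T" for i v
  define init where "init i = word_contents (if i < 2 then [x, w] ! i else [])" for i
  \<comment> \<open>Steps are counted from 1, so nothing is written at index 0 and
    \<open>C i 1\<close> is the initial content.\<close>
  define C where "C i v = rec_nat (init i) (\<lambda>u f. if u = 0 then f else f(pos i u := wr i (e u))) v"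
      for i v
  have C1: "C i 1 = init i" for i by (simp add: C_def)
  have C_Suc: "C i (Suc v) = (C i v)(pos i v := wr i (e v))" if "1 \<le> v" for i v
    using that by (simp add: C_def)
  have loc: "local_ok x T c v (e v) (h v) (l v)" if "1 \<le> v" "v \<le> T" for v
    using tr that by (auto simp: trace_ok_def)
  have pair: "pair_ok T v (e v) (h v) (l v) v' (e v') (h v') (l v')" if "1 \<le> v" "v < v'" "v' \<le> T"
      for v v'
    using tr that by (auto simp: trace_ok_def)
  \<comment> \<open>The pair constraints exclude any visit after step \<open>l v i\<close>, so the
    cell holds what was written then, or its initial content if there was no earlier visit.\<close>
  have read: "C i v (pos i v) = sy i (e v)" if v: "1 \<le> v" "v \<le> T" and i: "i < K" for i v
  proof (cases "l v i = 0")
    case True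
    have "C i v (pos i v) = C i 1 (pos i v)"
    proof (rule contents_unvisited[where C = "C i" and pos = "pos i" and wr = "\<lambda>v. wr i (e v)"])
      fix u assume u: "1 \<le> u" "u < v"
      have "h u i \<noteq> h v i"
        using pair[OF u(1,2) v(2)] i True u(1) unfolding pair_ok_def by force
      then show "pos i u \<noteq> pos i v" by (simp add: pos_def)
    qed (use C_Suc v in auto)
    also have "\<dots> = sy i (e v)"
    proof -
      consider "i = 0" | "i = 1" | "2 \<le> i" by linarith
      then show ?thesis
      proof cases
        case 1
        then show ?thesis unfolding C1 using loc[OF v] True i
          by (auto simp: local_ok_def init_def pos_def input_symbol_def word_contents_def
              of_nat_diff)
      next
        case 2
        then show ?thesis unfolding C1 using w(2)[of v] True v by (simp add: init_def pos_def)
      next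
        case 3
        then have "sy i (e v) = 0" using loc[OF v] True i unfolding local_ok_def by force
        then show ?thesis unfolding C1 using 3 by (simp add: init_def word_contents_def)
      qed
    qed
    finally show ?thesis .
  next
    case False
    let ?t = "l v i"
    have t: "1 \<le> ?t" "?t < v" using False loc[OF v] i by (auto simp: local_ok_def)
    have pt: "h ?t i = h v i" "sy i (e v) = wr i (e ?t)"
      using pair[OF t v(2)] i unfolding pair_ok_def by auto
    have "C i v (pos i v) = wr i (e ?t)"
    proof (rule contents_after_last_visit[where C = "C i" and pos = "pos i"
        and wr = "\<lambda>v. wr i (e v)"])
      fix u assume u: "?t < u" "u < v"
      then have "h u i \<noteq> h v i" using pair[of u v] v t i unfolding pair_ok_def by auto
      then show "pos i u \<noteq> pos i v" by (simp add: pos_def)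
    qed (use C_Suc t pt(1) in \<open>auto simp: pos_def\<close>)
    then show ?thesis using pt(2) by simp
  qed
  have run: "tm_run V [x, w] v = (st (e (Suc v)), map (\<lambda>i. (pos i (Suc v), C i (Suc v))) [0..<K])"
    if "Suc v \<le> T" for v
    using that
  proof (induction v)
    case 0
    have "st (e 1) = tm_start V" "\<forall>i<K. h 1 i = T" using loc[of 1] 0 by (auto simp: local_ok_def)
    then show ?case
      using C1 by (auto simp: tm_run_def tm_init_def pos_def init_def)
  next
    case (Suc v)
    let ?u = "Suc v"
    let ?ts = "map (\<lambda>i. (pos i ?u, C i ?u)) [0..<K]"
    have u: "1 \<le> ?u" "?u \<le> T" "?u < Suc ?u" "Suc ?u \<le> T" using Suc.prems by auto
    have e: "e ?u < num_sit" using loc[OF u(1,2)] by (simp add: local_ok_def)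
    have len: "length (snd (sit (e ?u))) = K" using sit_mem[OF e] by (auto simp: situations_def)
    have "map read_tape ?ts = snd (sit (e ?u))"
      using len read[OF u(1,2)] by (intro nth_equalityI) (auto simp: sy_def)
    then have sit: "(st (e ?u), map read_tape ?ts) = sit (e ?u)" by (simp add: st_def)
    have "tm_run V [x, w] (Suc v) = tm_step V (st (e ?u), ?ts)"
      using Suc.IH Suc.prems by (simp add: tm_run_def)
    also have "\<dots> = (nx (e ?u), map2 act_tape (snd (act (sit (e ?u)))) ?ts)"
      unfolding step_act sit nx_def ..
    also have "map2 act_tape (snd (act (sit (e ?u)))) ?ts
        = map (\<lambda>i. (pos i (Suc ?u), C i (Suc ?u))) [0..<K]"
    proof (rule nth_equalityI)
      fix i assume "i < length (map2 act_tape (snd (act (sit (e ?u)))) ?ts)"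
      then have i: "i < K" using act_wf(2)[OF sit_mem[OF e]] by simp
      have "act_tape (snd (act (sit (e ?u))) ! i) (pos i ?u, C i ?u)
          = (pos i ?u + int (mv i (e ?u)) - 1, C i (Suc ?u))"
        unfolding mv_def C_Suc[OF u(1)] wr_def
        by (cases "snd (act (sit (e ?u))) ! i") (simp add: move_head_code)
      moreover have "h (Suc ?u) i + 1 = h ?u i + mv i (e ?u)"
        using pair[OF u(1,3,4)] i unfolding pair_ok_def by auto
      then have "pos i ?u + int (mv i (e ?u)) - 1 = pos i (Suc ?u)"
        unfolding pos_def by linarith
      ultimately show "map2 act_tape (snd (act (sit (e ?u)))) ?ts ! i
          = map (\<lambda>i. (pos i (Suc ?u), C i (Suc ?u))) [0..<K] ! i"
        using i act_wf(2)[OF sit_mem[OF e]] by simp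
    qed (use act_wf(2)[OF sit_mem[OF e]] in simp)
    also have "nx (e ?u) = st (e (Suc ?u))" using pair[OF u(1,3,4)] unfolding pair_ok_def by simp
    finally show ?case .
  qed
  have "fst (tm_run V [x, w] (T - 1)) = st (e T)" using run[of "T - 1"] T by simp
  also have "\<dots> = tm_accept V" using loc[of T] T by (simp add: local_ok_def)
  finally show ?thesis using w(1) by blast
qed

section \<open>Traces of accepting runs\<close>

lemma step_wf:
  assumes "fst c < tm_states V" "length (snd c) = K" "\<forall>i<K. \<forall>z. snd (snd c ! i) z < tm_symbols V"
  shows "(fst c, map read_tape (snd c)) \<in> situations"
    and "fst (tm_step V c) < tm_states V" "length (snd (tm_step V c)) = K"
    and "i < K \<Longrightarrow> snd (tm_step V c) ! i
        = act_tape (snd (act (fst c, map read_tape (snd c))) ! i) (snd c ! i)"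
    and "\<forall>i<K. \<forall>z. snd (snd (tm_step V c) ! i) z < tm_symbols V"
proof -
  have "read_tape t = snd t (fst t)" for t by (cases t) simp
  then have "read_tape (snd c ! i) < tm_symbols V" if "i < K" for i using assms(3) that by simp
  then show mem: "(fst c, map read_tape (snd c)) \<in> situations"
  proof -
    assume r: "\<And>i. i < K \<Longrightarrow> read_tape (snd c ! i) < tm_symbols V"
    have "set (map read_tape (snd c)) \<subseteq> {..<tm_symbols V}"
    proof
      fix s assume "s \<in> set (map read_tape (snd c))"
      then obtain i where "i < K" "s = read_tape (snd c ! i)"
        using assms(2) unfolding in_set_conv_nth by auto
      then show "s \<in> {..<tm_symbols V}" using r by simp
    qed
    then show ?thesis using assms(1,2) by (simp add: situations_def)
  qed
  have step: "tm_step V c = (fst (act (fst c, map read_tape (snd c))),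
      map2 act_tape (snd (act (fst c, map read_tape (snd c)))) (snd c))"
    using step_act[of "fst c" "snd c"] by simp
  show "fst (tm_step V c) < tm_states V" "length (snd (tm_step V c)) = K"
    using act_wf(1,2)[OF mem] assms(2) by (simp_all add: step)
  show nth: "snd (tm_step V c) ! i
      = act_tape (snd (act (fst c, map read_tape (snd c))) ! i) (snd c ! i)"
    if "i < K" for i
    using act_wf(2)[OF mem] assms(2) that by (simp add: step)
  show "\<forall>i<K. \<forall>z. snd (snd (tm_step V c) ! i) z < tm_symbols V"
  proof (intro allI impI)
    fix i z assume i: "i < K"
    obtain s m where sm: "snd (act (fst c, map read_tape (snd c))) ! i = (s, m)"
        by (metis surj_pair)
    have "s < tm_symbols V" using act_wf(3)[OF mem i] sm by simp
    then show "snd (snd (tm_step V c) ! i) z < tm_symbols V"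
      unfolding nth[OF i] sm using assms(3) i by (cases "snd c ! i") (auto dest!: spec[of _ i])
  qed
qed

lemma run_wf:
  "fst (tm_run V ws n) < tm_states V \<and> length (snd (tm_run V ws n)) = K \<and>
    (\<forall>i<K. \<forall>z. snd (snd (tm_run V ws n) ! i) z < tm_symbols V)"
proof (induction n)
  case 0
  have "word_contents w z < 3" for w z
    using bit_symbol_less_3 by (simp add: word_contents_def)
  moreover have "3 \<le> tm_symbols V" "tm_start V < tm_states V" using wf by (auto simp: wf_tm_def)
  ultimately show ?case
    by (auto simp: tm_run_def tm_init_def intro: less_le_trans)
next
  case (Suc n)
  then show ?case using step_wf(2,3,5)[of "tm_run V ws n"] by (simp add: tm_run_def)
qed

lemma trace_complete:
  assumes acc: "fst (tm_run V [x, w] (T - 1)) = tm_accept V" and w: "length w \<le> c" and T: "1 \<le> T"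
  shows "\<exists>e h l. trace_ok x T c e h l \<and>
    (\<forall>v\<in>{1..T}. \<forall>i<K. h v i \<le> 2 * T \<and> l v i < T)"
proof -
  define conf where "conf v = tm_run V [x, w] (v - 1)" for v
  define pos where "pos i v = fst (snd (conf v) ! i)" for i v
  define C where "C i v = snd (snd (conf v) ! i)" for i v
  have wfc: "fst (conf v) < tm_states V" "length (snd (conf v))
      = K" "\<forall>i<K. \<forall>z. snd (snd (conf v) ! i) z < tm_symbols V" for v
    using run_wf unfolding conf_def by auto
  have "\<exists>e<num_sit. sit e = (fst (conf v), map read_tape (snd (conf v)))" for v
    using step_wf(1)[OF wfc] bij_sit unfolding bij_betw_def by (metis atLeastLessThan_iff imageE)
  then obtain e where e: "\<And>v. e v < num_sit" "\<And>v. sit (e v)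
      = (fst (conf v), map read_tape (snd (conf v)))"
    by metis
  have conf_Suc: "conf (Suc v) = tm_step V (conf v)" if "1 \<le> v" for v
    using that by (cases v) (auto simp: conf_def tm_run_def)
  have st: "st (e v) = fst (conf v)" for v by (simp add: st_def e)
  have sy: "sy i (e v) = C i v (pos i v)" if "i < K" for i v
    using that wfc(2)[of v] by (cases "snd (conf v) ! i") (simp add: sy_def e C_def pos_def)
  have nx: "nx (e v) = fst (conf (Suc v))" if "1 \<le> v" for v
    using step_act[of "fst (conf v)" "snd (conf v)"] by (simp add: nx_def e conf_Suc[OF that])
  have next_tape: "pos i (Suc v) = pos i v + int (mv i (e v)) - 1 \<and> C i (Suc v)
      = (C i v)(pos i v := wr i (e v))"
    if "1 \<le> v" "i < K" for i v
    unfolding pos_def C_def conf_Suc[OF that(1)] step_wf(4)[OF wfc that(2)] mv_def wr_def e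
    by (cases "snd (act (fst (conf v), map read_tape (snd (conf v)))) ! i"; cases
        "snd (conf v) ! i")
      (simp add: move_head_code)
  have pos_1: "pos i 1 = 0" and C_1: "C i 1 = word_contents (if i < 2 then [x, w] ! i else [])"
      if "i < K" for i
    using that by (auto simp: pos_def C_def conf_def tm_run_def tm_init_def)
  have mv_le: "mv i a \<le> 2" for i a by (auto simp: mv_def move_code_def split: move.split)
  have pos_bound: "\<bar>pos i v\<bar> \<le> int v - 1" if "1 \<le> v" "i < K" for i v
    using that(1)
  proof (induction v rule: dec_induct)
    case base
    then show ?case using pos_1[OF that(2)] by simp
  next
    case (step v)
    then show ?case using next_tape[OF step.hyps(1) that(2)] mv_le[of i "e v"] by linarith
  qed
  \<comment> \<open>A head moves at most one cell per step, so adding \<open>T\<close> makes all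
    positions natural numbers up to \<open>2 * T\<close>.\<close>
  define h where "h v i = nat (pos i v + int T)" for v i
  define l where "l v i = Max (insert 0 {t. 1 \<le> t \<and> t < v \<and> pos i t = pos i v})" for v i
  have h: "int (h v i) = pos i v + int T" if "1 \<le> v" "v \<le> T" "i < K" for v i
    using pos_bound[OF that(1,3)] that(2) by (simp add: h_def)
  have fin: "finite (insert 0 {t. 1 \<le> t \<and> t < v \<and> pos i t = pos i v})" for v i
    by (rule finite_subset[of _ "{..v}"]) auto
  have l_mem: "l v i = 0 \<or> (1 \<le> l v i \<and> l v i < v \<and> pos i (l v i) = pos i v)" for v i
    using Max_in[OF fin[of v i]] unfolding l_def[symmetric] by blast
  have l_max: "u \<le> l v i" if "1 \<le> u" "u < v" "pos i u = pos i v" for u v i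
    unfolding l_def using that by (intro Max_ge fin) auto
  have first: "sy i (e v) = word_contents (if i < 2 then [x, w] ! i else []) (pos i v)"
    if "1 \<le> v" "i < K" "l v i = 0" for v i
  proof -
    have "C i v (pos i v) = C i 1 (pos i v)"
    proof (rule contents_unvisited[where C = "C i" and pos = "pos i" and wr = "\<lambda>v. wr i (e v)"])
      show "pos i u \<noteq> pos i v" if "1 \<le> u" "u < v" for u
        using l_max[of u v i] that \<open>l v i = 0\<close> by auto
    qed (use next_tape that in auto)
    then show ?thesis using sy[OF that(2)] C_1[OF that(2)] by simp
  qed
  have "local_ok x T c v (e v) (h v) (l v)" if v: "1 \<le> v" "v \<le> T" for v
    unfolding local_ok_def
  proof (intro conjI allI impI)
    show "e v < num_sit" by (rule e)
    show "l v i < v" for i using l_mem[of v i] v by auto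
    show "st (e v) = tm_start V" if "v = 1" using that
        by (simp add: st conf_def tm_run_def tm_init_def)
    show "h v i = T" if "v = 1" "i < K" for i using that h[OF v that(2)] pos_1[OF that(2)] by simp
    show "st (e v) = tm_accept V" if "v = T" using that acc by (simp add: st conf_def)
    fix i assume i: "i < K" "l v i = 0"
    have hv: "int (h v i) = pos i v + int T" by (rule h[OF v i(1)])
    show "if i = 0 then sy i (e v) = (if T \<le> h v i then input_symbol x (h v i - T) else 0)
         else if i = 1 then sy i (e v) \<le> 2 \<and> (sy i (e v) \<noteq> 0 \<longrightarrow> T \<le> h v i \<and> h v i < T + c)
         else sy i (e v) = 0"
    proof -
      consider "i = 0" | "i = 1" | "2 \<le> i" by linarith
      then show ?thesis
      proof cases
        case 1
        have "word_contents x (pos i v) = (if T \<le> h v i then input_symbol x (h v i - T) else 0)"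
        proof (cases "T \<le> h v i")
          case True
          then have "pos i v = int (h v i - T)" using hv by simp
          then show ?thesis using True by (simp add: input_symbol_def)
        next
          case False
          then have "pos i v < 0" using hv by linarith
          then show ?thesis using False by (simp add: word_contents_def)
        qed
        then show ?thesis using first[OF v(1) i] 1 by simp
      next
        case 2
        have s: "sy i (e v) = word_contents w (pos i v)" using first[OF v(1) i] 2 by simp
        have "sy i (e v) \<le> 2"
          unfolding s word_contents_def using bit_symbol_less_3[of "w ! nat (pos i v)"] by auto
        moreover have "T \<le> h v i \<and> h v i < T + c" if "sy i (e v) \<noteq> 0"
        proof -
          have "0 \<le> pos i v \<and> pos i v < int (length w)"
            using that unfolding s word_contents_def by (auto split: if_splits)
          then show ?thesis using hv w by linarith
        qed
        ultimately show ?thesis using 2 by simp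
      next
        case 3
        then show ?thesis using first[OF v(1) i] by (simp add: word_contents_def)
      qed
    qed
  qed
  moreover have "pair_ok T v (e v) (h v) (l v) v' (e v') (h v') (l v')"
      if v: "1 \<le> v" "v < v'" "v' \<le> T" for v v'
    unfolding pair_ok_def
  proof (intro conjI allI impI; (elim conjE)?)
    have vT: "v \<le> T" and v1: "1 \<le> v'" using v by auto
    have k1: "(1 :: nat) < K" using tapes_ge by simp
    fix i assume i: "i < K"
    show "h v i = h v' i" if "l v' i = v"
      using l_mem[of v' i] that v by (simp add: h_def)
    show "sy i (e v') = wr i (e v)" if lv: "l v' i = v"
    proof -
      have "C i v' (pos i v') = wr i (e v)"
      proof (rule contents_after_last_visit[where C = "C i" and pos = "pos i"
          and wr = "\<lambda>v. wr i (e v)"])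
        show "pos i v = pos i v'" using l_mem[of v' i] lv v by auto
        show "pos i u \<noteq> pos i v'" if "v < u" "u < v'" for u
          using l_max[of u v' i] that lv v by auto
      qed (use next_tape i v in auto)
      then show ?thesis using sy[OF i] by simp
    qed
    show "h v i \<noteq> h v' i" if "l v' i < v"
      using l_max[OF v(1,2), of i] that h[OF v(1) vT i] h[OF v1 v(3) i] by auto
  next
    assume v': "v' = Suc v"
    show "st (e v') = nx (e v)" using nx[OF v(1)] v' by (simp add: st)
    fix i assume i: "i < K"
    have vT: "v \<le> T" and v1: "1 \<le> v'" using v by auto
    have "int (h v' i + 1) = int (h v i + mv i (e v))"
      using next_tape[OF v(1) i] h[OF v(1) vT i] h[OF v1 v(3) i] v' by simp
    then show "h v' i + 1 = h v i + mv i (e v)" by (simp only: of_nat_eq_iff)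
  next
    have vT: "v \<le> T" and v1: "1 \<le> v'" using v by auto
    have k1: "(1 :: nat) < K" using tapes_ge by simp
    assume l0: "l v 1 = 0" "l v' 1 = 0"
    have s: "sy 1 (e v) = word_contents w (pos 1 v)" "sy 1 (e v') = word_contents w (pos 1 v')"
      using first[OF v(1) k1 l0(1)] first[OF v1 k1 l0(2)] by auto
    have z: "int (length w) \<le> pos 1 u" if "word_contents w (pos 1 u) = 0" "0 \<le> pos 1 u" for u
    proof (rule ccontr)
      assume "\<not> int (length w) \<le> pos 1 u"
      then have "word_contents w (pos 1 u) = bit_symbol (w ! nat (pos 1 u))"
        using that(2) by (simp add: word_contents_def)
      then show False using that(1) bit_symbol_pos[of "w ! nat (pos 1 u)"] by simp
    qed
    have nz: "pos 1 u < int (length w)" if "word_contents w (pos 1 u) \<noteq> 0" for u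
      using that by (auto simp: word_contents_def split: if_splits)
    show "h v' 1 < h v 1" if "sy 1 (e v) = 0" "sy 1 (e v') \<noteq> 0" "T \<le> h v 1"
      using z[of v] nz[of v'] that h[OF v(1) vT k1] h[OF v1 v(3) k1] unfolding s by linarith
    show "h v 1 < h v' 1" if "sy 1 (e v') = 0" "sy 1 (e v) \<noteq> 0" "T \<le> h v' 1"
      using z[of v'] nz[of v] that h[OF v(1) vT k1] h[OF v1 v(3) k1] unfolding s by linarith
  qed
  ultimately have "trace_ok x T c e h l" by (auto simp: trace_ok_def)
  moreover have "h v i \<le> 2 * T \<and> l v i < T" if "v \<in> {1..T}" "i < K" for v i
    using pos_bound[of v i] h[of v i] l_mem[of v i] that T by auto
  ultimately show ?thesis by blast
qed
end

section \<open>Computing the matrix\<close>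

text \<open>The relation \<open>R\<close> is evaluated under two bound variables, so its
  computability is assumed for all arities and arbitrary computable arguments.\<close>

lemma cf_shift_rel:
  assumes R: "\<And>n F1 F2 F3 F4. cf n F1 \<Longrightarrow> cf n F2 \<Longrightarrow> cf n F3 \<Longrightarrow> cf n F4 \<Longrightarrow>
      cfp n (\<lambda>x vs. R x (F1 x vs) (F2 x vs) (F3 x vs) (F4 x vs))"
    and m: "\<And>n. cf n (\<lambda>x vs. m x)"
    and F: "cf n F1" "cf n F2" "cf n F3" "cf n F4"
  shows "cfp n (\<lambda>x vs. shift_rel (m x) (R x) (F1 x vs) (F2 x vs) (F3 x vs) (F4 x vs))"
  unfolding shift_rel_def sidon_def
  by (intro cf_intros cf_mod cf_power m R F[THEN cf_tl, THEN cf_tl] cf_hd cf_tl[OF cf_hd])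

text \<open>A family of systems indexed by the input word. The constants of \<open>shift_csp\<close>
  occur with explicit parameters, since no single system is fixed; each proof interprets the locale
  at one \<open>x\<close>.\<close>

locale computable_csp =
  fixes N M kappa :: "bool list \<Rightarrow> nat" and R :: "bool list \<Rightarrow> nat \<Rightarrow> nat \<Rightarrow> nat \<Rightarrow> nat \<Rightarrow> bool"
  assumes csp: "shift_csp (N x) (M x) (kappa x) (R x)"
    and cf_N: "cf n (\<lambda>x vs. N x)" and cf_M: "cf n (\<lambda>x vs. M x)"
        and cf_kappa: "cf n (\<lambda>x vs. kappa x)"
    and cf_R: "cf n F1 \<Longrightarrow> cf n F2 \<Longrightarrow> cf n F3 \<Longrightarrow> cf n F4 \<Longrightarrow>
      cfp n (\<lambda>x vs. R x (F1 x vs) (F2 x vs) (F3 x vs) (F4 x vs))"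
begin

abbreviation "lit_count x \<equiv> shift_csp.num_lits (N x) (M x)"
abbreviation "pair_count x \<equiv> shift_csp.num_pairs (N x) (M x) (R x)"
abbreviation "matrix x \<equiv> shift_csp.Gamma (N x) (M x) (kappa x) (R x)"

lemma cf_lit_count: "cf n (\<lambda>x vs. lit_count x)"
proof (rule cf_eqI)
  show "cf n (\<lambda>x vs. N x * (M x + 1))" by (intro cf_intros cf_N cf_M)
  show "lit_count x = N x * (M x + 1)" for x
    by (rule shift_csp.num_lits_def[OF csp])
qed

lemma cf_compatible:
  assumes F: "cf n F" "cf n G"
  shows "cfp n (\<lambda>x vs. shift_csp.compatible (M x) (R x) (F x vs) (G x vs))"
proof (rule cf_eqI)
  show "cfp n (\<lambda>x vs. \<not> (F x vs div (M x + 1) = G x vs div (M x + 1)) \<and>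
     (F x vs mod (M x + 1) = M x \<or> G x vs mod (M x + 1) = M x \<or>
      R x (F x vs div (M x + 1)) (G x vs div (M x + 1)) (F x vs mod (M x + 1)) (G x vs mod (M x +
          1))))"
    by (intro cf_intros cf_mod cf_div cf_R cf_M F)
  fix x :: "bool list" and vs :: "nat list"
  interpret shift_csp "N x" "M x" "kappa x" "R x" by (rule csp)
  show "of_bool (compatible (F x vs) (G x vs))
      = (of_bool (\<not> (F x vs div (M x + 1) = G x vs div (M x + 1)) \<and>
     (F x vs mod (M x + 1) = M x \<or> G x vs mod (M x + 1) = M x \<or>
      R x (F x vs div (M x + 1)) (G x vs div (M x + 1)) (F x vs mod (M x + 1)) (G x vs mod (M x +
          1)))) :: nat)"
    by (simp add: compatible_def cell_of_def val_of_def)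
qed

lemma cf_weight:
  assumes F: "cf n F"
  shows "cf n (\<lambda>x vs. shift_csp.weight (M x) (kappa x) (F x vs))"
proof (rule cf_eqI)
  show "cf n (\<lambda>x vs. if F x vs mod (M x + 1) = M x then kappa x * M x - M x else 1)"
    by (intro cf_intros cf_mod cf_M cf_kappa F)
  fix x :: "bool list" and vs :: "nat list"
  interpret shift_csp "N x" "M x" "kappa x" "R x" by (rule csp)
  show "weight (F x vs) = (if F x vs mod (M x + 1) = M x then kappa x * M x - M x else 1)"
    by (simp add: weight_def val_of_def)
qed

lemma cf_pair_count: "cf n (\<lambda>x vs. pair_count x)"
proof (rule cf_eqI)
  show "cf n (\<lambda>x vs. \<Sum>i<lit_count x. \<Sum>j<lit_count x. of_bool (i < j
      \<and> shift_csp.compatible (M x) (R x) i j))"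
    by (intro cf_intros cf_compatible cf_lit_count cf_hd cf_tl[OF cf_hd])
  fix x :: "bool list" and vs :: "nat list"
  interpret shift_csp "N x" "M x" "kappa x" "R x" by (rule csp)
  show "num_pairs = (\<Sum>i<num_lits. \<Sum>j<num_lits. of_bool (i < j \<and> compatible i j))"
    by (rule num_pairs_eq)
qed

abbreviation "half_pairs x \<equiv> 1 + pair_count x - N x * (N x - 1) div 2"

lemma cf_event_num:
  assumes F: "cf n F"
  shows "cf n (\<lambda>x vs. shift_csp.event_num (N x) (M x) (kappa x) (R x) (F x vs))"
proof (rule cf_eqI)
  show "cf n (\<lambda>x vs. if F x vs = 0 then half_pairs x * (kappa x * M x) else if F x vs
      = 1 then kappa x * M x
     else (\<Sum>j<lit_count x. of_bool (shift_csp.compatible (M x) (R x) (F x vs - 2) j)) * (kappa x * M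
         x)
       - shift_csp.weight (M x) (kappa x) (F x vs - 2) * (N x - 2))"
    by (intro cf_intros cf_div cf_compatible cf_weight cf_pair_count cf_lit_count cf_N cf_M cf_kappa
        F F[THEN cf_tl] cf_hd)
  fix x :: "bool list" and vs :: "nat list"
  interpret shift_csp "N x" "M x" "kappa x" "R x" by (rule csp)
  show "event_num (F x vs) = (if F x vs = 0 then half_pairs x * (kappa x * M x) else if F x vs
      = 1 then kappa x * M x
     else (\<Sum>j<num_lits. of_bool (compatible (F x vs - 2) j)) * (kappa x * M x) - weight (F x vs - 2)
         * (N x - 2))"
    unfolding event_num_def total_def degree_eq D_def num_pairs_def ..
qed

lemma cf_moment_num:
  assumes F: "cf n F" "cf n G"
  shows "cf n (\<lambda>x vs. shift_csp.moment_num (N x) (M x) (kappa x) (R x) (F x vs) (G x vs))"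
proof (rule cf_eqI)
  let ?e = "\<lambda>x. shift_csp.event_num (N x) (M x) (kappa x) (R x)"
  let ?w = "\<lambda>x. shift_csp.weight (M x) (kappa x)"
  show "cf n (\<lambda>x vs. if F x vs = G x vs then ?e x (F x vs) else if F x vs = 0 then ?e x (G x vs)
      else if G x vs = 0 then ?e x (F x vs) else if F x vs = 1 then ?w x (G x vs - 2)
      else if G x vs = 1 then ?w x (F x vs - 2)
      else if shift_csp.compatible (M x) (R x) (F x vs - 2) (G x vs - 2) then kappa x * M x else 0)"
    by (intro cf_intros cf_compatible cf_weight cf_event_num cf_M cf_kappa F)
  fix x :: "bool list" and vs :: "nat list"
  interpret shift_csp "N x" "M x" "kappa x" "R x" by (rule csp)
  show "moment_num (F x vs) (G x vs) = (if F x vs = G x vs then event_num (F x vs) else if F x vs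
      = 0 then event_num (G x vs)
      else if G x vs = 0 then event_num (F x vs) else if F x vs = 1 then weight (G x vs - 2)
      else if G x vs = 1 then weight (F x vs - 2)
      else if compatible (F x vs - 2) (G x vs - 2) then kappa x * M x else 0)"
    unfolding moment_num_def total_def ..
qed

lemma emittable_matrix: "emittable 0 (\<lambda>x vs. encode_entries (lit_count x + 2) (matrix x))"
proof (rule emittable_eqI)
  let ?e = "\<lambda>x. shift_csp.event_num (N x) (M x) (kappa x) (R x)"
  let ?m = "\<lambda>x. shift_csp.moment_num (N x) (M x) (kappa x) (R x)"
  let ?D = "\<lambda>x. half_pairs x * (kappa x * M x)"
  have pos: "0 < ?D x" for x
  proof -
    interpret shift_csp "N x" "M x" "kappa x" "R x" by (rule csp)
    have "D * total = ?D x" unfolding total_def D_def num_pairs_def ..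
    then show ?thesis using D_pos W_pos by (metis nat_0_less_mult_iff)
  qed
  show "emittable 0 (\<lambda>x vs. concat (map (\<lambda>i. concat (map (\<lambda>j.
      encode_rat ((of_nat (?D x + 4 * ?m x i j) - of_nat (2 * ?e x i + 2 * ?e x j)) / of_nat (?D
          x)))
      [0..<lit_count x + 2])) [0..<lit_count x + 2]))"
    by (intro emittable_concat_map emittable_encode_rat pos cf_intros cf_div cf_event_num
        cf_moment_num
        cf_pair_count cf_lit_count cf_N cf_M cf_kappa cf_hd cf_tl[OF cf_hd])
  fix x :: "bool list" and vs :: "nat list"
  interpret shift_csp "N x" "M x" "kappa x" "R x" by (rule csp)
  have D: "D * total = ?D x" unfolding total_def D_def num_pairs_def ..
  have "Gamma $$ (i, j) = (of_nat (?D x + 4 * moment_num i j) - of_nat (2 * event_num i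
      + 2 * event_num j)) / of_nat (?D x)"
    if "i < num_lits + 2" "j < num_lits + 2" for i j
    unfolding Gamma_def index_mat(1)[OF that] prod.case D ..
  then show "encode_entries (num_lits + 2) Gamma = concat (map (\<lambda>i. concat (map (\<lambda>j.
      encode_rat ((of_nat (?D x + 4 * moment_num i j) - of_nat (2 * event_num i + 2 * event_num j))
          / of_nat (?D x)))
      [0..<num_lits + 2])) [0..<num_lits + 2])"
    unfolding encode_entries_def set_upt
    by (intro arg_cong[of _ _ concat] map_cong refl arg_cong[of _ _ encode_rat]) (simp only: set_upt
        atLeastLessThan_iff)
qed

theorem polytime_computable_membership:
  "polytime_computable (\<lambda>x. encode_membership (lit_count x + 2, matrix x))"
  unfolding encode_membership_def prod.case
  by (rule polytime_computable_emittable)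
    (intro emittable_append emittable_encode_nat emittable_matrix cf_intros cf_lit_count)

theorem polytime_computable_rank:
  "polytime_computable (\<lambda>x. encode_rank (M x + 1 + pair_count x, lit_count x + 2, matrix x))"
  unfolding encode_rank_def prod.case
  by (rule polytime_computable_emittable)
    (intro emittable_append emittable_encode_nat emittable_matrix cf_intros cf_lit_count
        cf_pair_count cf_M)

end

section \<open>The reductions\<close>

lemma karp_reducibleI:
  assumes "polytime_computable (\<lambda>x. enc (g x))" "\<And>x. promise (g x)" "\<And>x. question (g x) \<longleftrightarrow> x \<in> L"
  shows "karp_reducible L (promise_problem_of enc promise question)"
  unfolding karp_reducible_def promise_problem_of_def
  using assms by (intro exI[of _ "\<lambda>x. enc (g x)"]) auto

lemma cf_digit: "cf n F \<Longrightarrow> cf n G \<Longrightarrow> cf n (\<lambda>x vs. digit (F x vs) (G x vs) j)"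
  unfolding digit_def by (intro cf_mod cf_div cf_power)

lemma cf_if_const: "cfp n P \<Longrightarrow> cfp n Q \<Longrightarrow> cfp n (\<lambda>x vs. if b then P x vs else Q x vs)"
  by (cases b) auto

context verifier
begin

text \<open>Any function of \<open>sit\<close> is a finite table with a default value, because the
  enumeration is constant from \<open>num_sit\<close> on.\<close>

lemma cf_sit:
  assumes "cf n F"
  shows "cf n (\<lambda>x vs. g (sit (F x vs)))"
proof (rule cf_eqI)
  show "cf n (\<lambda>x vs. if F x vs < num_sit then (if F x vs
      < num_sit then g (sit (F x vs)) else 0) else g (sit num_sit))"
    by (intro cf_if cf_less assms cf_const cf_table[where g = "\<lambda>e. g (sit e)"])
  show "g (sit (F x vs)) =
      (if F x vs < num_sit then (if F x vs < num_sit then g (sit (F x vs)) else 0) else g (sit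
          num_sit))" for x vs
    using sit_props by (metis not_le)
qed

lemma cf_st: "cf n F \<Longrightarrow> cf n (\<lambda>x vs. st (F x vs))"
  unfolding st_def by (rule cf_sit)
lemma cf_sy: "cf n F \<Longrightarrow> cf n (\<lambda>x vs. sy i (F x vs))"
  unfolding sy_def by (rule cf_sit)
lemma cf_nx: "cf n F \<Longrightarrow> cf n (\<lambda>x vs. nx (F x vs))"
  unfolding nx_def by (rule cf_sit)
lemma cf_wr: "cf n F \<Longrightarrow> cf n (\<lambda>x vs. wr i (F x vs))"
  unfolding wr_def by (rule cf_sit)
lemma cf_mv: "cf n F \<Longrightarrow> cf n (\<lambda>x vs. mv i (F x vs))"
  unfolding mv_def by (rule cf_sit)

lemma cf_local_ok:
  assumes "cf n T" "cf n C" "cf n W" "cf n E" "\<And>i. cf n (\<lambda>x vs. H x vs i)"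
      "\<And>i. cf n (\<lambda>x vs. L x vs i)"
  shows "cfp n (\<lambda>x vs. local_ok x (T x vs) (C x vs) (W x vs) (E x vs) (H x vs) (L x vs))"
  unfolding local_ok_def
  by (intro cf_conj cf_imp cf_less cf_le cf_eq cf_all_const cf_if_const cf_not cf_if cf_diff cf_add
      cf_input
      cf_st cf_sy cf_const assms)

lemma cf_pair_ok:
  assumes "cf n T" "cf n W" "cf n E" "\<And>i. cf n (\<lambda>x vs. H x vs i)" "\<And>i. cf n (\<lambda>x vs. L x vs i)"
    "cf n W'" "cf n E'" "\<And>i. cf n (\<lambda>x vs. H' x vs i)" "\<And>i. cf n (\<lambda>x vs. L' x vs i)"
  shows "cfp n (\<lambda>x vs. pair_ok (T x vs) (W x vs) (E x vs) (H x vs) (L x vs)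
    (W' x vs) (E' x vs) (H' x vs) (L' x vs))"
  unfolding pair_ok_def
  by (intro cf_conj cf_imp cf_less cf_le cf_eq cf_all_const cf_not cf_diff cf_add cf_Suc
      cf_st cf_sy cf_nx cf_wr cf_mv cf_const assms)

text \<open>Functions decoded from digits agree with those of a trace only on the indices of
  tapes.\<close>

lemma local_ok_cong:
  assumes "\<forall>i<K. h i = h' i \<and> l i = l' i"
  shows "local_ok x T c v e h l = local_ok x T c v e h' l'"
  using assms unfolding local_ok_def by (simp cong: conj_cong)

lemma pair_ok_cong:
  assumes "\<forall>i<K. h i = g i \<and> l i = k i" "\<forall>i<K. h' i = g' i \<and> l' i = k' i"
  shows "pair_ok T v e h l v' e' h' l' = pair_ok T v e g k v' e' g' k'"
proof -
  have "(1 :: nat) < K" using tapes_ge by simp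
  then show ?thesis using assms unfolding pair_ok_def by (simp cong: conj_cong)
qed

end

locale np_verifier = verifier +
  fixes p q :: "nat poly" and L :: "bool list set"
  assumes halts: "halted V (tm_run V [x, w] (poly p (length x + length w)))"
    and L: "x \<in> L \<longleftrightarrow> (\<exists>w. length w \<le> poly q (length x) \<and>
      fst (tm_run V [x, w] (poly p (length x + length w))) = tm_accept V)"
begin

definition cert :: "bool list \<Rightarrow> nat" where "cert x = poly q (length x)"
text \<open>The summand 2 guarantees at least three cells and makes \<open>horizon x - 1\<close>,
  the number of machine steps described, no smaller than the running time.\<close>

definition horizon :: "bool list \<Rightarrow> nat" where "horizon x = poly p (length x + cert x) + 2"
text \<open>Exceeds every digit: step numbers and previous visits are at most
  \<open>horizon x\<close>, head positions at most twice that, situations below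
  \<open>num_sit\<close>.\<close>

definition base :: "bool list \<Rightarrow> nat" where "base x = 2 * horizon x + 2 + num_sit"
text \<open>The exponent depends on the verifier only, so this is polynomial in the length of the
  input.\<close>

definition num_vals :: "bool list \<Rightarrow> nat" where "num_vals x = base x ^ (2 + 2 * K)"

text \<open>The value of the cell of step \<open>v\<close> has the digits \<open>v\<close>, \<open>e\<close>, \<open>h 0, h 1, \<dots>\<close>,
  \<open>l 0, l 1, \<dots>\<close> in base \<open>base x\<close>; cell 0 has the value 0 and serves as the reference for shifts.\<close>

definition heads :: "bool list \<Rightarrow> nat \<Rightarrow> nat \<Rightarrow> nat" where
  "heads x c i = digit (base x) c (2 + i)"
definition lasts :: "bool list \<Rightarrow> nat \<Rightarrow> nat \<Rightarrow> nat" where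
  "lasts x c i = digit (base x) c (2 + K + i)"
definition code_ok :: "bool list \<Rightarrow> nat \<Rightarrow> nat \<Rightarrow> bool" where
  "code_ok x v c \<longleftrightarrow> digit (base x) c 0 = v \<and> (v = 0 \<longrightarrow> c = 0) \<and>
     (0 < v \<longrightarrow> local_ok x (horizon x) (cert x) v (digit (base x) c 1) (heads x c) (lasts x c))"
definition codes_ok :: "bool list \<Rightarrow> nat \<Rightarrow> nat \<Rightarrow> nat \<Rightarrow> nat \<Rightarrow> bool" where
  "codes_ok x v c v' c' \<longleftrightarrow> (0 < v \<and> v < v' \<longrightarrow>
     pair_ok (horizon x) v (digit (base x) c 1) (heads x c) (lasts x c)
       v' (digit (base x) c' 1) (heads x c') (lasts x c'))"
text \<open>\<open>codes_ok\<close> is directed in time and is demanded both ways to make the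
  relation symmetric. Conditions on a single cell are included because each cell takes part in some
  pair.\<close>

definition rel :: "bool list \<Rightarrow> nat \<Rightarrow> nat \<Rightarrow> nat \<Rightarrow> nat \<Rightarrow> bool" where
  "rel x v v' c c' \<longleftrightarrow> code_ok x v c \<and> code_ok x v' c' \<and> codes_ok x v c v' c' \<and> codes_ok x v' c' v c"

lemma rel_sym: "rel x v v' c c' \<Longrightarrow> rel x v' v c' c"
  by (simp add: rel_def)

lemma rel_ref: "rel x 0 v c c' \<Longrightarrow> c = 0"
  by (simp add: rel_def code_ok_def)

text \<open>Digit 0 of a value is the number of its cell.\<close>

lemma rel_neq: "rel x v v' c c' \<Longrightarrow> v \<noteq> v' \<Longrightarrow> c \<noteq> c'"
  by (auto simp: rel_def code_ok_def)

lemma cf_cert: "cf n (\<lambda>x vs. cert x)"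
  unfolding cert_def by (intro cf_poly cf_length)
lemma cf_horizon: "cf n (\<lambda>x vs. horizon x)"
  unfolding horizon_def by (intro cf_poly cf_length cf_add cf_const cf_cert)
lemma cf_base: "cf n (\<lambda>x vs. base x)"
  unfolding base_def by (intro cf_add cf_mult cf_const cf_horizon)
lemma cf_num_vals: "cf n (\<lambda>x vs. num_vals x)"
  unfolding num_vals_def by (intro cf_power cf_base)

lemma cf_code_ok: "cf n F \<Longrightarrow> cf n G \<Longrightarrow> cfp n (\<lambda>x vs. code_ok x (F x vs) (G x vs))"
  unfolding code_ok_def heads_def lasts_def
  by (intro cf_conj cf_imp cf_eq cf_less cf_local_ok cf_digit cf_const cf_base cf_horizon cf_cert)

lemma cf_codes_ok: "cf n F \<Longrightarrow> cf n G \<Longrightarrow> cf n F' \<Longrightarrow> cf n G' \<Longrightarrow>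
    cfp n (\<lambda>x vs. codes_ok x (F x vs) (G x vs) (F' x vs) (G' x vs))"
  unfolding codes_ok_def heads_def lasts_def
  by (intro cf_conj cf_imp cf_eq cf_less cf_pair_ok cf_digit cf_const cf_base cf_horizon cf_cert)

lemma cf_rel: "cf n F1 \<Longrightarrow> cf n F2 \<Longrightarrow> cf n F3 \<Longrightarrow> cf n F4 \<Longrightarrow>
    cfp n (\<lambda>x vs. rel x (F1 x vs) (F2 x vs) (F3 x vs) (F4 x vs))"
  unfolding rel_def by (intro cf_conj cf_code_ok cf_codes_ok)

text \<open>For any admissible certificate the verifier has halted by then, and a halting
  configuration no longer changes.\<close>

lemma run_horizon:
  assumes "length w \<le> cert x"
  shows "tm_run V [x, w] (horizon x - 1) = tm_run V [x, w] (poly p (length x + length w))"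
proof -
  have "poly p (length x + length w) \<le> horizon x - 1"
    using poly_nat_mono[of "length x + length w" "length x + cert x" p] assms
        by (simp add: horizon_def)
  then show ?thesis using halts[of x w] unfolding tm_run_def by (intro halted_later)
qed

lemma solvable_iff:
  "(\<exists>g. (\<forall>v<horizon x + 1. g v < num_vals x) \<and>
      (\<forall>v<horizon x + 1. \<forall>v'<horizon x + 1. v \<noteq> v' \<longrightarrow> rel x v v' (g v) (g v'))) \<longleftrightarrow> x \<in> L"
    (is "?S \<longleftrightarrow> _")
proof
  let ?T = "horizon x"
  have T: "1 \<le> ?T" by (simp add: horizon_def)
  assume ?S
  then obtain g where g: "\<And>v v'. v \<le> ?T \<Longrightarrow> v' \<le> ?T \<Longrightarrow> v \<noteq> v' \<Longrightarrow> rel x v v' (g v) (g v')"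
    by (metis less_Suc_eq_le Suc_eq_plus1)
  have "trace_ok x ?T (cert x) (\<lambda>v. digit (base x) (g v) 1) (\<lambda>v. heads x (g v)) (\<lambda>v. lasts x (g v))"
    unfolding trace_ok_def
  proof (intro conjI ballI impI)
    fix v assume v: "v \<in> {1..?T}"
    \<comment> \<open>Pairing with the reference cell gives access to the condition on the single
      cell \<open>v\<close>.\<close>
    then have "rel x 0 v (g 0) (g v)" by (intro g) auto
    then show "local_ok x ?T (cert x) v (digit (base x) (g v) 1) (heads x (g v)) (lasts x (g v))"
      using v by (auto simp: rel_def code_ok_def)
    fix v' assume v': "v' \<in> {1..?T}" "v < v'"
    then have "rel x v v' (g v) (g v')" using v by (intro g) auto
    then show "pair_ok ?T v (digit (base x) (g v) 1) (heads x (g v)) (lasts x (g v))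
        v' (digit (base x) (g v') 1) (heads x (g v')) (lasts x (g v'))"
      using v v' by (auto simp: rel_def codes_ok_def)
  qed
  then obtain w where w: "length w \<le> cert x" "fst (tm_run V [x, w] (?T - 1)) = tm_accept V"
    using trace_sound T by blast
  then show "x \<in> L" unfolding L using run_horizon[OF w(1)] by (auto simp: cert_def)
next
  let ?T = "horizon x"
  have T: "1 \<le> ?T" by (simp add: horizon_def)
  assume "x \<in> L"
  then obtain w where w: "length w \<le> cert x" "fst (tm_run V [x, w] (poly p (length x + length w)))
      = tm_accept V"
    unfolding L cert_def by blast
  then have "fst (tm_run V [x, w] (?T - 1)) = tm_accept V" using run_horizon by simp
  then obtain e h l where tr: "trace_ok x ?T (cert x) e h l"
    and hl: "\<forall>v\<in>{1..?T}. \<forall>i<K. h v i \<le> 2 * ?T \<and> l v i < ?T"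
    using trace_complete[OF _ w(1) T] by blast
  have loc: "local_ok x ?T (cert x) v (e v) (h v) (l v)" if "v \<in> {1..?T}" for v
    using tr that by (auto simp: trace_ok_def)
  have "\<exists>c<num_vals x. digit (base x) c 0 = v \<and> digit (base x) c 1 = e v \<and>
      (\<forall>i<K. heads x c i = h v i \<and> lasts x c i = l v i)" if v: "v \<in> {1..?T}" for v
  proof -
    \<comment> \<open>The list of digits, in the order in which \<open>heads\<close> and
      \<open>lasts\<close> decode them.\<close>
    define f where "f j = (if j = 0 then v else if j = 1 then e v
      else if j < 2 + K then h v (j - 2) else l v (j - (2 + K)))" for j
    have "f j < base x" if "j < 2 + 2 * K" for j
    proof -
      have "v < base x" "e v < base x" using loc[OF v] v by (auto simp: base_def local_ok_def)
      moreover have "h v i < base x \<and> l v i < base x" if "i < K" for i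
        using hl v that by (force simp: base_def)
      ultimately show ?thesis using that by (auto simp: f_def)
    qed
    then obtain c where c: "c < base x ^ (2 + 2 * K)" "\<forall>j<2 + 2 * K. digit (base x) c j = f j"
      using ex_digits[of "2 + 2 * K" f "base x"] by blast
    moreover have "digit (base x) c 0 = v" "digit (base x) c 1 = e v" using c(2)
        by (auto simp: f_def)
    moreover have "heads x c i = h v i \<and> lasts x c i = l v i" if "i < K" for i
      using c(2) that by (simp add: f_def heads_def lasts_def)
    ultimately show ?thesis unfolding num_vals_def by blast
  qed
  then obtain c where c: "\<And>v. v \<in> {1..?T} \<Longrightarrow> c v < num_vals x \<and> digit (base x) (c v) 0 = v \<and>
      digit (base x) (c v) 1 = e v \<and> (\<forall>i<K. heads x (c v) i = h v i \<and> lasts x (c v) i = l v i)"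
    by metis
  define g where "g v = (if v = 0 then 0 else c v)" for v
  have "code_ok x v (g v)" if "v \<le> ?T" for v
  proof (cases "v = 0")
    case True
    then show ?thesis by (simp add: code_ok_def g_def digit_def)
  next
    case False
    then have v: "v \<in> {1..?T}" using that by simp
    then show ?thesis
      using c[OF v] loc[OF v] local_ok_cong[of "heads x (c v)" "h v" "lasts x (c v)" "l v"] False
      by (simp add: code_ok_def g_def)
  qed
  moreover have "codes_ok x v (g v) v' (g v')" if "v \<le> ?T" "v' \<le> ?T" for v v'
    unfolding codes_ok_def
  proof
    assume vv: "0 < v \<and> v < v'"
    then have v: "v \<in> {1..?T}" "v' \<in> {1..?T}" using that by auto
    then have "pair_ok ?T v (e v) (h v) (l v) v' (e v') (h v') (l v')"
      using tr vv by (auto simp: trace_ok_def)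
    then show "pair_ok ?T v (digit (base x) (g v) 1) (heads x (g v)) (lasts x (g v))
        v' (digit (base x) (g v') 1) (heads x (g v')) (lasts x (g v'))"
      using c[OF v(1)] c[OF v(2)] vv
        pair_ok_cong[of "heads x (c v)" "h v" "lasts x (c v)" "l v" "heads x (c v')" "h v'"
            "lasts x (c v')" "l v'"]
      by (simp add: g_def)
  qed
  moreover have "g v < num_vals x" if "v \<le> ?T" for v
    using c[of v] that by (auto simp: g_def num_vals_def base_def)
  ultimately show ?S by (intro exI[of _ g]) (auto simp: rel_def less_Suc_eq_le)
qed

abbreviation "num_cells x \<equiv> horizon x + 1"
abbreviation "modulus x \<equiv> 8 * num_vals x ^ 3"
abbreviation "shifted x \<equiv> shift_rel (num_vals x) (rel x)"

lemma num_vals_pos: "0 < num_vals x"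
  by (simp add: num_vals_def base_def)

lemma shift_csp_shifted:
  assumes "kappa = 1 \<or> kappa = num_cells x"
  shows "shift_csp (num_cells x) (modulus x) kappa (shifted x)"
proof
  show "3 \<le> num_cells x" by (simp add: horizon_def)
  show "0 < modulus x" using num_vals_pos[of x] by simp
  show "kappa = 1 \<or> kappa = num_cells x" by (rule assms)
  show "shifted x v' v c' c" if "shifted x v v' c c'" for v v' c c'
    by (rule shift_rel_sym[OF _ that]) (rule rel_sym)
  show "shifted x v v' ((c + r) mod modulus x) ((c' + r) mod modulus x)" if "shifted x v v' c c'"
      for v v' c c' r
    using that by (rule shift_rel_shift)
qed

lemma solvable_shifted:
  assumes "kappa = 1 \<or> kappa = num_cells x"
  shows "shift_csp.solvable (num_cells x) (modulus x) (shifted x) \<longleftrightarrow> x \<in> L"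
  unfolding shift_csp.solvable_def[OF shift_csp_shifted[OF assms]] solvable_iff[symmetric]
  by (rule shift_rel_solvable_iff[OF num_vals_pos rel_ref rel_neq])

lemma cf_modulus: "cf n (\<lambda>x vs. modulus x)"
  by (intro cf_mult cf_power cf_const cf_num_vals)
lemma cf_num_cells: "cf n (\<lambda>x vs. num_cells x)"
  by (intro cf_add cf_const cf_horizon)

text \<open>With \<open>kappa = 1\<close> wild cards have probability 0, so that membership already
  amounts to solvability.\<close>

theorem karp_reducible_membership: "karp_reducible L CUT_membership"
proof -
  interpret computable_csp num_cells modulus "\<lambda>_. 1" shifted
    by (rule computable_csp.intro)
      (simp_all only: shift_csp_shifted cf_num_cells cf_modulus cf_const cf_shift_rel[OF cf_rel
          cf_num_vals] simp_thms)
  have inst: "symmetric_rat_mat (lit_count x + 2) (matrix x)"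
    "map_mat of_rat (matrix x) \<in> CUT (lit_count x + 2) \<longleftrightarrow> x \<in> L" for x
  proof -
    interpret I: shift_csp "num_cells x" "modulus x" 1 "shifted x" by (rule csp)
    show "symmetric_rat_mat (lit_count x + 2) (matrix x)" by (rule I.symmetric_Gamma)
    show "map_mat of_rat (matrix x) \<in> CUT (lit_count x + 2) \<longleftrightarrow> x \<in> L"
      unfolding I.map_Gamma I.moment_matrix_in_CUT_iff[OF refl]
          by (rule solvable_shifted[of 1]) simp
  qed
  show ?thesis
    unfolding CUT_membership_def
    by (rule karp_reducibleI[where enc = encode_membership, OF polytime_computable_membership])
        (simp_all only: prod.case inst)
qed

text \<open>With \<open>kappa\<close> equal to the number of cells, the promise holds for every
  \<open>x\<close>, also outside \<open>L\<close>; only the rank depends on solvability.\<close>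

theorem karp_reducible_rank: "karp_reducible L CUT_rank"
proof -
  interpret computable_csp num_cells modulus num_cells shifted
    by (rule computable_csp.intro)
      (simp_all only: shift_csp_shifted cf_num_cells cf_modulus cf_const cf_shift_rel[OF cf_rel
          cf_num_vals] simp_thms)
  have inst: "symmetric_rat_mat (lit_count x + 2) (matrix x)"
    "map_mat of_rat (matrix x) \<in> CUT (lit_count x + 2)"
    "cut_rank_le (lit_count x + 2) (modulus x + 1 + pair_count x) (map_mat of_rat (matrix x)) \<longleftrightarrow>
        x \<in> L" for x
  proof -
    interpret I: shift_csp "num_cells x" "modulus x" "num_cells x" "shifted x" by (rule csp)
    show "symmetric_rat_mat (lit_count x + 2) (matrix x)" by (rule I.symmetric_Gamma)
    show "map_mat of_rat (matrix x) \<in> CUT (lit_count x + 2)"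
      unfolding I.map_Gamma by (rule I.moment_matrix_in_CUT[OF refl])
    show "cut_rank_le (lit_count x + 2) (modulus x + 1 + pair_count x) (map_mat of_rat (matrix x)) \<longleftrightarrow>
        x \<in> L"
      unfolding I.map_Gamma I.num_pairs_def I.cut_rank_le_moment_matrix_iff[OF refl]
      by (rule solvable_shifted[of "num_cells x"]) simp
  qed
  show ?thesis
    unfolding CUT_rank_def
    by (rule karp_reducibleI[where enc = encode_rank, OF polytime_computable_rank]; unfold
        prod.case)
      (intro conjI inst, simp, rule inst)
qed

end

theorem mainTheorem5:
  shows "NP_hard CUT_membership \<and> NP_hard CUT_rank"
proof -
  have "karp_reducible L CUT_membership \<and> karp_reducible L CUT_rank" if L: "L \<in> NP_languages" for L
  proof -
    obtain M p q where M: "wf_tm M" "2 \<le> tm_tapes M"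
      "\<And>x w. halted M (tm_run M [x, w] (poly p (length x + length w)))"
      "\<And>x. x \<in> L \<longleftrightarrow> (\<exists>w. length w \<le> poly q (length x) \<and>
         fst (tm_run M [x, w] (poly p (length x + length w))) = tm_accept M)"
      using L unfolding NP_languages_def by blast
    interpret np_verifier M p q L
      by unfold_locales (rule M)+
    show ?thesis using karp_reducible_membership karp_reducible_rank by blast
  qed
  then show ?thesis unfolding NP_hard_def by blast
qed

end
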